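(* (a) Let $1\le p<q\le2$ and $1\le r\le q$. There is a constant $C_{p,q}$ such that for every $f\in L^{p,\infty}(S)$ and every $\lambda\in S_q=\{z\in\mathbb C:|\Im z|\le\gamma_q\rho\}$, $$\|\widetilde f(\lambda,\cdot)\|_{L^r(N,P_1)}\le C_{p,q}\,\|f\|^\ast_{p,\infty}.$$ (b) Let $1\le p<q<2$. For every $\lambda\in S_q^\circ$ there is a constant $C_{\lambda,p,q}$ such that for every $f\in L^{p,\infty}(S)$, $$\|\widetilde f(\lambda,\cdot)\|^\ast_{L^{q,1}(N,P_1)}\le C_{\lambda,p,q}\,\|f\|^\ast_{p,\infty}.$$ (c) Let $1\le p<q<q_1\le2$. There is a constant $C_{p,q,q_1}$ such that for every $f\in L^{p,\infty}(S)$ and every $\lambda\in\mathbb R$, $$\|\widetilde f(\lambda+i\gamma_{q_1}\rho,\cdot)\|^\ast_{L^{q,1}(N,P_1)}\le C_{p,q,q_1}\,\|f\|^\ast_{p,\infty}.$$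
   Context: Let $\mathfrak n=\mathfrak v\oplus\mathfrak z$ be an $H$-type Lie algebra: a two-step nilpotent real Lie algebra with inner product, with centre $\mathfrak z$ and orthogonal complement $\mathfrak v$, $\dim\mathfrak v=m\ge1$, $\dim\mathfrak z=k\ge1$, such that for each $Z\in\mathfrak z$ the map $J_Z:\mathfrak v\to\mathfrak v$ given by $\langle J_ZX,X'\rangle=\langle Z,[X,X']\rangle$ satisfies $J_Z^2=-|Z|^2I$. Let $N=\exp\mathfrak n$ be the simply connected group, identified with $\mathbb R^m\times\mathbb R^k$ via $\exp$, with Lebesgue measure $dn$. Let $A=\{a_t=e^t:t\in\mathbb R\}$ act on $N$ by $a_t(X,Y)a_{-t}=(e^{t/2}X,e^{t}Y)$ and let $S=NA$ be the semidirect product (a Damek-Ricci space). Put $Q=m/2+k$, $\rho=Q/2$. The left Haar measure on $S$ is $\int_Sf(x)\,dx=\int_N\int_{\mathbb R}f(na_t)e^{-2\rho t}\,dt\,dn$. Poisson kernel: $P_{a_t}(V,Z)=C\,e^{tQ}\left(\left(e^t+|V|^2/4\right)^2+|Z|^2\right)^{-Q}$ for $(V,Z)\in N$, with $C$ chosen so that $\int_NP_{a_t}(n)\,dn=1$; $P_1=P_{a_0}$; $\mathcal P(n_1a_t,n)=P_{a_t}(n^{-1}n_1)$; and $\mathcal P_\lambda(x,n)=\mathcal P(x,n)^{1/2-i\lambda/Q}$ for $\lambda\in\mathbb C$. The Fourier transform of $f$ on $S$ is $\widetilde f(\lambda,n)=\int_Sf(x)\mathcal P_\lambda(x,n)\,dx$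 whenever the integral converges. For $p\in[1,\infty)$: $\gamma_p=2/p-1$. $S_q^\circ$ is the interior of $S_q$. $L^r(N,P_1)$ and $L^{q,1}(N,P_1)$ are the Lebesgue and Lorentz spaces on the measure space $(N,P_1(n)\,dn)$. Lorentz norms on a measure space: $\|f\|^\ast_{p,q}=\left(\frac qp\int_0^\infty[t^{1/p}f^*(t)]^q\frac{dt}t\right)^{1/q}$ for $p,q<\infty$ and $\|f\|^\ast_{p,\infty}=\sup_{t>0}t^{1/p}f^*(t)$, where $f^*$ is the nonincreasing rearrangement; $L^{p,q}$ is the space of measurable functions for which this is finite.
   Formalization: For p = 1 the space L^{1,∞}(S) and its norm are replaced by L^{1,1}(S) = L^1(S): the literal claim fails there, since |x|^{-d} (d = dim S) on a ball about the identity is in L^{1,∞} but its Fourier integral diverges for every n and λ. *)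

theory Defs
  imports "HOL-Analysis.Analysis"
begin

section \<open>H-type Lie algebras\<close>

text \<open>
  The Lie algebra is the orthogonal direct sum of the inner product spaces
  \<^typ>\<open>'v::euclidean_space\<close> and \<^typ>\<open>'z::euclidean_space\<close>, that is the product type
  \<^typ>\<open>('v::euclidean_space) \<times> ('z::euclidean_space)\<close> with its standard inner product.
  Both dimensions are arbitrary and automatically at least 1.
\<close>

definition lie_centre :: "('a::zero \<Rightarrow> 'a \<Rightarrow> 'a) \<Rightarrow> 'a set" where
  "lie_centre br = {c. \<forall>x. br c x = 0}"

text \<open>
  \<open>J\<^sub>Z X\<close> is the adjoint of \<open>X' \<mapsto> [X, X']\<close> applied to \<open>Z\<close>; the lemma \<open>inner_J_map\<close> below
  gives the defining identity.
\<close>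

definition J_map ::
    "('v::euclidean_space \<times> 'z::euclidean_space \<Rightarrow> 'v \<times> 'z \<Rightarrow> 'v \<times> 'z) \<Rightarrow> 'z \<Rightarrow> 'v \<Rightarrow> 'v" where
  "J_map br Z X = adjoint (\<lambda>X'. snd (br (X, 0) (X', 0))) Z"

locale h_type =
  fixes br :: "'v::euclidean_space \<times> 'z::euclidean_space \<Rightarrow> 'v \<times> 'z \<Rightarrow> 'v \<times> 'z"
  assumes bilinear: "bilinear br"
    and alternating: "br x x = 0"
    and jacobi: "br x (br y w) + br y (br w x) + br w (br x y) = 0"
    and two_step: "br (br x y) w = 0"
    and centre: "lie_centre br = {0} \<times> UNIV"
    and J_square: "J_map br Z (J_map br Z X) = - ((norm Z)\<^sup>2 *\<^sub>R X)"

lemma (in h_type) inner_J_map: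
  "J_map br Z X \<bullet> X' = (0, Z) \<bullet> br (X, 0) (X', 0)"
proof -
  have "linear (br (X, 0))"
    using bilinear by (simp add: bilinear_def)
  moreover have "linear (\<lambda>X'. (X', 0) :: 'v \<times> 'z)"
    by (auto intro!: linearI)
  ultimately have "linear (snd \<circ> (br (X, 0) \<circ> (\<lambda>X'. (X', 0))))"
    by (intro linear_compose) (auto simp: linear_snd)
  then have "linear (\<lambda>X'. snd (br (X, 0) (X', 0)))"
    by (simp add: o_def)
  then have "X' \<bullet> adjoint (\<lambda>X'. snd (br (X, 0) (X', 0))) Z = snd (br (X, 0) (X', 0)) \<bullet> Z"
    by (rule adjoint_works)
  then show ?thesis
    by (simp add: J_map_def inner_prod_def inner_commute)
qed


section \<open>The Damek--Ricci space\<close>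

text \<open>
  The group \<open>N\<close> is the Lie algebra itself in exponential coordinates. By the
  Baker--Campbell--Hausdorff formula its product is the one below, and the inverse of \<open>n\<close> is \<open>- n\<close>.
\<close>

definition N_mult :: "('a::real_vector \<Rightarrow> 'a \<Rightarrow> 'a) \<Rightarrow> 'a \<Rightarrow> 'a \<Rightarrow> 'a" where
  "N_mult br x y = x + y + (1/2) *\<^sub>R br x y"

text \<open>The bracket argument of \<open>hom_dim\<close> only serves to determine the two types.\<close>

definition hom_dim ::
    "('v::euclidean_space \<times> 'z::euclidean_space \<Rightarrow> 'v \<times> 'z \<Rightarrow> 'v \<times> 'z) \<Rightarrow> real" where
  "hom_dim br = real DIM('v) / 2 + real DIM('z)"

definition rho ::
    "('v::euclidean_space \<times> 'z::euclidean_space \<Rightarrow> 'v \<times> 'z \<Rightarrow> 'v \<times> 'z) \<Rightarrow> real" where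
  "rho br = hom_dim br / 2"

text \<open>
  The point \<open>n a\<^sub>t\<close> of \<open>S = N A\<close>, where \<open>a\<^sub>t = e\<^sup>t\<close>, is represented by the pair \<open>(n, t)\<close>.
\<close>

definition haar_S ::
    "('v::euclidean_space \<times> 'z::euclidean_space \<Rightarrow> 'v \<times> 'z \<Rightarrow> 'v \<times> 'z)
     \<Rightarrow> (('v \<times> 'z) \<times> real) measure" where
  "haar_S br = density lborel (\<lambda>(n, t). ennreal (exp (- 2 * rho br * t)))"

definition poisson_unnormalized ::
    "('v::euclidean_space \<times> 'z::euclidean_space \<Rightarrow> 'v \<times> 'z \<Rightarrow> 'v \<times> 'z)
     \<Rightarrow> real \<Rightarrow> 'v \<times> 'z \<Rightarrow> real" where
  "poisson_unnormalized br t = (\<lambda>(V, Z).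
     exp (t * hom_dim br) *
     ((exp t + (norm V)\<^sup>2 / 4)\<^sup>2 + (norm Z)\<^sup>2) powr (- hom_dim br))"

text \<open>
  The integral of the unnormalized kernel over \<open>N\<close> does not depend on \<open>t\<close>: substitute
  \<open>(V, Z) = (e\<^bsup>t/2\<^esup> V', e\<^sup>t Z')\<close>. Normalizing at \<open>t = 0\<close> therefore normalizes every kernel.
\<close>

definition poisson_const ::
    "('v::euclidean_space \<times> 'z::euclidean_space \<Rightarrow> 'v \<times> 'z \<Rightarrow> 'v \<times> 'z) \<Rightarrow> real" where
  "poisson_const br = 1 / (LINT n|lborel. poisson_unnormalized br 0 n)"

definition poisson ::
    "('v::euclidean_space \<times> 'z::euclidean_space \<Rightarrow> 'v \<times> 'z \<Rightarrow> 'v \<times> 'z)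
     \<Rightarrow> real \<Rightarrow> 'v \<times> 'z \<Rightarrow> real" where
  "poisson br t n = poisson_const br * poisson_unnormalized br t n"

definition poisson_S ::
    "('v::euclidean_space \<times> 'z::euclidean_space \<Rightarrow> 'v \<times> 'z \<Rightarrow> 'v \<times> 'z)
     \<Rightarrow> ('v \<times> 'z) \<times> real \<Rightarrow> 'v \<times> 'z \<Rightarrow> real" where
  "poisson_S br = (\<lambda>(n1, t) n. poisson br t (N_mult br (- n) n1))"

definition poisson_power ::
    "('v::euclidean_space \<times> 'z::euclidean_space \<Rightarrow> 'v \<times> 'z \<Rightarrow> 'v \<times> 'z)
     \<Rightarrow> complex \<Rightarrow> ('v \<times> 'z) \<times> real \<Rightarrow> 'v \<times> 'z \<Rightarrow> complex" where
  "poisson_power br \<zeta> x n =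
     complex_of_real (poisson_S br x n) powr (1/2 - \<i> * \<zeta> / complex_of_real (hom_dim br))"

definition fourier_converges ::
    "('v::euclidean_space \<times> 'z::euclidean_space \<Rightarrow> 'v \<times> 'z \<Rightarrow> 'v \<times> 'z)
     \<Rightarrow> (('v \<times> 'z) \<times> real \<Rightarrow> complex) \<Rightarrow> complex \<Rightarrow> 'v \<times> 'z \<Rightarrow> bool" where
  "fourier_converges br f \<zeta> n \<longleftrightarrow> integrable (haar_S br) (\<lambda>x. f x * poisson_power br \<zeta> x n)"

text \<open>Meaningful where \<^const>\<open>fourier_converges\<close> holds; elsewhere it is 0 by convention.\<close>

definition fourier_S ::
    "('v::euclidean_space \<times> 'z::euclidean_space \<Rightarrow> 'v \<times> 'z \<Rightarrow> 'v \<times> 'z)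
     \<Rightarrow> (('v \<times> 'z) \<times> real \<Rightarrow> complex) \<Rightarrow> complex \<Rightarrow> 'v \<times> 'z \<Rightarrow> complex" where
  "fourier_S br f \<zeta> n = (LINT x|haar_S br. f x * poisson_power br \<zeta> x n)"

definition poisson_measure ::
    "('v::euclidean_space \<times> 'z::euclidean_space \<Rightarrow> 'v \<times> 'z \<Rightarrow> 'v \<times> 'z) \<Rightarrow> ('v \<times> 'z) measure" where
  "poisson_measure br = density lborel (\<lambda>n. ennreal (poisson br 0 n))"

definition lp_gamma :: "real \<Rightarrow> real" where
  "lp_gamma p = 2 / p - 1"

definition strip ::
    "('v::euclidean_space \<times> 'z::euclidean_space \<Rightarrow> 'v \<times> 'z \<Rightarrow> 'v \<times> 'z) \<Rightarrow> real \<Rightarrow> complex set" where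
  "strip br q = {z. \<bar>Im z\<bar> \<le> lp_gamma q * rho br}"


section \<open>Lebesgue and Lorentz norms\<close>

text \<open>Only used for exponents \<open>a > 0\<close>.\<close>

definition enn_powr :: "ennreal \<Rightarrow> real \<Rightarrow> ennreal" where
  "enn_powr x a = (if x = \<infinity> then \<infinity> else ennreal (enn2real x powr a))"

definition Lebesgue_norm :: "'a measure \<Rightarrow> real \<Rightarrow> ('a \<Rightarrow> complex) \<Rightarrow> ennreal" where
  "Lebesgue_norm M r f = enn_powr (\<integral>\<^sup>+x. ennreal (norm (f x) powr r) \<partial>M) (1 / r)"

definition rearrangement :: "'a measure \<Rightarrow> ('a \<Rightarrow> complex) \<Rightarrow> real \<Rightarrow> ennreal" where
  "rearrangement M f t =
     Inf {s. emeasure M {x \<in> space M. s < ennreal (norm (f x))} \<le> ennreal t}"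

definition Lorentz_norm :: "'a measure \<Rightarrow> real \<Rightarrow> ennreal \<Rightarrow> ('a \<Rightarrow> complex) \<Rightarrow> ennreal" where
  "Lorentz_norm M p q f =
     (if q = \<infinity> then (SUP t\<in>{0<..}. ennreal (t powr (1 / p)) * rearrangement M f t)
      else enn_powr
        (ennreal (enn2real q / p) *
         (\<integral>\<^sup>+t\<in>{0<..}. enn_powr (ennreal (t powr (1 / p)) * rearrangement M f t) (enn2real q)
                        * ennreal (1 / t) \<partial>lborel))
        (1 / enn2real q))"

definition Lorentz_space :: "'a measure \<Rightarrow> real \<Rightarrow> ennreal \<Rightarrow> ('a \<Rightarrow> complex) set" where
  "Lorentz_space M p q = {f \<in> borel_measurable M. Lorentz_norm M p q f < \<infinity>}"

text \<open>
  The second Lorentz index of the source space: \<open>\<infinity>\<close> for \<open>p > 1\<close>, whereas for \<open>p = 1\<close> the source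
  space is \<open>L\<^bsup>1,1\<^esup> = L\<^sup>1\<close>. No Fourier estimate holds on weak \<open>L\<^sup>1\<close>: with \<open>d = dim S\<close>, the functions
  \<open>min (|x|\<^bsup>-d\<^esup>) (\<epsilon>\<^bsup>-d\<^esup>)\<close> on the unit ball are bounded in weak \<open>L\<^sup>1\<close>, but their Fourier transforms
  at \<open>\<zeta> = 0\<close> are at least a constant times \<open>log (1/\<epsilon>)\<close> on compact sets of \<open>N\<close>; the limit
  \<open>|x|\<^bsup>-d\<^esup>\<close> is in weak \<open>L\<^sup>1\<close> and its Fourier integral diverges for every \<open>n\<close>.
\<close>

definition source_index :: "real \<Rightarrow> ennreal" where
  "source_index p = (if p = 1 then 1 else \<infinity>)"

end

theory Submission
  imports Defs
begin

text \<open>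
  Write \<open>a = 1/2 + Im \<zeta> / Q\<close>. The Fourier kernel has modulus \<open>\<P>(x, n)\<^sup>a\<close>, and \<open>\<zeta>\<close> lies in the
  strip \<open>S\<^sub>q\<close> exactly when \<open>1 - 1/q \<le> a \<le> 1/q\<close>. So everything follows from bounds for the positive
  operators \<open>T\<^sub>a \<phi>(n) = \<integral> \<phi>(x) \<P>(x, n)\<^sup>a dx\<close> (\<open>kernel_op\<close>), applied to \<open>\<phi> = |f|\<close>. A power of
  the kernel is at most the sum of the two powers with the extreme exponents, hence one constant
  serves the whole strip.

  The target space \<open>L\<^sup>q(N, P\<^sub>1)\<close> stays fixed while the source exponent varies below \<open>q\<close>. A function in
  weak \<open>L\<^sup>p\<close>, cut at height 1, is the sum of an \<open>L\<^sup>1\<close> function and an \<open>L\<^sup>r\<close> function with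
  \<open>p < r < q\<close>, so it suffices to treat these two spaces. The case of \<open>L\<^sup>1\<close> is Hoelder's inequality
  (\<open>kernel_op_L1\<close>). The case of \<open>L\<^sup>r\<close> (\<open>kernel_op_strong_type\<close>) is the core of the argument.

  There \<open>S\<close> is cut into the slices \<open>j \<le> t < j + 1\<close>. Translations of \<open>N\<close> preserve Lebesgue measure,
  and \<open>\<integral>\<^sub>N P\<^sub>t\<^sup>\<beta>\<close> is at most a constant times \<open>e\<close> to the \<open>Q t (1 - \<beta>)\<close> as soon as \<open>\<beta> > 1/2\<close>. A
  version of Young's inequality for integral kernels turns these two facts into the bound
  \<open>e\<close> to the \<open>Q j (1/u - a)\<close> for the norm of \<open>T\<^sub>a\<close> from \<open>L\<^sup>r\<close> of the slice to \<open>L\<^sup>u(N)\<close>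
  (\<open>kernel_op_slice_bound\<close>), for every \<open>u\<close> with \<open>1/u\<close> near \<open>a\<close>. A single such bound grows on one
  side, and at \<open>1/u = a\<close> it gives no decay in \<open>j\<close>. But if \<open>h\<^sub>j\<close> and \<open>h\<^sub>k\<close> are the contributions of
  two slices, Hoelder's inequality with the exponents \<open>1/u = a - \<epsilon>\<close> and \<open>1/v = a + \<epsilon>\<close> gives
  exponential decay of \<open>\<integral> (h\<^sub>j h\<^sub>k)\<close> to the power \<open>q/2\<close> in \<open>|j - k|\<close> (\<open>kernel_op_slice_pair\<close>). Since
  \<open>q/2 \<le> 1\<close>, the \<open>q\<close>-th power of \<open>\<Sum> h\<^sub>j\<close> is at most the double sum of those powers of
  \<open>h\<^sub>j h\<^sub>k\<close>, and the double sum is controlled by the \<open>L\<^sup>r\<close> norm (\<open>almost_orthogonal_sum\<close>).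

  For the Lorentz estimates, a point of the open strip, or of a boundary line of index \<open>q\<^sub>1 > q\<close>, lies
  in the closed strip of some index \<open>v > q\<close>; there \<open>L\<^sup>v\<close> bounds are available, and
  \<open>L\<^sup>v \<subseteq> L\<^bsup>q,1\<^esup>\<close> on a probability space (\<open>Lorentz_norm_q_1_le\<close>).
\<close>

section \<open>Powers and integral inequalities in the extended nonnegative reals\<close>

lemma enn_powr_ennreal [simp]: "0 \<le> x \<Longrightarrow> enn_powr (ennreal x) a = ennreal (x powr a)"
  by (simp add: enn_powr_def)

lemma enn_powr_top [simp]: "enn_powr top a = top"
  by (simp add: enn_powr_def)

lemma enn_powr_zero [simp]: "enn_powr 0 a = 0"
  by (simp add: enn_powr_def)

lemma enn_powr_one [simp]: "enn_powr x 1 = x"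
  by (cases x) auto

lemma enn_powr_1_left [simp]: "enn_powr 1 a = 1"
  using enn_powr_ennreal[of 1 a] by simp

lemma measurable_enn_powr [measurable]:
  assumes [measurable]: "f \<in> borel_measurable M"
  shows "(\<lambda>x. enn_powr (f x) a) \<in> borel_measurable M"
  unfolding enn_powr_def by measurable

lemma enn_powr_mono: "x \<le> y \<Longrightarrow> 0 < a \<Longrightarrow> enn_powr x a \<le> enn_powr y a"
  by (cases x; cases y) (auto intro!: ennreal_leI powr_mono2 simp: top_unique)

lemma enn_powr_mult: "0 < a \<Longrightarrow> enn_powr (x * y) a = enn_powr x a * enn_powr y a"
proof (cases x; cases y)
  fix r assume "0 < a" "0 \<le> r" "x = ennreal r" "y = top"
  then show ?thesis
    by (cases "r = 0") (auto simp: ennreal_mult_top ennreal_mult_eq_top_iff)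
next
  fix r assume "0 < a" "0 \<le> r" "y = ennreal r" "x = top"
  then show ?thesis
    by (cases "r = 0") (auto simp: ennreal_top_mult ennreal_mult_eq_top_iff)
qed (auto simp: powr_mult simp flip: ennreal_mult)

lemma enn_powr_add: "0 < a \<Longrightarrow> 0 < b \<Longrightarrow> enn_powr x (a + b) = enn_powr x a * enn_powr x b"
  by (cases x) (auto simp: powr_add simp flip: ennreal_mult)

lemma enn_powr_powr: "enn_powr (enn_powr x a) b = enn_powr x (a * b)"
  by (cases x) (auto simp: powr_powr)

lemma enn_powr_eq_0_iff: "enn_powr x a = 0 \<longleftrightarrow> x = 0"
  by (cases x) auto

lemma enn_powr_eq_top_iff: "enn_powr x a = top \<longleftrightarrow> x = top"
  by (cases x) auto

lemma enn_powr_sum_le: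
  assumes "0 < a"
  shows "enn_powr (x + y) a \<le> ennreal (2 powr a) * (enn_powr x a + enn_powr y a)"
proof -
  have "x + y \<le> ennreal 2 * max x y"
  proof -
    have "x + y \<le> max x y + max x y" by (intro add_mono) auto
    then show ?thesis by (simp add: mult_2)
  qed
  then have "enn_powr (x + y) a \<le> enn_powr (ennreal 2 * max x y) a"
    using assms by (rule enn_powr_mono)
  also have "\<dots> = ennreal (2 powr a) * enn_powr (max x y) a"
    using assms by (subst enn_powr_mult) (auto simp del: ennreal_numeral)
  also have "\<dots> \<le> ennreal (2 powr a) * (enn_powr x a + enn_powr y a)"
    by (intro mult_left_mono) (auto simp: max_def add_increasing add_increasing2)
  finally show ?thesis .
qed

text \<open>
  A quasi-triangle inequality; it glues together bounds for pieces of a function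
  without invoking Minkowski's inequality.
\<close>

lemma nn_integral_enn_powr_sum_le:
  assumes [measurable]: "g \<in> borel_measurable M" "h \<in> borel_measurable M" and q: "0 < q"
    and le: "\<And>x. f x \<le> g x + h x"
    and G: "(\<integral>\<^sup>+x. enn_powr (g x) q \<partial>M) \<le> ennreal G" and H: "(\<integral>\<^sup>+x. enn_powr (h x) q \<partial>M) \<le> ennreal H"
    and "0 < G" "0 < H"
  shows "(\<integral>\<^sup>+x. enn_powr (f x) q \<partial>M) \<le> ennreal (2 powr q * (G + H))"
proof -
  have "(\<integral>\<^sup>+x. enn_powr (f x) q \<partial>M) \<le> (\<integral>\<^sup>+x. ennreal (2 powr q) * (enn_powr (g x) q + enn_powr (h x) q) \<partial>M)"
    using enn_powr_mono[OF le q] enn_powr_sum_le[OF q] by (intro nn_integral_mono) (rule order_trans)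
  also have "\<dots> = ennreal (2 powr q) * ((\<integral>\<^sup>+x. enn_powr (g x) q \<partial>M) + (\<integral>\<^sup>+x. enn_powr (h x) q \<partial>M))"
    by (simp add: nn_integral_cmult nn_integral_add)
  also have "\<dots> \<le> ennreal (2 powr q) * (ennreal G + ennreal H)"
    by (intro mult_left_mono add_mono G H) auto
  finally show ?thesis using \<open>0 < G\<close> \<open>0 < H\<close> by (simp add: ennreal_mult)
qed

lemma Young_ennreal:
  assumes "0 < \<theta>" "0 < \<phi>" "\<theta> + \<phi> = 1"
  shows "enn_powr x \<theta> * enn_powr y \<phi> \<le> ennreal \<theta> * x + ennreal \<phi> * y"
proof (cases "x = 0 \<or> y = 0 \<or> x = top \<or> y = top")
  case True
  then show ?thesis
    using assms by (auto simp: ennreal_mult_top)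
next
  case False
  then obtain r s where rs: "x = ennreal r" "y = ennreal s" "0 < r" "0 < s"
    by (cases x; cases y) (auto simp: less_le)
  then have "r powr \<theta> * s powr \<phi> \<le> \<theta> * r + \<phi> * s"
    using assms by (intro Youngs_inequality_0) auto
  then show ?thesis
    using rs assms by (simp flip: ennreal_mult ennreal_plus)
qed

lemma enn_powr_mult_half_le:
  assumes "0 < b"
  shows "enn_powr (x * y) (b / 2) \<le> enn_powr x b + enn_powr y b"
proof -
  have "enn_powr (x * y) (b / 2) = enn_powr (enn_powr x b) (1 / 2) * enn_powr (enn_powr y b) (1 / 2)"
    using assms by (simp add: enn_powr_mult enn_powr_powr)
  also have "\<dots> \<le> ennreal (1 / 2) * enn_powr x b + ennreal (1 / 2) * enn_powr y b"
    by (rule Young_ennreal) auto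
  also have "\<dots> \<le> 1 * enn_powr x b + 1 * enn_powr y b"
  proof -
    have "ennreal (1 / 2) \<le> 1"
      using ennreal_leI[of "1 / 2" 1] unfolding ennreal_1 by simp
    then show ?thesis by (intro add_mono mult_right_mono) auto
  qed
  finally show ?thesis by simp
qed

text \<open>
  Weighted form: both factors are normalised by their integrals and then compared pointwise
  by Young's inequality for numbers. The cases where an integral is 0 or infinite are
  trivial but have to be split off, as the normalisation divides by it.
\<close>

lemma Hoelder_nn_integral:
  assumes [measurable]: "a \<in> borel_measurable M" "b \<in> borel_measurable M"
    and e: "0 < \<theta>" "0 < \<phi>" "\<theta> + \<phi> = 1"
  shows "(\<integral>\<^sup>+x. enn_powr (a x) \<theta> * enn_powr (b x) \<phi> \<partial>M)
    \<le> enn_powr (\<integral>\<^sup>+x. a x \<partial>M) \<theta> * enn_powr (\<integral>\<^sup>+x. b x \<partial>M) \<phi>"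
proof -
  let ?X = "\<integral>\<^sup>+x. a x \<partial>M" and ?Y = "\<integral>\<^sup>+x. b x \<partial>M"
  consider "?X = 0" | "?Y = 0" | "?X \<noteq> 0" "?Y \<noteq> 0" "?X = top \<or> ?Y = top"
    | "?X \<noteq> 0" "?Y \<noteq> 0" "?X \<noteq> top" "?Y \<noteq> top" by auto
  then show ?thesis
  proof cases
    case 1
    then have "AE x in M. a x = 0" by (simp add: nn_integral_0_iff_AE)
    then have "(\<integral>\<^sup>+x. enn_powr (a x) \<theta> * enn_powr (b x) \<phi> \<partial>M) = (\<integral>\<^sup>+x. 0 \<partial>M)"
      by (intro nn_integral_cong_AE) auto
    then show ?thesis by simp
  next
    case 2
    then have "AE x in M. b x = 0" by (simp add: nn_integral_0_iff_AE)
    then have "(\<integral>\<^sup>+x. enn_powr (a x) \<theta> * enn_powr (b x) \<phi> \<partial>M) = (\<integral>\<^sup>+x. 0 \<partial>M)"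
      by (intro nn_integral_cong_AE) auto
    then show ?thesis by simp
  next
    case 3
    then show ?thesis
      by (auto simp: ennreal_mult_top ennreal_top_mult enn_powr_eq_0_iff)
  next
    case 4
    then obtain r s where rs: "?X = ennreal r" "?Y = ennreal s" "0 < r" "0 < s"
      by (cases ?X; cases ?Y) (auto simp: less_le)
    have pt: "enn_powr (a x) \<theta> * enn_powr (b x) \<phi> \<le> ennreal (r powr \<theta> * s powr \<phi>) *
        (ennreal \<theta> * (a x * ennreal (1/r)) + ennreal \<phi> * (b x * ennreal (1/s)))" for x
    proof -
      have 1: "a x = ennreal r * (a x * ennreal (1/r))" "b x = ennreal s * (b x * ennreal (1/s))"
        using ennreal_mult[of r "1/r"] ennreal_mult[of s "1/s"] rs
        by (simp_all add: mult.left_commute[of "ennreal _"])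
      have "enn_powr (a x) \<theta> * enn_powr (b x) \<phi> =
        enn_powr (ennreal r * (a x * ennreal (1/r))) \<theta> * enn_powr (ennreal s * (b x * ennreal (1/s))) \<phi>"
        using 1 by simp
      also have "\<dots> = ennreal (r powr \<theta> * s powr \<phi>) *
        (enn_powr (a x * ennreal (1/r)) \<theta> * enn_powr (b x * ennreal (1/s)) \<phi>)"
        using rs e by (simp add: enn_powr_mult[of _ "ennreal r"] enn_powr_mult[of _ "ennreal s"] ennreal_mult mult_ac)
      also have "\<dots> \<le> ennreal (r powr \<theta> * s powr \<phi>) *
        (ennreal \<theta> * (a x * ennreal (1/r)) + ennreal \<phi> * (b x * ennreal (1/s)))"
        by (intro mult_left_mono Young_ennreal e) auto
      finally show ?thesis .
    qed
    have "(\<integral>\<^sup>+x. enn_powr (a x) \<theta> * enn_powr (b x) \<phi> \<partial>M) \<le> (\<integral>\<^sup>+x. ennreal (r powr \<theta> * s powr \<phi>) *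
        (ennreal \<theta> * (a x * ennreal (1/r)) + ennreal \<phi> * (b x * ennreal (1/s))) \<partial>M)"
      by (intro nn_integral_mono pt)
    also have "\<dots> = ennreal (r powr \<theta> * s powr \<phi>) *
        (ennreal \<theta> * (?X * ennreal (1/r)) + ennreal \<phi> * (?Y * ennreal (1/s)))"
      by (simp add: nn_integral_cmult nn_integral_add nn_integral_multc)
    also have "\<dots> = enn_powr ?X \<theta> * enn_powr ?Y \<phi>"
      using rs e by (simp flip: ennreal_mult ennreal_plus)
    finally show ?thesis .
  qed
qed

lemma Hoelder_nn_integral3:
  assumes [measurable]: "a \<in> borel_measurable M" "b \<in> borel_measurable M" "c \<in> borel_measurable M"
    and e: "0 < \<theta>" "0 < \<phi>" "0 < \<psi>" "\<theta> + \<phi> + \<psi> = 1"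
  shows "(\<integral>\<^sup>+x. enn_powr (a x) \<theta> * enn_powr (b x) \<phi> * enn_powr (c x) \<psi> \<partial>M)
    \<le> enn_powr (\<integral>\<^sup>+x. a x \<partial>M) \<theta> * enn_powr (\<integral>\<^sup>+x. b x \<partial>M) \<phi> * enn_powr (\<integral>\<^sup>+x. c x \<partial>M) \<psi>"
proof -
  define \<eta> where "\<eta> = \<phi> + \<psi>"
  have \<eta>: "0 < \<eta>" "\<theta> + \<eta> = 1" using e by (auto simp: \<eta>_def)
  let ?d = "\<lambda>x. enn_powr (b x) (\<phi>/\<eta>) * enn_powr (c x) (\<psi>/\<eta>)"
  have "enn_powr (?d x) \<eta> = enn_powr (b x) \<phi> * enn_powr (c x) \<psi>" for x
    using \<eta> by (simp add: enn_powr_mult enn_powr_powr)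
  then have "(\<integral>\<^sup>+x. enn_powr (a x) \<theta> * enn_powr (b x) \<phi> * enn_powr (c x) \<psi> \<partial>M) =
    (\<integral>\<^sup>+x. enn_powr (a x) \<theta> * enn_powr (?d x) \<eta> \<partial>M)"
    by (simp add: mult.assoc)
  also have "\<dots> \<le> enn_powr (\<integral>\<^sup>+x. a x \<partial>M) \<theta> * enn_powr (\<integral>\<^sup>+x. ?d x \<partial>M) \<eta>"
    using e \<eta> by (intro Hoelder_nn_integral) auto
  also have "(\<integral>\<^sup>+x. ?d x \<partial>M) \<le> enn_powr (\<integral>\<^sup>+x. b x \<partial>M) (\<phi>/\<eta>) * enn_powr (\<integral>\<^sup>+x. c x \<partial>M) (\<psi>/\<eta>)"
    using e \<eta> by (intro Hoelder_nn_integral) (auto simp: \<eta>_def simp flip: add_divide_distrib)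
  then have "enn_powr (\<integral>\<^sup>+x. ?d x \<partial>M) \<eta> \<le>
      enn_powr (enn_powr (\<integral>\<^sup>+x. b x \<partial>M) (\<phi>/\<eta>) * enn_powr (\<integral>\<^sup>+x. c x \<partial>M) (\<psi>/\<eta>)) \<eta>"
    using \<eta> by (intro enn_powr_mono)
  also have "\<dots> = enn_powr (\<integral>\<^sup>+x. b x \<partial>M) \<phi> * enn_powr (\<integral>\<^sup>+x. c x \<partial>M) \<psi>"
    using \<eta> by (simp add: enn_powr_mult enn_powr_powr)
  finally show ?thesis by (simp add: mult.assoc mult_left_mono)
qed

lemma Jensen_enn_powr:
  assumes [measurable]: "a \<in> borel_measurable M" and M: "emeasure M (space M) \<le> 1"
    and e: "0 < \<theta>" "\<theta> \<le> 1"
  shows "(\<integral>\<^sup>+x. enn_powr (a x) \<theta> \<partial>M) \<le> enn_powr (\<integral>\<^sup>+x. a x \<partial>M) \<theta>"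
proof (cases "\<theta> = 1")
  case False
  have "(\<integral>\<^sup>+x. enn_powr (a x) \<theta> \<partial>M) = (\<integral>\<^sup>+x. enn_powr (a x) \<theta> * enn_powr 1 (1 - \<theta>) \<partial>M)"
    by simp
  also have "\<dots> \<le> enn_powr (\<integral>\<^sup>+x. a x \<partial>M) \<theta> * enn_powr (\<integral>\<^sup>+x. 1 \<partial>M) (1 - \<theta>)"
    using e False by (intro Hoelder_nn_integral) auto
  also have "enn_powr (\<integral>\<^sup>+x. 1 \<partial>M) (1 - \<theta>) \<le> enn_powr 1 (1 - \<theta>)"
    using M False e by (intro enn_powr_mono) auto
  then have "enn_powr (\<integral>\<^sup>+x. a x \<partial>M) \<theta> * enn_powr (\<integral>\<^sup>+x. 1 \<partial>M) (1 - \<theta>) \<le> enn_powr (\<integral>\<^sup>+x. a x \<partial>M) \<theta> * 1"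
    by (intro mult_left_mono) auto
  finally show ?thesis by simp
qed simp

text \<open>
  Subadditivity of \<open>x \<mapsto> x\<^sup>\<theta>\<close> for \<open>\<theta> \<le> 1\<close>, for sums over an arbitrary index set. With
  \<open>S = \<Sum> a\<^sub>i\<^sup>\<theta>\<close>, each \<open>a\<^sub>i\<^sup>\<theta>\<close> is at most \<open>S\<close>, so \<open>a\<^sub>i\<close> is at most \<open>a\<^sub>i\<^sup>\<theta>\<close> times \<open>S\<close> to the
  \<open>1/\<theta> - 1\<close>; summing gives the claim with no passage to the limit.
\<close>

lemma enn_powr_nn_integral_count_space_le:
  fixes a :: "'i \<Rightarrow> ennreal"
  assumes e: "0 < \<theta>" "\<theta> \<le> 1"
  shows "enn_powr (\<integral>\<^sup>+i. a i \<partial>count_space UNIV) \<theta> \<le> (\<integral>\<^sup>+i. enn_powr (a i) \<theta> \<partial>count_space UNIV)"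
proof (cases "\<theta> = 1")
  case False
  define S where "S = (\<integral>\<^sup>+i. enn_powr (a i) \<theta> \<partial>count_space UNIV)"
  have le: "enn_powr (a i) \<theta> \<le> S" for i
    using nn_integral_ge_point[of i UNIV "\<lambda>i. enn_powr (a i) \<theta>"] by (simp add: S_def)
  have d: "0 < 1/\<theta> - 1" using e False by (simp add: less_divide_eq)
  have "a i \<le> enn_powr (a i) \<theta> * enn_powr S (1/\<theta> - 1)" for i
  proof -
    have "a i = enn_powr (enn_powr (a i) \<theta>) (1 + (1/\<theta> - 1))"
      using e by (simp add: enn_powr_powr)
    also have "\<dots> = enn_powr (a i) \<theta> * enn_powr (enn_powr (a i) \<theta>) (1/\<theta> - 1)"
      using d by (subst enn_powr_add) auto
    also have "\<dots> \<le> enn_powr (a i) \<theta> * enn_powr S (1/\<theta> - 1)"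
      by (intro mult_left_mono enn_powr_mono le d) auto
    finally show ?thesis .
  qed
  then have "(\<integral>\<^sup>+i. a i \<partial>count_space UNIV) \<le> (\<integral>\<^sup>+i. enn_powr (a i) \<theta> * enn_powr S (1/\<theta> - 1) \<partial>count_space UNIV)"
    by (intro nn_integral_mono)
  also have "\<dots> = S * enn_powr S (1/\<theta> - 1)"
    by (simp add: nn_integral_multc S_def)
  also have "\<dots> = enn_powr S (1/\<theta>)"
    using enn_powr_add[of 1 "1/\<theta> - 1" S] d by simp
  finally have "enn_powr (\<integral>\<^sup>+i. a i \<partial>count_space UNIV) \<theta> \<le> enn_powr (enn_powr S (1/\<theta>)) \<theta>"
    using e by (intro enn_powr_mono)
  then show ?thesis using e by (simp add: enn_powr_powr S_def)
qed simp

text \<open>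
  Young's convolution inequality for kernels that need not be convolutions: only the two
  marginal bounds \<open>A\<close> and \<open>B\<close> enter. With \<open>s = 1/u + 1 - 1/p\<close> the usual proof applies: \<open>f k\<^sup>s\<close> is
  the product of \<open>(f\<^sup>p k)\<^bsup>1/u\<^esup>\<close>, a power of \<open>f\<^sup>p\<close> and a power of \<open>k\<close>, whose exponents add up to 1, so
  that the three-factor Hoelder inequality leaves only the first factor to be integrated over the
  second variable. Keeping \<open>A\<close> and \<open>B\<close> apart is what makes the estimate for one slice of \<open>S\<close>
  sharp in the position of the slice.
\<close>

lemma Young_kernel_inequality:
  fixes k :: "'a \<Rightarrow> 'b \<Rightarrow> ennreal"
  assumes sf: "sigma_finite_measure M" "sigma_finite_measure N"
    and [measurable]: "f \<in> borel_measurable M" "(\<lambda>(x, n). k x n) \<in> borel_measurable (M \<Otimes>\<^sub>M N)"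
    and pu: "1 < p" "p < u"
    and A: "\<And>x. x \<in> space M \<Longrightarrow> (\<integral>\<^sup>+n. k x n \<partial>N) \<le> A" and B: "\<And>n. n \<in> space N \<Longrightarrow> (\<integral>\<^sup>+x. k x n \<partial>M) \<le> B"
  shows "(\<integral>\<^sup>+n. enn_powr (\<integral>\<^sup>+x. f x * enn_powr (k x n) (1/u + 1 - 1/p) \<partial>M) u \<partial>N)
    \<le> A * enn_powr B (u * (1 - 1/p)) * enn_powr (\<integral>\<^sup>+x. enn_powr (f x) p \<partial>M) (u/p)"
proof -
  interpret M: sigma_finite_measure M by fact
  interpret N: sigma_finite_measure N by fact
  interpret MN: pair_sigma_finite M N ..
  define \<theta> \<phi> \<psi> where d: "\<theta> = 1/u" "\<phi> = 1/p - 1/u" "\<psi> = 1 - 1/p"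
  have e: "0 < \<theta>" "0 < \<phi>" "0 < \<psi>" "\<theta> + \<phi> + \<psi> = 1"
    using pu by (auto simp: d field_simps)
  define F where "F = (\<integral>\<^sup>+x. enn_powr (f x) p \<partial>M)"
  have pt: "f x * enn_powr (k x n) (1/u + 1 - 1/p) =
    enn_powr (enn_powr (f x) p * k x n) \<theta> * enn_powr (enn_powr (f x) p) \<phi> * enn_powr (k x n) \<psi>" for x n
  proof -
    have "f x = enn_powr (enn_powr (f x) p) (\<theta> + \<phi>)"
      using pu by (simp add: enn_powr_powr d)
    also have "\<dots> = enn_powr (enn_powr (f x) p) \<theta> * enn_powr (enn_powr (f x) p) \<phi>"
      by (intro enn_powr_add e)
    finally have 1: "f x = enn_powr (enn_powr (f x) p) \<theta> * enn_powr (enn_powr (f x) p) \<phi>" .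
    have 2: "enn_powr (k x n) (1/u + 1 - 1/p) = enn_powr (k x n) \<theta> * enn_powr (k x n) \<psi>"
      using enn_powr_add[of \<theta> \<psi> "k x n"] e by (simp add: d algebra_simps)
    show ?thesis
      by (subst 1, subst 2) (simp add: enn_powr_mult e mult_ac)
  qed
  have sl: "enn_powr (\<integral>\<^sup>+x. f x * enn_powr (k x n) (1/u + 1 - 1/p) \<partial>M) u \<le>
     (\<integral>\<^sup>+x. enn_powr (f x) p * k x n \<partial>M) * (enn_powr F (\<phi> * u) * enn_powr B (\<psi> * u))" if n: "n \<in> space N" for n
  proof -
    have [measurable]: "(\<lambda>x. k x n) \<in> borel_measurable M" using n by measurable
    have "(\<integral>\<^sup>+x. f x * enn_powr (k x n) (1/u + 1 - 1/p) \<partial>M) \<le>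
      enn_powr (\<integral>\<^sup>+x. enn_powr (f x) p * k x n \<partial>M) \<theta> * enn_powr F \<phi> * enn_powr (\<integral>\<^sup>+x. k x n \<partial>M) \<psi>"
      unfolding pt F_def using e by (intro Hoelder_nn_integral3) auto
    also have "\<dots> \<le> enn_powr (\<integral>\<^sup>+x. enn_powr (f x) p * k x n \<partial>M) \<theta> * enn_powr F \<phi> * enn_powr B \<psi>"
      by (intro mult_left_mono enn_powr_mono B n e) auto
    finally have "enn_powr (\<integral>\<^sup>+x. f x * enn_powr (k x n) (1/u + 1 - 1/p) \<partial>M) u \<le>
       enn_powr (enn_powr (\<integral>\<^sup>+x. enn_powr (f x) p * k x n \<partial>M) \<theta> * enn_powr F \<phi> * enn_powr B \<psi>) u"
      using pu by (intro enn_powr_mono) auto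
    then show ?thesis
      using pu by (simp add: enn_powr_mult enn_powr_powr d mult.assoc)
  qed
  have "(\<integral>\<^sup>+n. enn_powr (\<integral>\<^sup>+x. f x * enn_powr (k x n) (1/u + 1 - 1/p) \<partial>M) u \<partial>N) \<le>
    (\<integral>\<^sup>+n. (\<integral>\<^sup>+x. enn_powr (f x) p * k x n \<partial>M) * (enn_powr F (\<phi> * u) * enn_powr B (\<psi> * u)) \<partial>N)"
    by (intro nn_integral_mono sl)
  also have "\<dots> = (\<integral>\<^sup>+n. \<integral>\<^sup>+x. enn_powr (f x) p * k x n \<partial>M \<partial>N) * (enn_powr F (\<phi> * u) * enn_powr B (\<psi> * u))"
    by (intro nn_integral_multc) measurable
  also have "(\<integral>\<^sup>+n. \<integral>\<^sup>+x. enn_powr (f x) p * k x n \<partial>M \<partial>N) = (\<integral>\<^sup>+x. \<integral>\<^sup>+n. enn_powr (f x) p * k x n \<partial>N \<partial>M)"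
    by (intro MN.Fubini') measurable
  also have "\<dots> = (\<integral>\<^sup>+x. enn_powr (f x) p * (\<integral>\<^sup>+n. k x n \<partial>N) \<partial>M)"
    by (intro nn_integral_cong nn_integral_cmult) measurable
  also have "\<dots> \<le> (\<integral>\<^sup>+x. enn_powr (f x) p * A \<partial>M)"
    by (intro nn_integral_mono mult_left_mono A) auto
  also have "\<dots> = F * A" by (simp add: F_def nn_integral_multc)
  finally have "(\<integral>\<^sup>+n. enn_powr (\<integral>\<^sup>+x. f x * enn_powr (k x n) (1/u + 1 - 1/p) \<partial>M) u \<partial>N) \<le>
    F * A * (enn_powr F (\<phi> * u) * enn_powr B (\<psi> * u))"
    by (simp add: mult_right_mono)
  also have "\<dots> = A * enn_powr B (u * (1 - 1/p)) * (enn_powr F 1 * enn_powr F (\<phi> * u))"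
    by (simp add: d mult_ac)
  also have "enn_powr F 1 * enn_powr F (\<phi> * u) = enn_powr F (u/p)"
    using pu e by (subst enn_powr_add[symmetric]) (auto simp: d field_simps)
  finally show ?thesis by (simp add: F_def)
qed

section \<open>Rearrangements and Lorentz norms\<close>

lemma nn_integral_powr_from_0:
  assumes "-1 < a"
  shows "(\<integral>\<^sup>+t\<in>{0<..1}. ennreal (t powr a) \<partial>lborel) = ennreal (1 / (a + 1))"
proof -
  have "((\<lambda>t. t powr a) has_integral (1 / (a + 1))) {0..1::real}"
    using has_integral_powr_from_0[of a 1] assms by simp
  then have "(\<integral>\<^sup>+t\<in>{0..1}. ennreal (t powr a) \<partial>lborel) = ennreal (1 / (a + 1))"
    by (intro nn_integral_has_integral_lebesgue') auto
  also have "(\<integral>\<^sup>+t\<in>{0..1}. ennreal (t powr a) \<partial>lborel) = (\<integral>\<^sup>+t\<in>{0<..1}. ennreal (t powr a) \<partial>lborel)"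
    by (intro nn_integral_cong) (auto simp: indicator_def)
  finally show ?thesis .
qed

lemma nn_integral_powr_to_inf:
  assumes "a < -1"
  shows "(\<integral>\<^sup>+t\<in>{1..}. ennreal (t powr a) \<partial>lborel) = ennreal (- 1 / (a + 1))"
proof -
  have "((\<lambda>t. t powr a) has_integral (- 1 / (a + 1))) {1::real..}"
    using has_integral_powr_to_inf[of a 1] assms by simp
  then show ?thesis
    by (intro nn_integral_has_integral_lebesgue') auto
qed

text \<open>
  The inner integral of the layer cake formula.
\<close>

lemma emeasure_lborel_below:
  "emeasure lborel {s::real. 0 < s \<and> ennreal s < c} = c"
proof (cases c)
  case (real r)
  then have "{s::real. 0 < s \<and> ennreal s < c} = {0<..<r}"
    by (auto simp: ennreal_less_iff)
  then show ?thesis using real by simp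
next
  case top
  have "of_nat n \<le> emeasure lborel {0::real<..}" for n
  proof -
    have "of_nat n = emeasure lborel {0<..<real n}" by (simp add: ennreal_of_nat_eq_real_of_nat)
    also have "\<dots> \<le> emeasure lborel {0::real<..}" by (intro emeasure_mono) auto
    finally show ?thesis .
  qed
  then have "emeasure lborel {0::real<..} = top"
    by (metis ennreal_Ex_less_of_nat leD less_top)
  then show ?thesis using top by (simp add: greaterThan_def)
qed

lemma layer_cake:
  assumes "sigma_finite_measure M" and [measurable]: "g \<in> borel_measurable M"
  shows "(\<integral>\<^sup>+x. g x \<partial>M) = (\<integral>\<^sup>+s\<in>{0<..}. emeasure M {x \<in> space M. ennreal s < g x} \<partial>lborel)"
proof -
  interpret sigma_finite_measure M by fact
  interpret P: pair_sigma_finite M "lborel :: real measure" ..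
  have "(\<integral>\<^sup>+x. g x \<partial>M) = (\<integral>\<^sup>+x. \<integral>\<^sup>+s. indicator {s. 0 < s \<and> ennreal s < g x} s \<partial>lborel \<partial>M)"
    by (intro nn_integral_cong) (simp add: emeasure_lborel_below)
  also have "\<dots> = (\<integral>\<^sup>+x. \<integral>\<^sup>+s. (if 0 < s \<and> ennreal s < g x then 1 else 0) \<partial>lborel \<partial>M)"
    by (intro nn_integral_cong) (auto simp: indicator_def)
  also have "\<dots> = (\<integral>\<^sup>+s. \<integral>\<^sup>+x. (if 0 < s \<and> ennreal s < g x then 1 else 0) \<partial>M \<partial>lborel)"
    by (intro P.Fubini'[symmetric]) measurable
  also have "\<dots> = (\<integral>\<^sup>+s\<in>{0<..}. emeasure M {x \<in> space M. ennreal s < g x} \<partial>lborel)"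
  proof (intro nn_integral_cong)
    fix s :: real
    have "(\<integral>\<^sup>+x. (if 0 < s \<and> ennreal s < g x then 1 else 0) \<partial>M) =
        (\<integral>\<^sup>+x. indicator {x \<in> space M. ennreal s < g x} x * indicator {0<..} s \<partial>M)"
      by (intro nn_integral_cong) (auto simp: indicator_def)
    also have "\<dots> = emeasure M {x \<in> space M. ennreal s < g x} * indicator {0<..} s"
      by (subst nn_integral_multc) auto
    finally show "(\<integral>\<^sup>+x. (if 0 < s \<and> ennreal s < g x then 1 else 0) \<partial>M) = \<dots>" .
  qed
  finally show ?thesis .
qed

text \<open>
  The layer cake formula: the distribution function of the truncated function is at most
  \<open>max(s, 1)\<close> to the \<open>-p\<close>, which is integrable because \<open>p > 1\<close>.
\<close>

lemma weak_type_large_part: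
  assumes M: "sigma_finite_measure M" and [measurable]: "\<phi> \<in> borel_measurable M" and p: "1 < p"
    and w: "\<And>s. 0 < s \<Longrightarrow> emeasure M {x \<in> space M. ennreal s < \<phi> x} \<le> ennreal (s powr - p)"
  shows "(\<integral>\<^sup>+x. (if 1 < \<phi> x then \<phi> x else 0) \<partial>M) \<le> ennreal (1 + 1 / (p - 1))"
proof -
  have "(\<integral>\<^sup>+x. (if 1 < \<phi> x then \<phi> x else 0) \<partial>M) =
    (\<integral>\<^sup>+s\<in>{0<..}. emeasure M {x \<in> space M. ennreal s < (if 1 < \<phi> x then \<phi> x else 0)} \<partial>lborel)"
    by (rule layer_cake[OF M]) measurable
  also have "\<dots> \<le> (\<integral>\<^sup>+s. ennreal (s powr 0) * indicator {0<..1} s + ennreal (s powr - p) * indicator {1..} s \<partial>lborel)"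
  proof (intro nn_integral_mono)
    fix s :: real
    have "emeasure M {x \<in> space M. ennreal s < (if 1 < \<phi> x then \<phi> x else 0)} \<le>
      emeasure M {x \<in> space M. ennreal (max s 1) < \<phi> x}" if "0 < s"
    proof (intro emeasure_mono subsetI)
      fix x assume "x \<in> {x \<in> space M. ennreal s < (if 1 < \<phi> x then \<phi> x else 0)}"
      then show "x \<in> {x \<in> space M. ennreal (max s 1) < \<phi> x}"
        by (cases "1 \<le> s") (auto simp: max_def split: if_splits)
    qed measurable
    also have "emeasure M {x \<in> space M. ennreal (max s 1) < \<phi> x} \<le> ennreal (max s 1 powr - p)"
      by (intro w) auto
    finally have le: "emeasure M {x \<in> space M. ennreal s < (if 1 < \<phi> x then \<phi> x else 0)} \<le> ennreal (max s 1 powr - p)"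
      if "0 < s" using that .
    consider "s \<le> 0" | "0 < s" "s < 1" | "s = 1" | "1 < s" by linarith
    then show "emeasure M {x \<in> space M. ennreal s < (if 1 < \<phi> x then \<phi> x else 0)} * indicator {0<..} s
       \<le> ennreal (s powr 0) * indicator {0<..1} s + ennreal (s powr - p) * indicator {1..} s"
    proof cases
      case 3
      have "(1::ennreal) \<le> 1 + 1" by simp
      then show ?thesis using order_trans[OF le, of 2] 3 by simp
    qed (use le in \<open>simp_all add: max_def\<close>)
  qed
  also have "\<dots> = ennreal 1 + ennreal (- 1 / (- p + 1))"
    using nn_integral_powr_from_0[of 0] nn_integral_powr_to_inf[of "-p"] p
    by (subst nn_integral_add) auto
  also have "\<dots> = ennreal (1 + 1 / (p - 1))"
  proof -
    have "- 1 / (- p + 1) = 1 / (p - 1)" using p by (simp add: field_simps)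
    then show ?thesis using p by (subst ennreal_plus[symmetric]) auto
  qed
  finally show ?thesis .
qed

text \<open>
  Again the layer cake formula: the level sets of the truncated \<open>\<phi>\<^sup>r\<close> are empty above height 1,
  and below it their measure is at most \<open>s\<close> to the \<open>-p/r\<close>, which is integrable at 0.
\<close>

lemma weak_type_small_part:
  assumes M: "sigma_finite_measure M" and [measurable]: "\<phi> \<in> borel_measurable M" and p: "0 < p" "p < r"
    and w: "\<And>s. 0 < s \<Longrightarrow> emeasure M {x \<in> space M. ennreal s < \<phi> x} \<le> ennreal (s powr - p)"
  shows "(\<integral>\<^sup>+x. enn_powr (if 1 < \<phi> x then 0 else \<phi> x) r \<partial>M) \<le> ennreal (1 / (1 - p / r))"
proof -
  have "(\<integral>\<^sup>+x. enn_powr (if 1 < \<phi> x then 0 else \<phi> x) r \<partial>M) =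
    (\<integral>\<^sup>+s\<in>{0<..}. emeasure M {x \<in> space M. ennreal s < enn_powr (if 1 < \<phi> x then 0 else \<phi> x) r} \<partial>lborel)"
    by (rule layer_cake[OF M]) measurable
  also have "\<dots> \<le> (\<integral>\<^sup>+s. ennreal (s powr (- p / r)) * indicator {0<..1} s \<partial>lborel)"
  proof (intro nn_integral_mono)
    fix s :: real
    let ?A = "{x \<in> space M. ennreal s < enn_powr (if 1 < \<phi> x then 0 else \<phi> x) r}"
    have le1: "enn_powr (if 1 < \<phi> x then 0 else \<phi> x) r \<le> 1" for x
      using enn_powr_mono[of "\<phi> x" 1 r] p by (auto simp: not_less)
    have "emeasure M ?A \<le> ennreal (s powr (- p / r))" if s: "0 < s"
    proof -
      have "emeasure M ?A \<le> emeasure M {x \<in> space M. ennreal (s powr (1/r)) < \<phi> x}"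
      proof (intro emeasure_mono subsetI CollectI conjI)
        fix x assume "x \<in> ?A"
        then have x: "x \<in> space M" "ennreal s < enn_powr (\<phi> x) r"
          by (auto split: if_splits)
        then show "x \<in> space M" by simp
        show "ennreal (s powr (1/r)) < \<phi> x"
        proof (rule ccontr)
          assume "\<not> ennreal (s powr (1/r)) < \<phi> x"
          then have "enn_powr (\<phi> x) r \<le> enn_powr (ennreal (s powr (1/r))) r"
            using p by (intro enn_powr_mono) auto
          also have "\<dots> = ennreal s" using p s by (simp add: powr_powr)
          finally show False using x by auto
        qed
      qed measurable
      also have "\<dots> \<le> ennreal ((s powr (1/r)) powr - p)"
        using s by (intro w) auto
      finally show ?thesis by (simp add: powr_powr)
    qed
    moreover have "?A = {}" if "1 < s"
    proof -
      have "1 \<le> ennreal s" using that by simp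
      then have "\<not> ennreal s < enn_powr (if 1 < \<phi> x then 0 else \<phi> x) r" for x
        using order_trans[OF le1[of x]] by (simp add: not_less)
      then show ?thesis by blast
    qed
    ultimately have "1 < s \<Longrightarrow> ?A = {}" "0 < s \<Longrightarrow> emeasure M ?A \<le> ennreal (s powr (- p / r))"
      by blast+
    show "emeasure M ?A * indicator {0<..} s \<le> ennreal (s powr (- p / r)) * indicator {0<..1} s"
    proof (cases "1 < s")
      case True
      then have "?A = {}" by (rule \<open>1 < s \<Longrightarrow> ?A = {}\<close>)
      then show ?thesis by (simp only: emeasure_empty mult_zero_left zero_le)
    next
      case False
      then have i: "(indicator {0<..1} s :: ennreal) = indicator {0<..} s" by (simp add: indicator_def)
      show ?thesis
      proof (cases "0 < s")
        case True
        show ?thesis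
          unfolding i by (rule mult_right_mono[OF \<open>0 < s \<Longrightarrow> emeasure M ?A \<le> ennreal (s powr (- p / r))\<close>[OF True]]) simp
      qed simp
    qed
  qed
  also have "\<dots> = ennreal (1 / (- p / r + 1))"
    using p by (intro nn_integral_powr_from_0) (auto simp: field_simps)
  finally show ?thesis by simp
qed

text \<open>
  The infimum in the rearrangement need not be attained, so the estimate is first proved at
  any \<open>t\<close> strictly above the bound.
\<close>

lemma Lorentz_weak_distribution:
  assumes [measurable]: "f \<in> borel_measurable M" and p: "0 < p"
    and N: "Lorentz_norm M p \<infinity> f \<le> ennreal N" "0 < N" and s: "0 < s"
  shows "emeasure M {x \<in> space M. ennreal s < ennreal (norm (f x))} \<le> ennreal ((N / s) powr p)"
proof (rule ennreal_le_epsilon)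
  fix e :: real assume e: "0 < e"
  define t where "t = (N / s) powr p + e"
  have t: "0 < t" using e by (simp add: t_def add_nonneg_pos)
  have "ennreal (t powr (1 / p)) * rearrangement M f t \<le> ennreal N"
    using N(1) t unfolding Lorentz_norm_def by (auto simp: SUP_le_iff)
  moreover have "(N / s) < t powr (1/p)"
  proof -
    have "((N / s) powr p) powr (1/p) < t powr (1/p)"
      using e p N s by (intro powr_less_mono2) (auto simp: t_def)
    then show ?thesis using p N s by (simp add: powr_powr)
  qed
  then have "ennreal N < ennreal (t powr (1/p)) * ennreal s"
    using N s by (simp add: ennreal_mult[symmetric] ennreal_less_iff field_simps)
  ultimately have "ennreal (t powr (1 / p)) * rearrangement M f t < ennreal (t powr (1/p)) * ennreal s"
    by simp
  then have "rearrangement M f t < ennreal s"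
    by (meson mult_left_mono not_le zero_le)
  then obtain s' where s': "s' < ennreal s" "emeasure M {x \<in> space M. s' < ennreal (norm (f x))} \<le> ennreal t"
    unfolding rearrangement_def by (auto simp: Inf_less_iff)
  have "emeasure M {x \<in> space M. ennreal s < ennreal (norm (f x))} \<le>
      emeasure M {x \<in> space M. s' < ennreal (norm (f x))}"
    using s' by (intro emeasure_mono) auto
  with s' have "emeasure M {x \<in> space M. ennreal s < ennreal (norm (f x))} \<le> ennreal t"
    by simp
  then show "emeasure M {x \<in> space M. ennreal s < ennreal (norm (f x))} \<le> ennreal ((N / s) powr p) + ennreal e"
    using e by (simp add: t_def)
qed

text \<open>
  The function \<open>|f|\<close> and its rearrangement are equimeasurable. For this inequality it is
  enough that \<open>t < \<mu>(s)\<close>, with \<open>\<mu>\<close> the distribution function of \<open>f\<close>, forces \<open>s \<le> f\<^sup>*(t)\<close>; the layer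
  cake formula and Tonelli's theorem do the rest.
\<close>

lemma nn_integral_le_Lorentz_norm_1_1:
  assumes M: "sigma_finite_measure M" and [measurable]: "f \<in> borel_measurable M"
  shows "(\<integral>\<^sup>+x. ennreal (norm (f x)) \<partial>M) \<le> Lorentz_norm M 1 1 f"
proof -
  define \<mu> where "\<mu> s = emeasure M {x \<in> space M. ennreal s < ennreal (norm (f x))}" for s
  have "(\<integral>\<^sup>+x. ennreal (norm (f x)) \<partial>M) = (\<integral>\<^sup>+s\<in>{0<..}. \<mu> s \<partial>lborel)"
    unfolding \<mu>_def by (rule layer_cake[OF M]) measurable
  also have "\<dots> \<le> (\<integral>\<^sup>+t\<in>{0<..}. rearrangement M f t \<partial>lborel)"
  proof -
    have [measurable]: "\<mu> \<in> borel_measurable lborel"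
    proof -
      interpret sigma_finite_measure M by fact
      have "(\<lambda>s. \<integral>\<^sup>+x. (if ennreal s < ennreal (norm (f x)) then 1 else 0) \<partial>M) \<in> borel_measurable (lborel :: real measure)"
        by measurable
      also have "(\<lambda>s. \<integral>\<^sup>+x. (if ennreal s < ennreal (norm (f x)) then 1 else 0) \<partial>M) = \<mu>"
      proof
        fix s
        have "(\<integral>\<^sup>+x. (if ennreal s < ennreal (norm (f x)) then 1 else 0) \<partial>M) =
          (\<integral>\<^sup>+x. indicator {x \<in> space M. ennreal s < ennreal (norm (f x))} x \<partial>M)"
          by (intro nn_integral_cong) (auto simp: indicator_def)
        then show "(\<integral>\<^sup>+x. (if ennreal s < ennreal (norm (f x)) then 1 else 0) \<partial>M) = \<mu> s"
          by (simp add: \<mu>_def)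
      qed
      finally show ?thesis .
    qed
    have "(\<integral>\<^sup>+s\<in>{0<..}. \<mu> s \<partial>lborel) =
      (\<integral>\<^sup>+s. \<integral>\<^sup>+t. (if 0 < s \<and> 0 < t \<and> ennreal t < \<mu> s then 1 else 0) \<partial>(lborel :: real measure) \<partial>lborel)"
    proof (intro nn_integral_cong)
      fix s :: real
      have "(\<integral>\<^sup>+t. (if 0 < s \<and> 0 < t \<and> ennreal t < \<mu> s then 1 else 0) \<partial>(lborel :: real measure)) =
        (\<integral>\<^sup>+t. indicator {t. 0 < t \<and> ennreal t < \<mu> s} t * indicator {0<..} s \<partial>lborel)"
        by (intro nn_integral_cong) (auto simp: indicator_def)
      then show "\<mu> s * indicator {0<..} s = (\<integral>\<^sup>+t. (if 0 < s \<and> 0 < t \<and> ennreal t < \<mu> s then 1 else 0) \<partial>lborel)"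
        by (simp add: nn_integral_multc emeasure_lborel_below)
    qed
    also have "\<dots> = (\<integral>\<^sup>+t. \<integral>\<^sup>+s. (if 0 < s \<and> 0 < t \<and> ennreal t < \<mu> s then 1 else 0) \<partial>(lborel :: real measure) \<partial>lborel)"
      by (intro lborel_pair.Fubini') measurable
    also have "\<dots> \<le> (\<integral>\<^sup>+t\<in>{0<..}. rearrangement M f t \<partial>lborel)"
    proof (intro nn_integral_mono)
      fix t :: real
      let ?c = "rearrangement M f t"
      have sub: "ennreal s \<le> ?c" if "ennreal t < \<mu> s" for s
        unfolding rearrangement_def
      proof (intro Inf_greatest, rule ccontr)
        fix s' assume s': "s' \<in> {s. emeasure M {x \<in> space M. s < ennreal (norm (f x))} \<le> ennreal t}" "\<not> ennreal s \<le> s'"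
        then have "\<mu> s \<le> emeasure M {x \<in> space M. s' < ennreal (norm (f x))}"
          unfolding \<mu>_def by (intro emeasure_mono) auto
        with s' that show False by auto
      qed
      have "(\<integral>\<^sup>+s. (if 0 < s \<and> 0 < t \<and> ennreal t < \<mu> s then 1 else 0) \<partial>(lborel :: real measure)) \<le>
        (\<integral>\<^sup>+s. indicator {s. 0 < s \<and> ennreal s \<le> ?c} s * indicator {0<..} t \<partial>(lborel :: real measure))"
        using sub by (intro nn_integral_mono) (auto simp: indicator_def)
      also have "\<dots> = emeasure lborel {s. 0 < s \<and> ennreal s \<le> ?c} * indicator {0<..} t"
        by (simp add: nn_integral_multc)
      also have "emeasure lborel {s. 0 < s \<and> ennreal s \<le> ?c} \<le> ?c"
      proof (cases ?c)
        case (real r)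
        then have "{s. 0 < s \<and> ennreal s \<le> ?c} = {0<..r}" by auto
        then show ?thesis using real by simp
      qed simp
      finally show "(\<integral>\<^sup>+s. (if 0 < s \<and> 0 < t \<and> ennreal t < \<mu> s then 1 else 0) \<partial>lborel) \<le> ?c * indicator {0<..} t"
        by (simp add: mult_right_mono)
    qed
    finally show ?thesis .
  qed
  also have "\<dots> = Lorentz_norm M 1 1 f"
  proof -
    have "ennreal (t powr 1) * r * ennreal (1 / t) = r" if "0 < t" for t r
    proof -
      have "ennreal (t powr 1) * r * ennreal (1 / t) = ennreal (t * (1 / t)) * r"
        using that by (simp only: ennreal_mult powr_one less_imp_le mult.assoc mult.commute[of r] divide_nonneg_pos zero_le_one)
      then show ?thesis using that by simp
    qed
    then have "(\<integral>\<^sup>+t\<in>{0<..}. rearrangement M f t \<partial>lborel) =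
       (\<integral>\<^sup>+t\<in>{0<..}. ennreal (t powr 1) * rearrangement M f t * ennreal (1 / t) \<partial>lborel)"
      by (intro nn_integral_cong) (simp add: indicator_def)
    then show ?thesis by (simp add: Lorentz_norm_def)
  qed
  finally show ?thesis .
qed

text \<open>
  The inclusion \<open>L\<^sup>v \<subseteq> L\<^bsup>q,1\<^esup>\<close> for \<open>q < v\<close> on a space of mass at most 1. By Markov's inequality the
  rearrangement is at most \<open>K t\<close> to the \<open>-1/v\<close>, and it vanishes for \<open>t \<ge> 1\<close>; the remaining
  integral over \<open>(0, 1]\<close> converges at 0 because \<open>1/q > 1/v\<close>. A majorant \<open>G\<close> takes the place
  of \<open>|F|\<close> so that \<open>F\<close> itself may be any function.
\<close>

lemma Lorentz_norm_q_1_le: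
  assumes M: "emeasure M (space M) \<le> 1" and [measurable]: "G \<in> borel_measurable M"
    and FG: "\<And>x. ennreal (norm (F x)) \<le> G x"
    and G: "(\<integral>\<^sup>+x. enn_powr (G x) v \<partial>M) \<le> ennreal (K powr v)" and K: "0 < K"
    and q: "1 \<le> q" "q < v"
  shows "Lorentz_norm M q 1 F \<le> ennreal (1 / q / (1 / q - 1 / v) * K)"
proof -
  have r0: "rearrangement M F t = 0" if "1 \<le> t" for t
  proof -
    have "emeasure M {x \<in> space M. 0 < ennreal (norm (F x))} \<le> emeasure M (space M)"
      by (intro emeasure_mono) auto
    also have "\<dots> \<le> 1" by fact
    also have "\<dots> \<le> ennreal t" using that by simp
    finally have "rearrangement M F t \<le> 0"
      unfolding rearrangement_def by (intro Inf_lower) auto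
    then show ?thesis by simp
  qed
  have r1: "rearrangement M F t \<le> ennreal (K * t powr (- 1 / v))" if t: "0 < t" for t
  proof -
    define s where "s = K * t powr (- 1 / v)"
    have s: "0 < s" using K t by (simp add: s_def)
    have sv: "s powr (- v) * K powr v = t"
    proof -
      have "s powr (- v) = K powr (- v) * t"
        using K t q by (simp add: s_def powr_mult powr_powr)
      then show ?thesis using K by (simp add: powr_minus)
    qed
    have "emeasure M {x \<in> space M. ennreal s < ennreal (norm (F x))} \<le>
      emeasure M {x \<in> space M. 1 \<le> ennreal (s powr (- v)) * enn_powr (G x) v}"
    proof (intro emeasure_mono subsetI)
      fix x assume x: "x \<in> {x \<in> space M. ennreal s < ennreal (norm (F x))}"
      then have "ennreal s \<le> G x" using FG[of x] by auto
      then have "enn_powr (ennreal s) v \<le> enn_powr (G x) v" using q by (intro enn_powr_mono) auto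
      then have "ennreal (s powr (- v)) * ennreal (s powr v) \<le> ennreal (s powr (- v)) * enn_powr (G x) v"
        using s by (intro mult_left_mono) auto
      moreover have "ennreal (s powr (- v)) * ennreal (s powr v) = 1"
        using s by (simp flip: ennreal_mult powr_add)
      ultimately show "x \<in> {x \<in> space M. 1 \<le> ennreal (s powr (- v)) * enn_powr (G x) v}"
        using x by auto
    qed measurable
    also have "\<dots> \<le> ennreal (s powr (- v)) * (\<integral>\<^sup>+x\<in>space M. enn_powr (G x) v \<partial>M)"
      by (intro nn_integral_Markov_inequality) measurable
    also have "(\<integral>\<^sup>+x\<in>space M. enn_powr (G x) v \<partial>M) = (\<integral>\<^sup>+x. enn_powr (G x) v \<partial>M)"
      by (intro nn_integral_cong) auto
    also have "ennreal (s powr (- v)) * \<dots> \<le> ennreal (s powr (- v)) * ennreal (K powr v)"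
      by (intro mult_left_mono G) auto
    also have "\<dots> = ennreal t" using sv by (simp flip: ennreal_mult)
    finally show ?thesis
      unfolding rearrangement_def s_def[symmetric] by (intro Inf_lower) auto
  qed
  have d: "0 < 1 / q - 1 / v" using q by (simp add: field_simps)
  have "(\<integral>\<^sup>+t\<in>{0<..}. enn_powr (ennreal (t powr (1 / q)) * rearrangement M F t) (enn2real 1) * ennreal (1 / t) \<partial>lborel)
    \<le> (\<integral>\<^sup>+t. ennreal K * (ennreal (t powr (1 / q - 1 / v - 1)) * indicator {0<..1} t) \<partial>lborel)"
  proof (intro nn_integral_mono)
    fix t :: real
    have "ennreal (t powr (1 / q)) * rearrangement M F t * ennreal (1 / t) \<le>
      ennreal K * ennreal (t powr (1 / q - 1 / v - 1))" if "0 < t"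
    proof -
      have "ennreal (t powr (1 / q)) * rearrangement M F t * ennreal (1 / t) \<le>
        ennreal (t powr (1 / q)) * ennreal (K * t powr (- 1 / v)) * ennreal (1 / t)"
        by (intro mult_right_mono mult_left_mono r1 that) auto
      also have "\<dots> = ennreal (t powr (1 / q) * (K * t powr (- 1 / v)) * (1 / t))"
        using that K by (simp only: ennreal_mult mult_nonneg_nonneg powr_ge_zero less_imp_le divide_nonneg_pos zero_le_one)
      also have "t powr (1 / q) * (K * t powr (- 1 / v)) * (1 / t) = K * t powr (1 / q - 1 / v - 1)"
        using that by (simp add: powr_diff powr_minus powr_add field_simps)
      finally show ?thesis using K by (simp add: ennreal_mult)
    qed
    then show "enn_powr (ennreal (t powr (1 / q)) * rearrangement M F t) (enn2real 1) * ennreal (1 / t) * indicator {0<..} t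
      \<le> ennreal K * (ennreal (t powr (1 / q - 1 / v - 1)) * indicator {0<..1} t)"
      using r0[of t] by (cases "1 < t") (auto simp: indicator_def)
  qed
  also have "\<dots> = ennreal K * ennreal (1 / (1 / q - 1 / v))"
    using nn_integral_powr_from_0[of "1 / q - 1 / v - 1"] d by (simp add: nn_integral_cmult)
  finally have I: "(\<integral>\<^sup>+t\<in>{0<..}. enn_powr (ennreal (t powr (1 / q)) * rearrangement M F t) (enn2real 1) * ennreal (1 / t) \<partial>lborel)
    \<le> ennreal K * ennreal (1 / (1 / q - 1 / v))" .
  have "Lorentz_norm M q 1 F \<le> ennreal (1 / q) * (ennreal K * ennreal (1 / (1 / q - 1 / v)))"
    using mult_left_mono[OF I, of "ennreal (1/q)"] unfolding Lorentz_norm_def by simp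
  also have "\<dots> = ennreal (1 / q / (1 / q - 1 / v) * K)"
    using d q K by (simp flip: ennreal_mult)
  finally show ?thesis .
qed

section \<open>Haar measure of the group N\<close>

context h_type
begin

lemma br_linear:
  "br (x + y) w = br x w + br y w" "br w (x + y) = br w x + br w y"
  "br (- x) w = - br x w" "br w (- x) = - br w x" "br 0 w = 0" "br w 0 = 0"
  "br (x - y) w = br x w - br y w" "br w (x - y) = br w x - br w y"
  using bilinear
  by (simp_all add: bilinear_ladd bilinear_radd bilinear_lneg bilinear_rneg bilinear_lzero
      bilinear_rzero bilinear_lsub bilinear_rsub)

lemma br_anticommute: "br x y = - br y x"
proof -
  have "br (x + y) (x + y) = (br x x + br y y) + (br x y + br y x)"
    by (simp only: br_linear ac_simps)
  then have "br x y + br y x = 0"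
    by (simp only: alternating) simp
  then show ?thesis by (simp add: eq_neg_iff_add_eq_0)
qed

text \<open>
  Together with \<open>fst_br\<close> this reduces the bracket to a bilinear map from \<open>\<vv>\<close> to \<open>\<zz>\<close>, which is
  what makes the group law a shear.
\<close>

lemma br_centre: "br (0, Z) x = 0" "br x (0, Z) = 0"
proof -
  have "(0, Z) \<in> lie_centre br" by (simp add: centre)
  then show "br (0, Z) x = 0" unfolding lie_centre_def by blast
  then show "br x (0, Z) = 0" by (subst br_anticommute) simp
qed

lemma fst_br: "fst (br x y) = 0"
proof -
  have "br x y \<in> lie_centre br" by (simp add: lie_centre_def two_step)
  then show ?thesis by (auto simp: centre)
qed

definition bracket_v :: "'v \<Rightarrow> 'v \<Rightarrow> 'z" where
  "bracket_v V V' = snd (br (V, 0) (V', 0))"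

lemma br_eq: "br (V, Z) (V', Z') = (0, bracket_v V V')"
proof -
  have "(V, Z) = (V, 0) + (0, Z)" "(V', Z') = (V', 0) + (0, Z')" by simp_all
  then have "br (V, Z) (V', Z') = br ((V, 0) + (0, Z)) ((V', 0) + (0, Z'))" by simp
  also have "\<dots> = br (V, 0) (V', 0)" by (simp only: br_linear br_centre) simp
  finally show ?thesis using fst_br by (auto simp: bracket_v_def prod_eq_iff)
qed

lemma bracket_v_uminus: "bracket_v (- V) V' = - bracket_v V V'"
proof -
  have "br (- (V, 0)) (V', 0) = - br (V, 0) (V', 0)" by (rule br_linear)
  then show ?thesis by (simp add: br_eq)
qed

lemma N_mult_eq: "N_mult br (- (V, Z)) (V', Z') = (V' - V, Z' - Z - (1/2) *\<^sub>R bracket_v V V')"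
  by (simp add: N_mult_def br_eq bracket_v_uminus)

lemma continuous_br: "continuous_on UNIV (\<lambda>p. br (fst p) (snd p))"
proof -
  have "bounded_bilinear br" using bilinear by (simp add: bilinear_conv_bounded_bilinear)
  then show ?thesis
    by (intro bounded_bilinear.continuous_on[of br] continuous_intros)
qed

lemma measurable_N_mult [measurable]:
  assumes [measurable]: "f \<in> borel_measurable M" "g \<in> borel_measurable M"
  shows "(\<lambda>x. N_mult br (- f x) (g x)) \<in> borel_measurable M"
proof -
  have [measurable]: "(\<lambda>p. br (fst p) (snd p)) \<in> borel_measurable borel"
    by (rule borel_measurable_continuous_onI[OF continuous_br])
  have "(\<lambda>x. (\<lambda>p. br (fst p) (snd p)) (- f x, g x)) \<in> borel_measurable M"
    by measurable
  then have [measurable]: "(\<lambda>x. br (- f x) (g x)) \<in> borel_measurable M" by simp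
  show ?thesis unfolding N_mult_def by measurable
qed

end

lemma nn_integral_lborel_translate:
  fixes f :: "'a::euclidean_space \<Rightarrow> ennreal"
  assumes [measurable]: "f \<in> borel_measurable borel"
  shows "(\<integral>\<^sup>+x. f (x - c) \<partial>lborel) = (\<integral>\<^sup>+x. f x \<partial>lborel)"
proof -
  have "(\<integral>\<^sup>+x. f x \<partial>lborel) = (\<integral>\<^sup>+x. f x \<partial>distr lborel borel ((+) (- c)))"
    by (simp add: lborel_distr_plus)
  also have "\<dots> = (\<integral>\<^sup>+x. f (x - c) \<partial>lborel)"
    by (subst nn_integral_distr) auto
  finally show ?thesis by simp
qed

lemma nn_integral_lborel_reflect:
  fixes f :: "'a::euclidean_space \<Rightarrow> ennreal"
  assumes [measurable]: "f \<in> borel_measurable borel"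
  shows "(\<integral>\<^sup>+x. f (c - x) \<partial>lborel) = (\<integral>\<^sup>+x. f x \<partial>lborel)"
proof -
  have "(lborel :: 'a measure) = distr lborel borel (\<lambda>x. c + (- 1) *\<^sub>R x)"
    by (subst lborel_affine[of "-1" c]) (auto simp: density_1)
  then have "(\<integral>\<^sup>+x. f x \<partial>lborel) = (\<integral>\<^sup>+x. f x \<partial>distr lborel borel (\<lambda>x. c + (- 1) *\<^sub>R x))"
    by simp
  also have "\<dots> = (\<integral>\<^sup>+x. f (c - x) \<partial>lborel)"
    by (subst nn_integral_distr) auto
  finally show ?thesis by simp
qed

lemma nn_integral_lborel_pair:
  fixes f :: "'a::euclidean_space \<times> 'b::euclidean_space \<Rightarrow> ennreal"
  assumes [measurable]: "f \<in> borel_measurable borel"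
  shows "(\<integral>\<^sup>+x. f x \<partial>lborel) = (\<integral>\<^sup>+a. \<integral>\<^sup>+b. f (a, b) \<partial>lborel \<partial>lborel)"
proof -
  have "f \<in> borel_measurable (lborel \<Otimes>\<^sub>M lborel)"
    using assms by (subst lborel_prod) simp
  from lborel.nn_integral_fst[OF this, symmetric] show ?thesis
    by (simp only: lborel_prod)
qed

context h_type
begin

lemma measurable_bracket_v [measurable]:
  assumes [measurable]: "f \<in> borel_measurable M" "g \<in> borel_measurable M"
  shows "(\<lambda>x. bracket_v (f x) (g x)) \<in> borel_measurable M"
proof -
  have [measurable]: "(\<lambda>p. br (fst p) (snd p)) \<in> borel_measurable borel"
    by (rule borel_measurable_continuous_onI[OF continuous_br])
  have "(\<lambda>x. (\<lambda>p. br (fst p) (snd p)) ((f x, 0), (g x, 0))) \<in> borel_measurable M"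
    by measurable
  moreover have "snd \<in> borel_measurable (borel :: ('v \<times> 'z) measure)"
    by (intro borel_measurable_continuous_onI continuous_intros)
  ultimately have "(\<lambda>x. snd ((\<lambda>p. br (fst p) (snd p)) ((f x, 0), (g x, 0)))) \<in> borel_measurable M"
    by (rule measurable_compose)
  then show ?thesis by (simp add: bracket_v_def)
qed

text \<open>
  In the coordinates \<open>(V, Z)\<close> a left translation is a translation in \<open>V\<close> followed, for each
  fixed \<open>V\<close>, by a translation in \<open>Z\<close>; Tonelli's theorem treats one variable at a time.
\<close>

lemma nn_integral_N_left:
  fixes f :: "'v \<times> 'z \<Rightarrow> ennreal"
  assumes [measurable]: "f \<in> borel_measurable borel"
  shows "(\<integral>\<^sup>+x. f (N_mult br (- n) x) \<partial>lborel) = (\<integral>\<^sup>+x. f x \<partial>lborel)"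
proof -
  obtain V Z where n: "n = (V, Z)" by (cases n)
  have "(\<integral>\<^sup>+x. f (N_mult br (- n) x) \<partial>lborel) =
    (\<integral>\<^sup>+V'. \<integral>\<^sup>+Z'. f (V' - V, Z' - (Z + (1/2) *\<^sub>R bracket_v V V')) \<partial>lborel \<partial>lborel)"
    by (subst nn_integral_lborel_pair) (simp_all add: n N_mult_eq diff_diff_eq del: uminus_Pair)
  also have "\<dots> = (\<integral>\<^sup>+V'. \<integral>\<^sup>+Z'. f (V' - V, Z') \<partial>lborel \<partial>lborel)"
    by (intro nn_integral_cong nn_integral_lborel_translate[of "\<lambda>z. f (_, z)"]) measurable
  also have "\<dots> = (\<integral>\<^sup>+V'. \<integral>\<^sup>+Z'. f (V', Z') \<partial>lborel \<partial>lborel)"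
    by (intro nn_integral_lborel_translate[of "\<lambda>v. \<integral>\<^sup>+Z'. f (v, Z') \<partial>lborel"]) measurable
  also have "\<dots> = (\<integral>\<^sup>+x. f x \<partial>lborel)"
    by (subst nn_integral_lborel_pair) simp_all
  finally show ?thesis .
qed

text \<open>
  The same computation in the other variable, with reflections in place of translations:
  Lebesgue measure is invariant under right translation and inversion as well.
\<close>

lemma nn_integral_N_inverse:
  fixes f :: "'v \<times> 'z \<Rightarrow> ennreal"
  assumes [measurable]: "f \<in> borel_measurable borel"
  shows "(\<integral>\<^sup>+n. f (N_mult br (- n) x) \<partial>lborel) = (\<integral>\<^sup>+n. f n \<partial>lborel)"
proof -
  obtain V' Z' where x: "x = (V', Z')" by (cases x)
  have "(\<integral>\<^sup>+n. f (N_mult br (- n) x) \<partial>lborel) =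
    (\<integral>\<^sup>+V. \<integral>\<^sup>+Z. f (V' - V, (Z' - (1/2) *\<^sub>R bracket_v V V') - Z) \<partial>lborel \<partial>lborel)"
    by (subst nn_integral_lborel_pair) (simp_all add: x N_mult_eq diff_diff_eq add.commute del: uminus_Pair)
  also have "\<dots> = (\<integral>\<^sup>+V. \<integral>\<^sup>+Z. f (V' - V, Z) \<partial>lborel \<partial>lborel)"
    by (intro nn_integral_cong nn_integral_lborel_reflect[of "\<lambda>z. f (_, z)"]) measurable
  also have "\<dots> = (\<integral>\<^sup>+V. \<integral>\<^sup>+Z. f (V, Z) \<partial>lborel \<partial>lborel)"
    by (intro nn_integral_lborel_reflect[of "\<lambda>v. \<integral>\<^sup>+Z'. f (v, Z') \<partial>lborel"]) measurable
  also have "\<dots> = (\<integral>\<^sup>+x. f x \<partial>lborel)"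
    by (subst nn_integral_lborel_pair) simp_all
  finally show ?thesis .
qed

end

section \<open>Integrals of powers of the Poisson kernel\<close>

context h_type
begin

abbreviation Q :: real where "Q \<equiv> hom_dim br"

lemma Q_pos: "0 < Q"
  by (simp add: hom_dim_def add_pos_pos)

abbreviation poisson_denominator :: "real \<Rightarrow> 'v \<times> 'z \<Rightarrow> real" where
  "poisson_denominator t n \<equiv> (exp t + (norm (fst n))\<^sup>2 / 4)\<^sup>2 + (norm (snd n))\<^sup>2"

lemma poisson_unnormalized_eq:
  "poisson_unnormalized br t n = exp (t * Q) * poisson_denominator t n powr (- Q)"
  by (cases n) (simp add: poisson_unnormalized_def)

lemma poisson_denominator_ge: "(exp t)\<^sup>2 \<le> poisson_denominator t n"
proof -
  have "(exp t)\<^sup>2 \<le> (exp t + (norm (fst n))\<^sup>2 / 4)\<^sup>2" by (intro power_mono) auto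
  then show ?thesis by (simp add: add_increasing2)
qed

lemma poisson_denominator_pos: "0 < poisson_denominator t n"
  using less_le_trans[OF _ poisson_denominator_ge[of t n], of 0] by simp

lemma poisson_unnormalized_pos: "0 < poisson_unnormalized br t n"
proof -
  have "0 < poisson_denominator t n powr (- Q)"
    unfolding powr_gt_zero using poisson_denominator_pos[of t n] by (rule less_imp_neq[symmetric])
  then show ?thesis unfolding poisson_unnormalized_eq by (intro mult_pos_pos) auto
qed

lemma measurable_poisson_unnormalized [measurable]:
  fixes g :: "'c \<Rightarrow> 'v \<times> 'z"
  assumes [measurable]: "f \<in> borel_measurable M" "g \<in> borel_measurable M"
  shows "(\<lambda>x. poisson_unnormalized br (f x) (g x)) \<in> borel_measurable M"
proof -
  have [measurable]: "fst \<in> borel_measurable (borel :: ('v \<times> 'z) measure)"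
    "snd \<in> borel_measurable (borel :: ('v \<times> 'z) measure)"
    by (intro borel_measurable_continuous_onI continuous_intros)+
  have [measurable]: "(\<lambda>x. fst (g x)) \<in> borel_measurable M" "(\<lambda>x. snd (g x)) \<in> borel_measurable M"
    by (rule measurable_compose[of g M borel]; measurable)+
  show ?thesis unfolding poisson_unnormalized_eq by measurable
qed

text \<open>
  The sets in question are boxes adapted to the dilations of \<open>N\<close>: \<open>|V|\<close> at most \<open>\<surd>b\<close> and
  \<open>|Z|\<close> at most \<open>b\<close>, with \<open>b = 4\<^sup>i e\<^sup>t\<close>. Taking the smallest box that contains \<open>n\<close>, the point is
  outside the preceding one, which bounds the denominator from below by a multiple of \<open>b\<^sup>2\<close>.
  The factor 256 is \<open>16\<^sup>2\<close>: the preceding box has \<open>b/4\<close>, and \<open>|V|\<^sup>2\<close> is divided by another 4.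
\<close>

lemma dyadic_shell:
  fixes n :: "'v \<times> 'z"
  obtains i :: nat where "norm (fst n) \<le> sqrt (4 ^ i * exp t)" "norm (snd n) \<le> 4 ^ i * exp t"
    "(4 ^ i * exp t)\<^sup>2 / 256 \<le> poisson_denominator t n"
proof -
  define P where "P i \<longleftrightarrow> (norm (fst n))\<^sup>2 \<le> 4 ^ i * exp t \<and> norm (snd n) \<le> 4 ^ i * exp t" for i :: nat
  obtain i where "max ((norm (fst n))\<^sup>2) (norm (snd n)) / exp t < 4 ^ i"
    using real_arch_pow[of 4 "max ((norm (fst n))\<^sup>2) (norm (snd n)) / exp t"] by auto
  then have "P i" by (auto simp: P_def field_simps)
  define i where "i = (LEAST i. P i)"
  have i: "P i" unfolding i_def by (rule LeastI) fact
  have "(4 ^ i * exp t)\<^sup>2 / 256 \<le> poisson_denominator t n"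
  proof (cases i)
    case 0
    have "(4 ^ i * exp t)\<^sup>2 / 256 \<le> (exp t)\<^sup>2" using 0 by simp
    also note poisson_denominator_ge[of t n]
    finally show ?thesis .
  next
    case (Suc j)
    then have "\<not> P j" using not_less_Least[of j P] by (simp add: i_def)
    then consider "4 ^ j * exp t < (norm (fst n))\<^sup>2" | "4 ^ j * exp t < norm (snd n)"
      by (auto simp: P_def)
    then show ?thesis
    proof cases
      case 1
      have "(4 ^ i * exp t / 16)\<^sup>2 \<le> (exp t + (norm (fst n))\<^sup>2 / 4)\<^sup>2"
      proof (intro power_mono)
        have "4 ^ i * exp t / 16 \<le> (norm (fst n))\<^sup>2 / 4" using 1 Suc by (simp add: mult_ac)
        then show "4 ^ i * exp t / 16 \<le> exp t + (norm (fst n))\<^sup>2 / 4"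
          by (rule add_increasing[rotated]) simp
      qed simp
      then show ?thesis by (simp add: power_divide add_increasing2)
    next
      case 2
      have "(4 ^ i * exp t / 16)\<^sup>2 \<le> (norm (snd n))\<^sup>2"
      proof (intro power_mono)
        have "4 ^ i * exp t / 16 \<le> 4 ^ j * exp t" using Suc by simp
        then show "4 ^ i * exp t / 16 \<le> norm (snd n)" using 2 by linarith
      qed auto
      then show ?thesis by (simp add: power_divide add_increasing)
    qed
  qed
  with i show ?thesis by (intro that[of i]) (auto simp: P_def real_le_rsqrt)
qed

lemma emeasure_homogeneous_box:
  assumes "0 \<le> b"
  shows "emeasure lborel (cball (0::'v) (sqrt b) \<times> cball (0::'z) b) =
    ennreal (unit_ball_vol (real DIM('v)) * unit_ball_vol (real DIM('z)) * b powr Q)"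
proof (cases "b = 0")
  case True
  then show ?thesis using assms by (simp add: emeasure_lborel_countable)
next
  case False
  then have b: "0 < b" using assms by simp
  have "emeasure lborel (cball (0::'v) (sqrt b) \<times> cball (0::'z) b) =
    emeasure (lborel \<Otimes>\<^sub>M lborel) (cball (0::'v) (sqrt b) \<times> cball (0::'z) b)"
    by (simp only: lborel_prod)
  also have "\<dots> = emeasure lborel (cball (0::'v) (sqrt b)) * emeasure lborel (cball (0::'z) b)"
    by (intro lborel.emeasure_pair_measure_Times) auto
  also have "\<dots> = ennreal ((unit_ball_vol (real DIM('v)) * sqrt b ^ DIM('v)) * (unit_ball_vol (real DIM('z)) * b ^ DIM('z)))"
    using b by (simp add: emeasure_cball ennreal_mult)
  also have "(unit_ball_vol (real DIM('v)) * sqrt b ^ DIM('v)) * (unit_ball_vol (real DIM('z)) * b ^ DIM('z)) =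
     unit_ball_vol (real DIM('v)) * unit_ball_vol (real DIM('z)) * b powr Q"
  proof -
    have "sqrt b ^ DIM('v) = (b powr (1/2)) powr real DIM('v)"
      using b by (simp add: powr_half_sqrt powr_realpow)
    then have 1: "sqrt b ^ DIM('v) = b powr (real DIM('v) / 2)" by (simp add: powr_powr)
    have 2: "b ^ DIM('z) = b powr real DIM('z)" using b by (simp add: powr_realpow)
    show ?thesis unfolding 1 2 hom_dim_def powr_add by simp
  qed
  finally show ?thesis .
qed

text \<open>
  A sum over dyadic boxes. A box of size \<open>b\<close> has measure of order \<open>b\<^sup>Q\<close>, and the integrand is of order
  \<open>e\<^bsup>tQ\<beta>\<^esup> b\<^bsup>-2Q\<beta>\<^esup>\<close> on it, so with \<open>b = 4\<^sup>i e\<^sup>t\<close> the series is geometric with ratio \<open>4\<close> to the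
  \<open>Q (1 - 2\<beta>)\<close>, and \<open>\<beta> > 1/2\<close> is exactly the condition for convergence. Scaling the boxes with
  \<open>e\<^sup>t\<close> gives the dependence on \<open>t\<close> without a change of variables.
\<close>

lemma nn_integral_poisson_unnormalized_powr:
  assumes \<beta>: "1/2 < \<beta>"
  shows "\<exists>C>0. \<forall>t. (\<integral>\<^sup>+n. ennreal (poisson_unnormalized br t n powr \<beta>) \<partial>lborel) \<le> ennreal (C * exp (Q * t * (1 - \<beta>)))"
proof -
  define c0 where "c0 = unit_ball_vol (real DIM('v)) * unit_ball_vol (real DIM('z))"
  have c0: "0 < c0" by (simp add: c0_def)
  define r where "r = (4::real) powr (Q * (1 - 2 * \<beta>))"
  have "r < 4 powr 0"
    unfolding r_def using Q_pos \<beta> by (intro powr_less_mono) (auto simp: mult_pos_neg)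
  then have r: "0 < r" "r < 1" by (simp_all add: r_def)
  define C where "C = c0 * 256 powr (Q * \<beta>) / (1 - r)"
  have "0 < C" using c0 r by (simp add: C_def)
  moreover have "(\<integral>\<^sup>+n. ennreal (poisson_unnormalized br t n powr \<beta>) \<partial>lborel) \<le> ennreal (C * exp (Q * t * (1 - \<beta>)))" for t
  proof -
    define b where "b i = 4 ^ i * exp t" for i :: nat
    define A :: "nat \<Rightarrow> ('v \<times> 'z) set" where "A i = cball 0 (sqrt (b i)) \<times> cball 0 (b i)" for i
    have b: "0 < b i" for i by (simp add: b_def)
    have A [measurable]: "A i \<in> sets borel" for i
      unfolding A_def by (intro borel_closed closed_Times closed_cball)
    define K where "K i = exp (t * (Q * \<beta>)) * ((b i)\<^sup>2 / 256) powr (- (Q * \<beta>))" for i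
    have "ennreal (poisson_unnormalized br t n powr \<beta>) \<le> (\<Sum>i. ennreal (K i) * indicator (A i) n)" for n :: "'v \<times> 'z"
    proof -
      obtain i where i: "norm (fst n) \<le> sqrt (b i)" "norm (snd n) \<le> b i"
        "(b i)\<^sup>2 / 256 \<le> poisson_denominator t n"
        unfolding b_def by (rule dyadic_shell)
      have "poisson_unnormalized br t n powr \<beta> = exp (t * (Q * \<beta>)) * poisson_denominator t n powr (- (Q * \<beta>))"
        using poisson_denominator_pos[of t n]
        by (simp add: poisson_unnormalized_eq powr_mult powr_powr exp_powr_real mult.assoc)
      also have "\<dots> \<le> K i"
        unfolding K_def using i(3) b[of i] Q_pos \<beta> by (intro mult_left_mono powr_mono2') auto
      finally have "ennreal (poisson_unnormalized br t n powr \<beta>) \<le> ennreal (K i) * indicator (A i) n"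
        using i by (cases n) (auto simp: A_def intro!: ennreal_leI)
      also have "\<dots> \<le> (\<Sum>i. ennreal (K i) * indicator (A i) n)"
      proof -
        have "h i \<le> suminf h" for h :: "nat \<Rightarrow> ennreal"
          using sum_le_suminf[of h "{i}"] by simp
        then show ?thesis .
      qed
      finally show ?thesis .
    qed
    then have "(\<integral>\<^sup>+n. ennreal (poisson_unnormalized br t n powr \<beta>) \<partial>lborel) \<le>
      (\<integral>\<^sup>+n. (\<Sum>i. ennreal (K i) * indicator (A i) n) \<partial>lborel)"
      by (intro nn_integral_mono)
    also have "\<dots> = (\<Sum>i. ennreal (K i) * emeasure lborel (A i))"
      by (subst nn_integral_suminf) (auto simp: nn_integral_cmult A)
    also have "\<dots> = (\<Sum>i. ennreal (c0 * 256 powr (Q * \<beta>) * exp (Q * t * (1 - \<beta>)) * r ^ i))"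
    proof (intro suminf_cong)
      fix i
      have "ennreal (K i) * emeasure lborel (A i) = ennreal (K i) * ennreal (c0 * b i powr Q)"
        using b[of i] by (simp add: A_def emeasure_homogeneous_box c0_def)
      also have "\<dots> = ennreal (K i * (c0 * b i powr Q))"
        using b[of i] c0 by (simp add: ennreal_mult K_def)
      also have "K i * (c0 * b i powr Q) = c0 * 256 powr (Q * \<beta>) * exp (Q * t * (1 - \<beta>)) * r ^ i"
      proof -
        have 1: "((b i)\<^sup>2 / 256) powr (- (Q * \<beta>)) = 256 powr (Q * \<beta>) * b i powr (- 2 * Q * \<beta>)"
        proof -
          have "(b i)\<^sup>2 = b i powr 2" using b[of i] by simp
          then have "((b i)\<^sup>2 / 256) powr (- (Q * \<beta>)) = (b i powr 2) powr (- (Q * \<beta>)) / 256 powr (- (Q * \<beta>))"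
            by (simp only: powr_divide powr_ge_zero)
          moreover have "(b i powr 2) powr (- (Q * \<beta>)) = b i powr (- 2 * Q * \<beta>)"
            by (simp add: powr_powr mult.assoc)
          moreover have "x / 256 powr (- (Q * \<beta>)) = 256 powr (Q * \<beta>) * x" for x :: real
            by (simp only: powr_minus divide_inverse inverse_inverse_eq mult.commute)
          ultimately show ?thesis by (simp only:)
        qed
        have 2: "b i powr (- 2 * Q * \<beta>) * b i powr Q = b i powr (Q * (1 - 2 * \<beta>))"
          by (simp add: powr_add[symmetric] algebra_simps)
        have "(4 ^ i) powr (Q * (1 - 2 * \<beta>)) = (4 powr real i) powr (Q * (1 - 2 * \<beta>))"
          by (subst powr_realpow) auto
        also have "\<dots> = r powr real i"
          unfolding r_def powr_powr by (simp only: mult.commute)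
        also have "\<dots> = r ^ i" using r by (simp add: powr_realpow)
        finally have "(4 ^ i) powr (Q * (1 - 2 * \<beta>)) = r ^ i" .
        then have 3: "b i powr (Q * (1 - 2 * \<beta>)) = r ^ i * exp (t * (Q * (1 - 2 * \<beta>)))"
          by (simp add: b_def powr_mult exp_powr_real)
        have 4: "exp (t * (Q * \<beta>)) * exp (t * (Q * (1 - 2 * \<beta>))) = exp (Q * t * (1 - \<beta>))"
          by (simp add: exp_add[symmetric] algebra_simps)
        have "K i * (c0 * b i powr Q) =
          c0 * 256 powr (Q * \<beta>) * (exp (t * (Q * \<beta>)) * (b i powr (- 2 * Q * \<beta>) * b i powr Q))"
          by (simp add: K_def 1)
        also have "\<dots> = c0 * 256 powr (Q * \<beta>) * ((exp (t * (Q * \<beta>)) * exp (t * (Q * (1 - 2 * \<beta>)))) * r ^ i)"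
          unfolding 2 3 by (simp only: mult_ac)
        finally show ?thesis by (simp add: 4)
      qed
      finally show "ennreal (K i) * emeasure lborel (A i) = ennreal (c0 * 256 powr (Q * \<beta>) * exp (Q * t * (1 - \<beta>)) * r ^ i)" .
    qed
    also have "\<dots> = ennreal (C * exp (Q * t * (1 - \<beta>)))"
    proof (rule suminf_ennreal_eq)
      have "(\<lambda>i. r ^ i) sums (1 / (1 - r))" using r by (intro geometric_sums) auto
      from sums_mult[OF this, of "c0 * 256 powr (Q * \<beta>) * exp (Q * t * (1 - \<beta>))"]
      show "(\<lambda>i. c0 * 256 powr (Q * \<beta>) * exp (Q * t * (1 - \<beta>)) * r ^ i) sums (C * exp (Q * t * (1 - \<beta>)))"
        by (simp add: C_def mult_ac)
    qed (use c0 r in auto)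
    finally show ?thesis .
  qed
  ultimately show ?thesis by blast
qed

text \<open>
  Integrability of the kernel is needed here: the integral of a non-integrable function is 0
  by convention, and the normalising constant would be \<open>1/0 = 0\<close>.
\<close>

lemma poisson_const_pos: "0 < poisson_const br"
  and emeasure_poisson_measure: "emeasure (poisson_measure br) (space (poisson_measure br)) = 1"
proof -
  obtain C where C: "(\<integral>\<^sup>+n. ennreal (poisson_unnormalized br 0 n) \<partial>lborel) \<le> ennreal C"
    using nn_integral_poisson_unnormalized_powr[of 1] poisson_unnormalized_pos
    by (auto simp: less_imp_le simp del: split_paired_All elim!: allE[of _ "0::real"])
  have int: "integrable lborel (poisson_unnormalized br 0)"
  proof (intro integrableI_bounded)
    show "(\<integral>\<^sup>+n. ennreal (norm (poisson_unnormalized br 0 n)) \<partial>lborel) < \<infinity>"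
      using C poisson_unnormalized_pos by (simp add: less_imp_le order.strict_trans1)
  qed measurable
  have "0 \<noteq> (LINT n|lborel. poisson_unnormalized br 0 n)"
  proof
    assume "0 = (LINT n|lborel. poisson_unnormalized br 0 n)"
    then have "AE n in lborel. poisson_unnormalized br 0 n = 0"
      using integral_nonneg_eq_0_iff_AE[OF int] poisson_unnormalized_pos by (auto simp: less_imp_le)
    then have "AE n in (lborel :: ('v \<times> 'z) measure). False"
      using poisson_unnormalized_pos by (auto simp: less_le)
    then show False by (simp add: eventually_False ae_filter_eq_bot_iff)
  qed
  moreover have "0 \<le> (LINT n|lborel. poisson_unnormalized br 0 n)"
    using poisson_unnormalized_pos by (intro integral_nonneg_AE) (auto simp: less_imp_le)
  ultimately have pos: "0 < (LINT n|lborel. poisson_unnormalized br 0 n)" by simp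
  then show p: "0 < poisson_const br" by (simp add: poisson_const_def)
  have "emeasure (poisson_measure br) (space (poisson_measure br)) = (\<integral>\<^sup>+n. ennreal (poisson br 0 n) \<partial>lborel)"
    unfolding poisson_measure_def by (subst emeasure_density) (auto simp: poisson_def)
  also have "\<dots> = ennreal (LINT n|lborel. poisson br 0 n)"
    using int p poisson_unnormalized_pos
    by (intro nn_integral_eq_integral) (auto simp: poisson_def less_imp_le)
  also have "(LINT n|lborel. poisson br 0 n) = 1"
    using pos by (simp add: poisson_def[abs_def] poisson_const_def)
  finally show "emeasure (poisson_measure br) (space (poisson_measure br)) = 1" by simp
qed

lemma poisson_pos: "0 < poisson br t n"
  using poisson_const_pos poisson_unnormalized_pos by (simp add: poisson_def)

lemma measurable_poisson [measurable]:
  fixes g :: "'c \<Rightarrow> 'v \<times> 'z"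
  assumes [measurable]: "f \<in> borel_measurable M" "g \<in> borel_measurable M"
  shows "(\<lambda>x. poisson br (f x) (g x)) \<in> borel_measurable M"
  unfolding poisson_def by measurable

lemma poisson_0_le: "poisson br 0 n \<le> poisson_const br"
proof -
  have "1 \<le> poisson_denominator 0 n" using poisson_denominator_ge[of 0 n] by simp
  then have "poisson_denominator 0 n powr (- Q) \<le> 1"
    using Q_pos by (simp add: powr_minus inverse_le_1_iff ge_one_powr_ge_zero)
  then show ?thesis
    using poisson_const_pos by (simp add: poisson_def poisson_unnormalized_eq)
qed

lemma nn_integral_poisson_powr:
  assumes \<beta>: "1/2 < \<beta>"
  shows "\<exists>C>0. \<forall>t. (\<integral>\<^sup>+n. ennreal (poisson br t n powr \<beta>) \<partial>lborel) \<le> ennreal (C * exp (Q * t * (1 - \<beta>)))"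
proof -
  from nn_integral_poisson_unnormalized_powr[OF \<beta>] obtain C where C: "0 < C"
    "\<And>t. (\<integral>\<^sup>+n. ennreal (poisson_unnormalized br t n powr \<beta>) \<partial>lborel) \<le> ennreal (C * exp (Q * t * (1 - \<beta>)))"
    by blast
  let ?c = "poisson_const br powr \<beta>"
  have "(\<integral>\<^sup>+n. ennreal (poisson br t n powr \<beta>) \<partial>lborel) \<le> ennreal (?c * C * exp (Q * t * (1 - \<beta>)))" for t
  proof -
    have "(\<integral>\<^sup>+n. ennreal (poisson br t n powr \<beta>) \<partial>lborel) =
      (\<integral>\<^sup>+n. ennreal ?c * ennreal (poisson_unnormalized br t n powr \<beta>) \<partial>lborel)"
      using poisson_const_pos poisson_unnormalized_pos
      by (intro nn_integral_cong) (simp add: poisson_def powr_mult ennreal_mult less_imp_le)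
    also have "\<dots> = ennreal ?c * (\<integral>\<^sup>+n. ennreal (poisson_unnormalized br t n powr \<beta>) \<partial>lborel)"
      by (intro nn_integral_cmult) measurable
    also have "\<dots> \<le> ennreal ?c * ennreal (C * exp (Q * t * (1 - \<beta>)))"
      by (intro mult_left_mono C) auto
    finally show ?thesis using C(1) by (simp add: ennreal_mult mult.assoc)
  qed
  then show ?thesis
    using C(1) poisson_const_pos by (intro exI[of _ "?c * C"]) simp
qed

lemma poisson_S_pos: "0 < poisson_S br x n"
  by (cases x) (simp add: poisson_S_def poisson_pos)

lemma sets_haar_S [simp, measurable_cong]: "sets (haar_S br) = sets borel"
  and space_haar_S [simp]: "space (haar_S br) = UNIV"
  by (simp_all add: haar_S_def)

lemma sets_poisson_measure [simp, measurable_cong]: "sets (poisson_measure br) = sets borel"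
  and space_poisson_measure [simp]: "space (poisson_measure br) = UNIV"
  by (simp_all add: poisson_measure_def)

lemma measurable_poisson_S [measurable]:
  fixes g :: "'c \<Rightarrow> 'v \<times> 'z"
  assumes [measurable]: "f \<in> borel_measurable M" "g \<in> borel_measurable M"
  shows "(\<lambda>x. poisson_S br (f x) (g x)) \<in> borel_measurable M"
proof -
  have [measurable]: "fst \<in> borel_measurable (borel :: (('v \<times> 'z) \<times> real) measure)"
    "snd \<in> borel_measurable (borel :: (('v \<times> 'z) \<times> real) measure)"
    by (intro borel_measurable_continuous_onI continuous_intros)+
  have [measurable]: "(\<lambda>x. fst (f x)) \<in> borel_measurable M" "(\<lambda>x. snd (f x)) \<in> borel_measurable M"
    by (rule measurable_compose[of f M borel]; measurable)+
  show ?thesis unfolding poisson_S_def case_prod_beta by measurable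
qed

lemma nn_integral_haar_S:
  assumes [measurable]: "f \<in> borel_measurable borel"
  shows "(\<integral>\<^sup>+x. f x \<partial>haar_S br) = (\<integral>\<^sup>+t. ennreal (exp (- Q * t)) * (\<integral>\<^sup>+n. f (n, t) \<partial>lborel) \<partial>lborel)"
proof -
  have [measurable]: "snd \<in> borel_measurable (borel :: (('v \<times> 'z) \<times> real) measure)"
    by (intro borel_measurable_continuous_onI continuous_intros)
  have "(\<integral>\<^sup>+x. f x \<partial>haar_S br) = (\<integral>\<^sup>+x. ennreal (exp (- Q * snd x)) * f x \<partial>lborel)"
    unfolding haar_S_def case_prod_beta by (subst nn_integral_density) (auto simp: rho_def)
  also have "\<dots> = (\<integral>\<^sup>+n. \<integral>\<^sup>+t. ennreal (exp (- Q * t)) * f (n, t) \<partial>lborel \<partial>lborel)"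
    by (subst nn_integral_lborel_pair) auto
  also have "\<dots> = (\<integral>\<^sup>+t. \<integral>\<^sup>+n. ennreal (exp (- Q * t)) * f (n, t) \<partial>lborel \<partial>lborel)"
    by (intro lborel_pair.Fubini'[symmetric]) measurable
  also have "\<dots> = (\<integral>\<^sup>+t. ennreal (exp (- Q * t)) * (\<integral>\<^sup>+n. f (n, t) \<partial>lborel) \<partial>lborel)"
    by (intro nn_integral_cong nn_integral_cmult) measurable
  finally show ?thesis .
qed

lemma sigma_finite_haar_S: "sigma_finite_measure (haar_S br)"
proof -
  have [measurable]: "snd \<in> borel_measurable (borel :: (('v \<times> 'z) \<times> real) measure)"
    by (intro borel_measurable_continuous_onI continuous_intros)
  show ?thesis
    unfolding haar_S_def case_prod_beta
    by (subst sigma_finite_measure.sigma_finite_iff_density_finite[OF sigma_finite_lborel]) auto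
qed

text \<open>
  Slices of unit height in \<open>t\<close>, over which powers of \<open>e\<^sup>t\<close> are constant up to a bounded factor.
\<close>

definition slice :: "int \<Rightarrow> (('v \<times> 'z) \<times> real) set" where
  "slice j = {x. \<lfloor>snd x\<rfloor> = j}"

lemma sets_slice [measurable]: "slice j \<in> sets borel"
proof -
  have [measurable]: "snd \<in> borel_measurable (borel :: (('v \<times> 'z) \<times> real) measure)"
    by (intro borel_measurable_continuous_onI continuous_intros)
  show ?thesis unfolding slice_def by measurable
qed

text \<open>
  One of the two marginal bounds for Young's inequality: integration over \<open>N\<close>.
\<close>

lemma nn_integral_kernel_boundary:
  assumes \<beta>: "1/2 < \<beta>"
  shows "\<exists>C>0. \<forall>j x. (\<integral>\<^sup>+n. indicator (slice j) x * ennreal (poisson_S br x n powr \<beta>) \<partial>lborel)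
    \<le> ennreal (C * exp (Q * real_of_int j * (1 - \<beta>)))"
proof -
  from nn_integral_poisson_powr[OF \<beta>] obtain C where C: "0 < C"
    "\<And>t. (\<integral>\<^sup>+n. ennreal (poisson br t n powr \<beta>) \<partial>lborel) \<le> ennreal (C * exp (Q * t * (1 - \<beta>)))"
    by blast
  have "(\<integral>\<^sup>+n. indicator (slice j) x * ennreal (poisson_S br x n powr \<beta>) \<partial>lborel)
    \<le> ennreal (C * exp (Q * \<bar>1 - \<beta>\<bar>) * exp (Q * real_of_int j * (1 - \<beta>)))" for j x
  proof -
    obtain n1 t where x: "x = (n1, t)" by (cases x)
    have "(\<integral>\<^sup>+n. ennreal (poisson_S br x n powr \<beta>) \<partial>lborel) = (\<integral>\<^sup>+n. ennreal (poisson br t n powr \<beta>) \<partial>lborel)"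
      unfolding x poisson_S_def prod.case
      by (rule nn_integral_N_inverse[where f="\<lambda>n. ennreal (poisson br t n powr \<beta>)"]) measurable
    also have "\<dots> \<le> ennreal (C * exp (Q * t * (1 - \<beta>)))" by (rule C)
    finally have 1: "(\<integral>\<^sup>+n. ennreal (poisson_S br x n powr \<beta>) \<partial>lborel) \<le> ennreal (C * exp (Q * t * (1 - \<beta>)))" .
    show ?thesis
    proof (cases "x \<in> slice j")
      case True
      then have j: "real_of_int j \<le> t" "t < real_of_int j + 1"
        by (auto simp: slice_def x floor_eq_iff)
      have "(t - j) * (1 - \<beta>) \<le> \<bar>1 - \<beta>\<bar>"
      proof -
        have "(t - j) * (1 - \<beta>) \<le> (t - j) * \<bar>1 - \<beta>\<bar>" using j by (intro mult_left_mono) auto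
        also have "\<dots> \<le> 1 * \<bar>1 - \<beta>\<bar>" using j by (intro mult_right_mono) auto
        finally show ?thesis by simp
      qed
      from mult_left_mono[OF this, of Q] have "Q * t * (1 - \<beta>) \<le> Q * \<bar>1 - \<beta>\<bar> + Q * real_of_int j * (1 - \<beta>)"
        using Q_pos by (simp add: algebra_simps)
      then have "exp (Q * t * (1 - \<beta>)) \<le> exp (Q * \<bar>1 - \<beta>\<bar>) * exp (Q * real_of_int j * (1 - \<beta>))"
        by (simp add: exp_add[symmetric])
      then have "ennreal (C * exp (Q * t * (1 - \<beta>))) \<le> ennreal (C * exp (Q * \<bar>1 - \<beta>\<bar>) * exp (Q * real_of_int j * (1 - \<beta>)))"
        using C(1) by (intro ennreal_leI) (simp add: mult.assoc)
      with 1 True show ?thesis by simp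
    qed simp
  qed
  then show ?thesis using C(1) by (intro exI[of _ "C * exp (Q * \<bar>1 - \<beta>\<bar>)"]) simp
qed

text \<open>
  The other marginal bound, over a slice: the density \<open>e\<^bsup>-Qt\<^esup>\<close> of the Haar measure cancels the
  part of \<open>e\<^bsup>Qt(1-\<beta>)\<^esup>\<close> that is free of \<open>\<beta>\<close>.
\<close>

lemma nn_integral_kernel_space:
  assumes \<beta>: "1/2 < \<beta>"
  shows "\<exists>C>0. \<forall>j n. (\<integral>\<^sup>+x. indicator (slice j) x * ennreal (poisson_S br x n powr \<beta>) \<partial>haar_S br)
    \<le> ennreal (C * exp (- Q * real_of_int j * \<beta>))"
proof -
  from nn_integral_poisson_powr[OF \<beta>] obtain C where C: "0 < C"
    "\<And>t. (\<integral>\<^sup>+n. ennreal (poisson br t n powr \<beta>) \<partial>lborel) \<le> ennreal (C * exp (Q * t * (1 - \<beta>)))"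
    by blast
  have "(\<integral>\<^sup>+x. indicator (slice j) x * ennreal (poisson_S br x n powr \<beta>) \<partial>haar_S br)
    \<le> ennreal (C * exp (- Q * real_of_int j * \<beta>))" for j n
  proof -
    have "(\<integral>\<^sup>+x. indicator (slice j) x * ennreal (poisson_S br x n powr \<beta>) \<partial>haar_S br) =
       (\<integral>\<^sup>+t. ennreal (exp (- Q * t)) * (\<integral>\<^sup>+n1. indicator (slice j) (n1, t) * ennreal (poisson_S br (n1, t) n powr \<beta>) \<partial>lborel) \<partial>lborel)"
      by (intro nn_integral_haar_S) measurable
    also have "\<dots> \<le> (\<integral>\<^sup>+t. ennreal (C * exp (- Q * real_of_int j * \<beta>)) * indicator {real_of_int j..<real_of_int j + 1} t \<partial>lborel)"
    proof (intro nn_integral_mono)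
      fix t :: real
      show "ennreal (exp (- Q * t)) * (\<integral>\<^sup>+n1. indicator (slice j) (n1, t) * ennreal (poisson_S br (n1, t) n powr \<beta>) \<partial>lborel)
        \<le> ennreal (C * exp (- Q * real_of_int j * \<beta>)) * indicator {real_of_int j..<real_of_int j + 1} t"
      proof (cases "\<lfloor>t\<rfloor> = j")
        case True
        then have j: "real_of_int j \<le> t" "t < real_of_int j + 1" by (auto simp: floor_eq_iff)
        have "(\<integral>\<^sup>+n1. ennreal (poisson_S br (n1, t) n powr \<beta>) \<partial>lborel) = (\<integral>\<^sup>+n. ennreal (poisson br t n powr \<beta>) \<partial>lborel)"
          unfolding poisson_S_def prod.case
          by (rule nn_integral_N_left[where f="\<lambda>n. ennreal (poisson br t n powr \<beta>)"]) measurable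
        also have "\<dots> \<le> ennreal (C * exp (Q * t * (1 - \<beta>)))" by (rule C)
        finally have "ennreal (exp (- Q * t)) * (\<integral>\<^sup>+n1. ennreal (poisson_S br (n1, t) n powr \<beta>) \<partial>lborel) \<le>
          ennreal (exp (- Q * t)) * ennreal (C * exp (Q * t * (1 - \<beta>)))"
          by (intro mult_left_mono) auto
        also have "\<dots> = ennreal (exp (- Q * t) * (C * exp (Q * t * (1 - \<beta>))))"
          using C(1) by (simp only: ennreal_mult exp_ge_zero less_imp_le mult_nonneg_nonneg)
        also have "exp (- Q * t) * (C * exp (Q * t * (1 - \<beta>))) = C * exp (- Q * t * \<beta>)"
          by (simp add: exp_add[symmetric] algebra_simps)
        also have "ennreal (C * exp (- Q * t * \<beta>)) \<le> ennreal (C * exp (- Q * real_of_int j * \<beta>))"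
          using C(1) j Q_pos \<beta> by (intro ennreal_leI) simp
        finally have "ennreal (exp (- Q * t)) * (\<integral>\<^sup>+n1. ennreal (poisson_S br (n1, t) n powr \<beta>) \<partial>lborel) \<le>
          ennreal (C * exp (- Q * real_of_int j * \<beta>))" .
        then show ?thesis using True j by (simp add: slice_def)
      qed (simp add: slice_def)
    qed
    also have "\<dots> = ennreal (C * exp (- Q * real_of_int j * \<beta>))"
      by (simp add: nn_integral_cmult)
    finally show ?thesis .
  qed
  then show ?thesis using C(1) by blast
qed

end

section \<open>Operators whose kernel is a power of the Poisson kernel\<close>

context h_type
begin

interpretation haar: sigma_finite_measure "haar_S br"
  by (rule sigma_finite_haar_S)

definition kernel_op :: "real \<Rightarrow> (('v \<times> 'z) \<times> real \<Rightarrow> ennreal) \<Rightarrow> 'v \<times> 'z \<Rightarrow> ennreal" where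
  "kernel_op a \<phi> n = (\<integral>\<^sup>+x. \<phi> x * ennreal (poisson_S br x n powr a) \<partial>haar_S br)"

lemma measurable_kernel_op [measurable]:
  assumes [measurable]: "\<phi> \<in> borel_measurable borel"
  shows "kernel_op a \<phi> \<in> borel_measurable borel"
  unfolding kernel_op_def[abs_def] by measurable

abbreviation on_slice :: "int \<Rightarrow> (('v \<times> 'z) \<times> real \<Rightarrow> ennreal) \<Rightarrow> ('v \<times> 'z) \<times> real \<Rightarrow> ennreal" where
  "on_slice j \<phi> \<equiv> \<lambda>x. indicator (slice j) x * \<phi> x"

lemma nn_integral_slices:
  assumes [measurable]: "g \<in> borel_measurable borel"
  shows "(\<integral>\<^sup>+x. g x \<partial>haar_S br) = (\<integral>\<^sup>+j. (\<integral>\<^sup>+x. indicator (slice j) x * g x \<partial>haar_S br) \<partial>count_space UNIV)"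
proof -
  have "g x = (\<integral>\<^sup>+j. indicator (slice j) x * g x \<partial>count_space UNIV)" for x
  proof -
    have "(\<integral>\<^sup>+j. indicator (slice j) x * g x \<partial>count_space UNIV) =
      (\<integral>\<^sup>+j. g x * indicator {\<lfloor>snd x\<rfloor>} j \<partial>count_space UNIV)"
      by (intro nn_integral_cong) (auto simp: slice_def indicator_def)
    then show ?thesis by (simp add: nn_integral_cmult_indicator)
  qed
  then have "(\<integral>\<^sup>+x. g x \<partial>haar_S br) = (\<integral>\<^sup>+x. \<integral>\<^sup>+j. indicator (slice j) x * g x \<partial>count_space UNIV \<partial>haar_S br)"
    by (intro nn_integral_cong)
  also have "\<dots> = (\<integral>\<^sup>+j. (\<integral>\<^sup>+x. indicator (slice j) x * g x \<partial>haar_S br) \<partial>count_space UNIV)"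
    by (intro nn_integral_count_space_nn_integral) auto
  finally show ?thesis .
qed

lemma kernel_op_slices:
  assumes [measurable]: "\<phi> \<in> borel_measurable borel"
  shows "kernel_op a \<phi> n = (\<integral>\<^sup>+j. kernel_op a (on_slice j \<phi>) n \<partial>count_space UNIV)"
  unfolding kernel_op_def
  by (subst nn_integral_slices) (auto simp: mult.assoc)

text \<open>
  Young's inequality for the kernel \<open>\<P>\<^sup>\<beta>\<close> on a slice, with \<open>s = 1/u + 1 - 1/p\<close> and \<open>\<beta> = a/s\<close>. The
  hypothesis on \<open>a\<close> says \<open>\<beta> > 1/2\<close>. The exponents of the two marginal bounds combine to
  \<open>1 - u a\<close>, so the sign of \<open>1/u - a\<close> decides whether the bound improves as \<open>j\<close> goes to
  plus or to minus infinity.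
\<close>

lemma kernel_op_slice_bound:
  assumes pu: "1 < p" "p < u" and a: "1 / u + 1 - 1 / p < 2 * a"
  shows "\<exists>C>0. \<forall>j \<phi>. \<phi> \<in> borel_measurable borel \<longrightarrow>
    (\<integral>\<^sup>+n. enn_powr (kernel_op a (on_slice j \<phi>) n) u \<partial>lborel) \<le>
      ennreal (C * exp (Q * real_of_int j * (1 - u * a))) *
      enn_powr (\<integral>\<^sup>+x. indicator (slice j) x * enn_powr (\<phi> x) p \<partial>haar_S br) (u / p)"
proof -
  define s where "s = 1 / u + 1 - 1 / p"
  define \<beta> where "\<beta> = a / s"
  have s: "0 < s"
  proof -
    have "0 < 1 / u" "1 / p < 1" using pu by simp_all
    then show ?thesis unfolding s_def by linarith
  qed
  have \<beta>: "1 / 2 < \<beta>" using a s unfolding s_def[symmetric] by (simp add: \<beta>_def field_simps)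
  obtain C1 where C1: "0 < C1" "\<And>j x. (\<integral>\<^sup>+n. indicator (slice j) x * ennreal (poisson_S br x n powr \<beta>) \<partial>lborel)
    \<le> ennreal (C1 * exp (Q * real_of_int j * (1 - \<beta>)))"
    using nn_integral_kernel_boundary[OF \<beta>] by blast
  obtain C2 where C2: "0 < C2" "\<And>j n. (\<integral>\<^sup>+x. indicator (slice j) x * ennreal (poisson_S br x n powr \<beta>) \<partial>haar_S br)
    \<le> ennreal (C2 * exp (- Q * real_of_int j * \<beta>))"
    using nn_integral_kernel_space[OF \<beta>] by blast
  define w where "w = u * (1 - 1 / p)"
  have w: "0 < w" using pu by (simp add: w_def)
  have sw: "u * s = 1 + w" using pu by (simp add: s_def w_def field_simps)
  have "(\<integral>\<^sup>+n. enn_powr (kernel_op a (on_slice j \<phi>) n) u \<partial>lborel) \<le>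
      ennreal (C1 * C2 powr w * exp (Q * real_of_int j * (1 - u * a))) *
      enn_powr (\<integral>\<^sup>+x. indicator (slice j) x * enn_powr (\<phi> x) p \<partial>haar_S br) (u / p)"
    if [measurable]: "\<phi> \<in> borel_measurable borel" for j \<phi>
  proof -
    let ?k = "\<lambda>x n. indicator (slice j) x * ennreal (poisson_S br x n powr \<beta>)"
    have k: "enn_powr (?k x n) s = indicator (slice j) x * ennreal (poisson_S br x n powr a)" for x n
      using s by (simp add: indicator_def \<beta>_def powr_powr)
    have K: "kernel_op a (on_slice j \<phi>) n = (\<integral>\<^sup>+x. on_slice j \<phi> x * enn_powr (?k x n) (1 / u + 1 - 1 / p) \<partial>haar_S br)" for n
      unfolding kernel_op_def s_def[symmetric] k
      by (intro nn_integral_cong) (auto simp: indicator_def)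
    have "(\<integral>\<^sup>+n. enn_powr (kernel_op a (on_slice j \<phi>) n) u \<partial>lborel)
      \<le> ennreal (C1 * exp (Q * real_of_int j * (1 - \<beta>))) *
        enn_powr (ennreal (C2 * exp (- Q * real_of_int j * \<beta>))) (u * (1 - 1 / p)) *
        enn_powr (\<integral>\<^sup>+x. enn_powr (on_slice j \<phi> x) p \<partial>haar_S br) (u / p)"
      unfolding K by (intro Young_kernel_inequality sigma_finite_haar_S sigma_finite_lborel pu C1 C2) measurable
    also have "ennreal (C1 * exp (Q * real_of_int j * (1 - \<beta>))) *
        enn_powr (ennreal (C2 * exp (- Q * real_of_int j * \<beta>))) (u * (1 - 1 / p)) =
      ennreal (C1 * exp (Q * real_of_int j * (1 - \<beta>)) * (C2 * exp (- Q * real_of_int j * \<beta>)) powr w)"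
      using C1(1) C2(1) by (simp add: w_def flip: ennreal_mult)
    also have "C1 * exp (Q * real_of_int j * (1 - \<beta>)) * (C2 * exp (- Q * real_of_int j * \<beta>)) powr w =
      C1 * C2 powr w * exp (Q * real_of_int j * (1 - u * a))"
    proof -
      have "u * a = (1 + w) * \<beta>" using s by (simp add: sw[symmetric] \<beta>_def)
      then have "Q * real_of_int j * (1 - \<beta>) + - Q * real_of_int j * \<beta> * w = Q * real_of_int j * (1 - u * a)"
        by (simp add: algebra_simps)
      then have "exp (Q * real_of_int j * (1 - \<beta>)) * exp (- Q * real_of_int j * \<beta> * w) = exp (Q * real_of_int j * (1 - u * a))"
        by (simp only: exp_add[symmetric])
      then show ?thesis
        using C2(1) by (simp add: powr_mult exp_powr_real)
    qed
    also have "(\<integral>\<^sup>+x. enn_powr (on_slice j \<phi> x) p \<partial>haar_S br) = (\<integral>\<^sup>+x. indicator (slice j) x * enn_powr (\<phi> x) p \<partial>haar_S br)"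
      by (intro nn_integral_cong) (auto simp: indicator_def)
    finally show ?thesis .
  qed
  then show ?thesis
    using C1(1) C2(1) by (intro exI[of _ "C1 * C2 powr w"]) auto
qed

text \<open>
  The density \<open>P\<^sub>1\<close> attains its maximum at the identity.
\<close>

lemma nn_integral_poisson_measure_le:
  assumes [measurable]: "g \<in> borel_measurable borel"
  shows "(\<integral>\<^sup>+n. g n \<partial>poisson_measure br) \<le> ennreal (poisson_const br) * (\<integral>\<^sup>+n. g n \<partial>lborel)"
proof -
  have "(\<integral>\<^sup>+n. g n \<partial>poisson_measure br) = (\<integral>\<^sup>+n. ennreal (poisson br 0 n) * g n \<partial>lborel)"
    unfolding poisson_measure_def by (subst nn_integral_density) auto
  also have "\<dots> \<le> (\<integral>\<^sup>+n. ennreal (poisson_const br) * g n \<partial>lborel)"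
    by (intro nn_integral_mono mult_right_mono ennreal_leI poisson_0_le) auto
  finally show ?thesis by (simp add: nn_integral_cmult)
qed

lemma Jensen_poisson_measure:
  assumes [measurable]: "g \<in> borel_measurable borel" and \<theta>: "0 < \<theta>" "\<theta> \<le> 1"
  shows "(\<integral>\<^sup>+n. enn_powr (g n) \<theta> \<partial>poisson_measure br) \<le>
    enn_powr (ennreal (poisson_const br) * (\<integral>\<^sup>+n. g n \<partial>lborel)) \<theta>"
proof -
  have "(\<integral>\<^sup>+n. enn_powr (g n) \<theta> \<partial>poisson_measure br) \<le> enn_powr (\<integral>\<^sup>+n. g n \<partial>poisson_measure br) \<theta>"
    using emeasure_poisson_measure \<theta> by (intro Jensen_enn_powr) auto
  also have "\<dots> \<le> enn_powr (ennreal (poisson_const br) * (\<integral>\<^sup>+n. g n \<partial>lborel)) \<theta>"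
    by (intro enn_powr_mono nn_integral_poisson_measure_le \<theta>) auto
  finally show ?thesis .
qed

text \<open>
  The off-diagonal decay. If \<open>k \<le> j\<close>, put the exponent \<open>u\<close> with \<open>1/u = a - \<epsilon>\<close> on the slice \<open>j\<close> and
  \<open>v\<close> with \<open>1/v = a + \<epsilon>\<close> on the slice \<open>k\<close>: the slice bounds then carry the factors \<open>e\<^bsup>-Q\<epsilon>j\<^esup>\<close> and
  \<open>e\<^bsup>Q\<epsilon>k\<^esup>\<close>, whose product decays in \<open>j - k\<close>. As \<open>1/u + 1/v = 2a\<close>, Hoelder's inequality controls \<open>(h\<^sub>j h\<^sub>k)\<^bsup>1/(2a)\<^esup>\<close> in
  \<open>L\<^sup>1(N)\<close>, and \<open>a \<le> 1/q\<close> allows one to pass to the smaller power \<open>q/2\<close> on the probability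
  space \<open>(N, P\<^sub>1 dn)\<close>.
\<close>

lemma kernel_op_slice_pair:
  assumes p: "1 < p" "p < q" "q \<le> 2" and a: "1 - 1 / p < a" "a \<le> 1 / q"
  shows "\<exists>C>0. \<exists>\<delta>>0. \<forall>j k \<phi>. \<phi> \<in> borel_measurable borel \<longrightarrow>
    (\<integral>\<^sup>+n. enn_powr (kernel_op a (on_slice j \<phi>) n * kernel_op a (on_slice k \<phi>) n) (q / 2) \<partial>poisson_measure br)
    \<le> ennreal (C * exp (- \<delta> * \<bar>real_of_int (j - k)\<bar>)) *
      enn_powr ((\<integral>\<^sup>+x. indicator (slice j) x * enn_powr (\<phi> x) p \<partial>haar_S br) *
        (\<integral>\<^sup>+x. indicator (slice k) x * enn_powr (\<phi> x) p \<partial>haar_S br)) (q / (2 * p))"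
proof -
  have ap: "a < 1 / p" using a p by (smt (verit) divide_strict_left_mono mult_pos_pos)
  have a0: "0 < a" using a p by (smt (verit) divide_le_eq_1)
  \<comment> \<open>Small enough for both slice bounds to be available: \<open>1/u\<close> and \<open>1/v\<close> stay strictly
    between \<open>1 - 1/p\<close> and \<open>1/p\<close>.\<close>
  define \<epsilon> where "\<epsilon> = min (a - (1 - 1 / p)) (1 / p - a) / 2"
  have \<epsilon>: "0 < \<epsilon>" "1 - 1 / p < a - \<epsilon>" "a + \<epsilon> < 1 / p"
    using a ap by (auto simp: \<epsilon>_def min_def field_simps)
  have p': "0 < 1 - 1 / p" using p by simp
  define u v where "u = 1 / (a - \<epsilon>)" and "v = 1 / (a + \<epsilon>)"
  have uv: "0 < u" "0 < v" "1 / u = a - \<epsilon>" "1 / v = a + \<epsilon>" "p < u" "p < v"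
  proof -
    show "0 < u" "0 < v" "1 / u = a - \<epsilon>" "1 / v = a + \<epsilon>"
      using \<epsilon> p' a0 by (auto simp: u_def v_def)
    show "p < v" using \<epsilon> a0 p by (simp add: v_def field_simps)
    have "0 < a - \<epsilon>" "(a - \<epsilon>) * p < 1"
    proof -
      show "0 < a - \<epsilon>" using \<epsilon> p' by simp
      have "a - \<epsilon> < 1 / p" using \<epsilon> by simp
      then show "(a - \<epsilon>) * p < 1" using p by (simp add: less_divide_eq)
    qed
    then show "p < u" by (simp add: u_def less_divide_eq mult.commute)
  qed
  obtain Cu where Cu: "0 < Cu" "\<And>j \<phi>. \<phi> \<in> borel_measurable borel \<Longrightarrow>
    (\<integral>\<^sup>+n. enn_powr (kernel_op a (on_slice j \<phi>) n) u \<partial>lborel) \<le>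
      ennreal (Cu * exp (Q * real_of_int j * (1 - u * a))) *
      enn_powr (\<integral>\<^sup>+x. indicator (slice j) x * enn_powr (\<phi> x) p \<partial>haar_S br) (u / p)"
    using kernel_op_slice_bound[of p u a] p uv \<epsilon> by auto
  obtain Cv where Cv: "0 < Cv" "\<And>j \<phi>. \<phi> \<in> borel_measurable borel \<Longrightarrow>
    (\<integral>\<^sup>+n. enn_powr (kernel_op a (on_slice j \<phi>) n) v \<partial>lborel) \<le>
      ennreal (Cv * exp (Q * real_of_int j * (1 - v * a))) *
      enn_powr (\<integral>\<^sup>+x. indicator (slice j) x * enn_powr (\<phi> x) p \<partial>haar_S br) (v / p)"
    using kernel_op_slice_bound[of p v a] p uv \<epsilon> by auto
  define \<theta> where "\<theta> = 1 / (2 * a * u)"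
  define \<eta> where "\<eta> = 1 / (2 * a * v)"
  have \<theta>e: "\<theta> = (a - \<epsilon>) / (2 * a)" "\<eta> = (a + \<epsilon>) / (2 * a)"
    using uv(3,4)[symmetric] by (simp_all add: \<theta>_def \<eta>_def)
  have \<theta>\<eta>: "0 < \<theta>" "0 < \<eta>"
    using uv a0 by (simp_all add: \<theta>_def \<eta>_def)
  have "\<theta> + \<eta> = 1"
    unfolding \<theta>e using a0 by (simp add: add_divide_distrib[symmetric])
  note \<theta>\<eta> = \<theta>\<eta> this
  define D where "D = Cu powr \<theta> * Cv powr \<eta>"
  have D: "0 < D" using Cu(1) Cv(1) by (simp add: D_def)
  define m where "m \<phi> j = (\<integral>\<^sup>+x. indicator (slice j) x * enn_powr (\<phi> x) p \<partial>haar_S br)"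
    for j and \<phi> :: "('v \<times> 'z) \<times> real \<Rightarrow> ennreal"
  define C where "C = (poisson_const br * D) powr (q * a)"
  define \<delta> where "\<delta> = Q * \<epsilon> * q / 2"
  have C: "0 < C" using D poisson_const_pos by (simp add: C_def)
  have \<delta>: "0 < \<delta>" using Q_pos \<epsilon> p by (simp add: \<delta>_def)
  have main: "(\<integral>\<^sup>+n. enn_powr (kernel_op a (on_slice j \<phi>) n * kernel_op a (on_slice k \<phi>) n) (q / 2) \<partial>poisson_measure br)
    \<le> ennreal (C * exp (- \<delta> * \<bar>real_of_int (j - k)\<bar>)) * enn_powr (m \<phi> j * m \<phi> k) (q / (2 * p))"
    if [measurable]: "\<phi> \<in> borel_measurable borel" and jk: "k \<le> j" for j k \<phi>
  proof -
    let ?h = "\<lambda>j. kernel_op a (on_slice j \<phi>)"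
    have "(\<integral>\<^sup>+n. enn_powr (?h j n * ?h k n) (1 / (2 * a)) \<partial>lborel) =
      (\<integral>\<^sup>+n. enn_powr (enn_powr (?h j n) u) \<theta> * enn_powr (enn_powr (?h k n) v) \<eta> \<partial>lborel)"
      using uv a0 by (simp add: enn_powr_mult enn_powr_powr \<theta>_def \<eta>_def)
    also have "\<dots> \<le> enn_powr (\<integral>\<^sup>+n. enn_powr (?h j n) u \<partial>lborel) \<theta> * enn_powr (\<integral>\<^sup>+n. enn_powr (?h k n) v \<partial>lborel) \<eta>"
      by (intro Hoelder_nn_integral \<theta>\<eta>) measurable
    also have "\<dots> \<le> enn_powr (ennreal (Cu * exp (Q * real_of_int j * (1 - u * a))) * enn_powr (m \<phi> j) (u / p)) \<theta> *
       enn_powr (ennreal (Cv * exp (Q * real_of_int k * (1 - v * a))) * enn_powr (m \<phi> k) (v / p)) \<eta>"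
      unfolding m_def by (intro mult_mono enn_powr_mono Cu Cv \<theta>\<eta>) auto
    also have "\<dots> = ennreal ((Cu * exp (Q * real_of_int j * (1 - u * a))) powr \<theta> * (Cv * exp (Q * real_of_int k * (1 - v * a))) powr \<eta>) *
       enn_powr (m \<phi> j * m \<phi> k) (1 / (2 * a * p))"
    proof -
      have 1: "enn_powr (ennreal X * enn_powr m (u / p)) \<theta> = ennreal (X powr \<theta>) * enn_powr m (1 / (2 * a * p))" if "0 < X" for X m
        using that \<theta>\<eta>(1) uv a0 by (subst enn_powr_mult) (simp_all add: enn_powr_powr \<theta>_def mult_ac)
      have 2: "enn_powr (ennreal X * enn_powr m (v / p)) \<eta> = ennreal (X powr \<eta>) * enn_powr m (1 / (2 * a * p))" if "0 < X" for X m
        using that \<theta>\<eta>(2) uv a0 by (subst enn_powr_mult) (simp_all add: enn_powr_powr \<eta>_def mult_ac)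
      have 3: "enn_powr (m \<phi> j * m \<phi> k) (1 / (2 * a * p)) = enn_powr (m \<phi> j) (1 / (2 * a * p)) * enn_powr (m \<phi> k) (1 / (2 * a * p))"
        using a0 p by (intro enn_powr_mult) simp
      have pos: "0 < Cu * exp (Q * real_of_int j * (1 - u * a))" "0 < Cv * exp (Q * real_of_int k * (1 - v * a))"
        using Cu(1) Cv(1) by simp_all
      show ?thesis
        unfolding 1[OF pos(1)] 2[OF pos(2)] 3 by (simp only: ennreal_mult powr_ge_zero mult_ac)
    qed
    also have "(Cu * exp (Q * real_of_int j * (1 - u * a))) powr \<theta> * (Cv * exp (Q * real_of_int k * (1 - v * a))) powr \<eta> =
      D * exp (- (Q * \<epsilon> / (2 * a)) * \<bar>real_of_int (j - k)\<bar>)"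
    proof -
      have 1: "(1 - u * a) * \<theta> = - \<epsilon> / (2 * a)" "(1 - v * a) * \<eta> = \<epsilon> / (2 * a)"
      proof -
        have "(1 - u * a) * \<theta> = \<theta> - 1 / 2" using uv a0 by (simp add: \<theta>_def field_simps)
        then show "(1 - u * a) * \<theta> = - \<epsilon> / (2 * a)" using a0 by (simp add: \<theta>e field_simps)
        have "(1 - v * a) * \<eta> = \<eta> - 1 / 2" using uv a0 by (simp add: \<eta>_def field_simps)
        then show "(1 - v * a) * \<eta> = \<epsilon> / (2 * a)" using a0 by (simp add: \<theta>e field_simps)
      qed
      have "Q * real_of_int j * ((1 - u * a) * \<theta>) + Q * real_of_int k * ((1 - v * a) * \<eta>) =
        - (Q * \<epsilon> / (2 * a)) * \<bar>real_of_int (j - k)\<bar>"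
        unfolding 1 using jk a0 by (simp add: field_simps)
      then have "exp (Q * real_of_int j * (1 - u * a) * \<theta>) * exp (Q * real_of_int k * (1 - v * a) * \<eta>) =
        exp (- (Q * \<epsilon> / (2 * a)) * \<bar>real_of_int (j - k)\<bar>)"
        by (simp only: exp_add[symmetric] mult.assoc)
      then show ?thesis
        using Cu(1) Cv(1) by (simp add: powr_mult exp_powr_real D_def mult_ac)
    qed
    finally have L: "(\<integral>\<^sup>+n. enn_powr (?h j n * ?h k n) (1 / (2 * a)) \<partial>lborel) \<le>
      ennreal (D * exp (- (Q * \<epsilon> / (2 * a)) * \<bar>real_of_int (j - k)\<bar>)) * enn_powr (m \<phi> j * m \<phi> k) (1 / (2 * a * p))" .
    have qa: "0 < q * a" "q * a \<le> 1" using a a0 p by (auto simp: field_simps)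
    have "(\<integral>\<^sup>+n. enn_powr (?h j n * ?h k n) (q / 2) \<partial>poisson_measure br) =
      (\<integral>\<^sup>+n. enn_powr (enn_powr (?h j n * ?h k n) (1 / (2 * a))) (q * a) \<partial>poisson_measure br)"
      using a0 by (simp add: enn_powr_powr)
    also have "\<dots> \<le> enn_powr (ennreal (poisson_const br) * (\<integral>\<^sup>+n. enn_powr (?h j n * ?h k n) (1 / (2 * a)) \<partial>lborel)) (q * a)"
      by (intro Jensen_poisson_measure qa) measurable
    also have "\<dots> \<le> enn_powr (ennreal (poisson_const br) * (ennreal (D * exp (- (Q * \<epsilon> / (2 * a)) * \<bar>real_of_int (j - k)\<bar>)) * enn_powr (m \<phi> j * m \<phi> k) (1 / (2 * a * p)))) (q * a)"
      by (intro enn_powr_mono mult_left_mono L qa) auto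
    also have "\<dots> = ennreal ((poisson_const br * (D * exp (- (Q * \<epsilon> / (2 * a)) * \<bar>real_of_int (j - k)\<bar>))) powr (q * a)) *
        enn_powr (m \<phi> j * m \<phi> k) (1 / (2 * a * p) * (q * a))"
      using D poisson_const_pos qa
      by (simp add: enn_powr_mult enn_powr_powr ennreal_mult powr_mult mult.assoc)
    also have "1 / (2 * a * p) * (q * a) = q / (2 * p)" using a0 by simp
    also have "(poisson_const br * (D * exp (- (Q * \<epsilon> / (2 * a)) * \<bar>real_of_int (j - k)\<bar>))) powr (q * a) =
      C * exp (- \<delta> * \<bar>real_of_int (j - k)\<bar>)"
    proof -
      have "- (Q * \<epsilon> / (2 * a)) * \<bar>real_of_int (j - k)\<bar> * (q * a) = - \<delta> * \<bar>real_of_int (j - k)\<bar>"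
        using a0 by (simp add: \<delta>_def field_simps)
      then have "exp (- (Q * \<epsilon> / (2 * a)) * \<bar>real_of_int (j - k)\<bar>) powr (q * a) = exp (- \<delta> * \<bar>real_of_int (j - k)\<bar>)"
        by (simp only: exp_powr_real)
      then show ?thesis
        using D poisson_const_pos by (simp only: C_def powr_mult mult_nonneg_nonneg exp_ge_zero less_imp_le mult.assoc)
    qed
    finally show ?thesis .
  qed
  have "(\<integral>\<^sup>+n. enn_powr (kernel_op a (on_slice j \<phi>) n * kernel_op a (on_slice k \<phi>) n) (q / 2) \<partial>poisson_measure br)
    \<le> ennreal (C * exp (- \<delta> * \<bar>real_of_int (j - k)\<bar>)) * enn_powr (m \<phi> j * m \<phi> k) (q / (2 * p))"
    if \<phi>: "\<phi> \<in> borel_measurable borel" for j k \<phi>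
  proof (cases "k \<le> j")
    case True
    then show ?thesis by (rule main[OF \<phi>])
  next
    case False
    then show ?thesis using main[OF \<phi>, of j k] by (simp add: mult.commute abs_minus_commute)
  qed
  then show ?thesis using C \<delta> unfolding m_def by blast
qed

end

section \<open>Almost orthogonality of the slices and bounds on all of S\<close>

text \<open>
  The enumeration \<open>int_decode\<close> of the integers satisfies \<open>n \<le> 2 |int_decode n| + 1\<close>, which
  reduces the two-sided series to a geometric one.
\<close>

lemma nn_integral_exp_int_finite:
  assumes "0 < \<delta>"
  shows "\<exists>D>0. (\<integral>\<^sup>+k. ennreal (exp (- \<delta> * \<bar>real_of_int k\<bar>)) \<partial>count_space UNIV) \<le> ennreal D"
proof -
  define r where "r = exp (- \<delta> / 2)"
  have r: "0 < r" "r < 1" using assms by (simp_all add: r_def)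
  have le: "real n \<le> 2 * \<bar>real_of_int (int_decode n)\<bar> + 1" for n
    by (auto simp: int_decode_def sum_decode_def elim!: evenE oddE)
  have "(\<integral>\<^sup>+k. ennreal (exp (- \<delta> * \<bar>real_of_int k\<bar>)) \<partial>count_space UNIV) =
    (\<integral>\<^sup>+n. ennreal (exp (- \<delta> * \<bar>real_of_int (int_decode n)\<bar>)) \<partial>count_space UNIV)"
    by (rule nn_integral_bij_count_space[OF bij_int_decode, symmetric])
  also have "\<dots> \<le> (\<integral>\<^sup>+n. ennreal (exp (\<delta> / 2) * r ^ n) \<partial>count_space UNIV)"
  proof (intro nn_integral_mono ennreal_leI)
    fix n :: nat
    have "- \<delta> * \<bar>real_of_int (int_decode n)\<bar> \<le> \<delta> / 2 + real n * (- \<delta> / 2)"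
      using mult_left_mono[OF le[of n], of "\<delta>"] assms by (simp add: field_simps)
    then have "exp (- \<delta> * \<bar>real_of_int (int_decode n)\<bar>) \<le> exp (\<delta> / 2 + real n * (- \<delta> / 2))" by simp
    also have "\<dots> = exp (\<delta> / 2) * r ^ n" by (simp only: exp_add exp_of_nat_mult r_def)
    finally show "exp (- \<delta> * \<bar>real_of_int (int_decode n)\<bar>) \<le> exp (\<delta> / 2) * r ^ n" .
  qed
  also have "\<dots> = (\<Sum>n. ennreal (exp (\<delta> / 2) * r ^ n))"
    by (simp add: nn_integral_count_space_nat)
  also have "\<dots> = ennreal (exp (\<delta> / 2) * (1 / (1 - r)))"
    using r by (intro suminf_ennreal_eq sums_mult geometric_sums) auto
  finally show ?thesis using r by (intro exI[of _ "exp (\<delta> / 2) * (1 / (1 - r))"]) simp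
qed

lemma nn_integral_int_shift:
  fixes g :: "int \<Rightarrow> ennreal"
  shows "(\<integral>\<^sup>+k. g (j - k) \<partial>count_space UNIV) = (\<integral>\<^sup>+k. g k \<partial>count_space UNIV)"
    and "(\<integral>\<^sup>+k. g (k - j) \<partial>count_space UNIV) = (\<integral>\<^sup>+k. g k \<partial>count_space UNIV)"
proof -
  have "bij_betw (\<lambda>k. j - k) UNIV (UNIV :: int set)"
    by (rule bij_betwI[where g="\<lambda>k. j - k"]) auto
  then show "(\<integral>\<^sup>+k. g (j - k) \<partial>count_space UNIV) = (\<integral>\<^sup>+k. g k \<partial>count_space UNIV)"
    by (rule nn_integral_bij_count_space)
  have "bij_betw (\<lambda>k. k - j) UNIV (UNIV :: int set)"
    by (rule bij_betwI[where g="\<lambda>k. k + j"]) auto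
  then show "(\<integral>\<^sup>+k. g (k - j) \<partial>count_space UNIV) = (\<integral>\<^sup>+k. g k \<partial>count_space UNIV)"
    by (rule nn_integral_bij_count_space)
qed

text \<open>
  An analogue of the Cotlar-Stein lemma for nonnegative functions in \<open>L\<^sup>q\<close> with \<open>q \<le> 2\<close>. The
  square of \<open>\<Sum> h\<^sub>j\<close> is the double sum of the products \<open>h\<^sub>j h\<^sub>k\<close>, and the power \<open>q/2 \<le> 1\<close> may be
  taken inside that sum. The kernel \<open>d (j - k)\<close> is then summed by Schur's test.
\<close>

lemma almost_orthogonal_sum:
  fixes h :: "int \<Rightarrow> 'a \<Rightarrow> ennreal" and m :: "int \<Rightarrow> ennreal"
  assumes [measurable]: "\<And>j. h j \<in> borel_measurable M" and q: "0 < q" "q \<le> 2"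
    and D: "(\<integral>\<^sup>+k. d k \<partial>count_space UNIV) \<le> D"
    and pair: "\<And>j k. (\<integral>\<^sup>+n. enn_powr (h j n * h k n) (q / 2) \<partial>M) \<le> d (j - k) * (m j + m k)"
  shows "(\<integral>\<^sup>+n. enn_powr (\<integral>\<^sup>+j. h j n \<partial>count_space UNIV) q \<partial>M) \<le> 2 * D * (\<integral>\<^sup>+j. m j \<partial>count_space UNIV)"
proof -
  define c where "c = (count_space UNIV :: int measure)"
  have pt: "enn_powr (\<integral>\<^sup>+j. h j n \<partial>c) q \<le> (\<integral>\<^sup>+j. \<integral>\<^sup>+k. enn_powr (h j n * h k n) (q / 2) \<partial>c \<partial>c)" for n
  proof -
    have "enn_powr (\<integral>\<^sup>+j. h j n \<partial>c) q = enn_powr (\<integral>\<^sup>+j. h j n \<partial>c) (q / 2) * enn_powr (\<integral>\<^sup>+k. h k n \<partial>c) (q / 2)"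
      using q enn_powr_add[of "q / 2" "q / 2"] by simp
    also have "\<dots> \<le> (\<integral>\<^sup>+j. enn_powr (h j n) (q / 2) \<partial>c) * (\<integral>\<^sup>+k. enn_powr (h k n) (q / 2) \<partial>c)"
      unfolding c_def using q by (intro mult_mono enn_powr_nn_integral_count_space_le) auto
    also have "\<dots> = (\<integral>\<^sup>+j. enn_powr (h j n) (q / 2) * (\<integral>\<^sup>+k. enn_powr (h k n) (q / 2) \<partial>c) \<partial>c)"
      by (simp add: c_def nn_integral_multc)
    also have "\<dots> = (\<integral>\<^sup>+j. \<integral>\<^sup>+k. enn_powr (h j n * h k n) (q / 2) \<partial>c \<partial>c)"
      using q by (simp add: c_def enn_powr_mult nn_integral_cmult)
    finally show ?thesis .
  qed
  have shift: "(\<integral>\<^sup>+j. \<integral>\<^sup>+k. d (j - k) * m j \<partial>c \<partial>c) \<le> D * (\<integral>\<^sup>+j. m j \<partial>c)"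
    "(\<integral>\<^sup>+j. \<integral>\<^sup>+k. d (j - k) * m k \<partial>c \<partial>c) \<le> D * (\<integral>\<^sup>+j. m j \<partial>c)"
  proof -
    have "(\<integral>\<^sup>+j. \<integral>\<^sup>+k. d (j - k) * m j \<partial>c \<partial>c) = (\<integral>\<^sup>+k. d k \<partial>c) * (\<integral>\<^sup>+j. m j \<partial>c)"
      by (simp add: c_def nn_integral_multc nn_integral_int_shift nn_integral_cmult)
    then show 1: "(\<integral>\<^sup>+j. \<integral>\<^sup>+k. d (j - k) * m j \<partial>c \<partial>c) \<le> D * (\<integral>\<^sup>+j. m j \<partial>c)"
      using D by (simp add: c_def mult_right_mono)
    have "(\<integral>\<^sup>+j. \<integral>\<^sup>+k. d (j - k) * m k \<partial>c \<partial>c) = (\<integral>\<^sup>+k. \<integral>\<^sup>+j. d (j - k) * m k \<partial>c \<partial>c)"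
      unfolding c_def by (intro nn_integral_count_space_nn_integral) auto
    also have "\<dots> = (\<integral>\<^sup>+k. (\<integral>\<^sup>+j. d (j - k) \<partial>c) * m k \<partial>c)"
      by (simp add: c_def nn_integral_multc)
    finally have "(\<integral>\<^sup>+j. \<integral>\<^sup>+k. d (j - k) * m k \<partial>c \<partial>c) = (\<integral>\<^sup>+k. d k \<partial>c) * (\<integral>\<^sup>+j. m j \<partial>c)"
      by (simp add: c_def nn_integral_cmult nn_integral_int_shift)
    then show "(\<integral>\<^sup>+j. \<integral>\<^sup>+k. d (j - k) * m k \<partial>c \<partial>c) \<le> D * (\<integral>\<^sup>+j. m j \<partial>c)"
      using D by (simp add: c_def mult_right_mono)
  qed
  have "(\<integral>\<^sup>+n. enn_powr (\<integral>\<^sup>+j. h j n \<partial>c) q \<partial>M) \<le>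
    (\<integral>\<^sup>+n. \<integral>\<^sup>+j. \<integral>\<^sup>+k. enn_powr (h j n * h k n) (q / 2) \<partial>c \<partial>c \<partial>M)"
    by (intro nn_integral_mono pt)
  also have "\<dots> = (\<integral>\<^sup>+j. \<integral>\<^sup>+n. \<integral>\<^sup>+k. enn_powr (h j n * h k n) (q / 2) \<partial>c \<partial>M \<partial>c)"
  proof -
    have "(\<lambda>n. \<integral>\<^sup>+k. enn_powr (h j n * h k n) (q / 2) \<partial>c) \<in> borel_measurable M" for j
      unfolding c_def nn_integral_bij_count_space[OF bij_int_decode, symmetric] nn_integral_count_space_nat
      by measurable
    then show ?thesis unfolding c_def by (intro nn_integral_count_space_nn_integral) auto
  qed
  also have "\<dots> = (\<integral>\<^sup>+j. \<integral>\<^sup>+k. \<integral>\<^sup>+n. enn_powr (h j n * h k n) (q / 2) \<partial>M \<partial>c \<partial>c)"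
    unfolding c_def by (intro nn_integral_cong nn_integral_count_space_nn_integral) auto
  also have "\<dots> \<le> (\<integral>\<^sup>+j. \<integral>\<^sup>+k. d (j - k) * m j + d (j - k) * m k \<partial>c \<partial>c)"
    using pair by (intro nn_integral_mono) (simp add: distrib_left)
  also have "\<dots> = (\<integral>\<^sup>+j. \<integral>\<^sup>+k. d (j - k) * m j \<partial>c \<partial>c) + (\<integral>\<^sup>+j. \<integral>\<^sup>+k. d (j - k) * m k \<partial>c \<partial>c)"
    by (simp add: c_def nn_integral_add)
  also have "\<dots> \<le> D * (\<integral>\<^sup>+j. m j \<partial>c) + D * (\<integral>\<^sup>+j. m j \<partial>c)"
    by (intro add_mono shift)
  also have "\<dots> = 2 * D * (\<integral>\<^sup>+j. m j \<partial>c)" by (simp add: mult_2 distrib_right)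
  finally show ?thesis by (simp add: c_def)
qed

context h_type
begin

interpretation haar: sigma_finite_measure "haar_S br"
  by (rule sigma_finite_haar_S)

text \<open>
  The masses \<open>m\<^sub>j\<close> of \<open>\<phi>\<^sup>p\<close> on the slices add up to at most \<open>L\<close>. The estimate for pairs
  produces \<open>m\<^sub>j\<close> to the power \<open>q/p\<close>, and since \<open>q > p\<close> and \<open>m\<^sub>j \<le> L\<close>, this is at most
  a constant times \<open>m\<^sub>j\<close>.
\<close>

lemma kernel_op_strong_type:
  assumes p: "1 < p" "p < q" "q \<le> 2" and a: "1 - 1 / p < a" "a \<le> 1 / q" and L: "0 < L"
  shows "\<exists>C>0. \<forall>\<phi>. \<phi> \<in> borel_measurable borel \<longrightarrow> (\<integral>\<^sup>+x. enn_powr (\<phi> x) p \<partial>haar_S br) \<le> ennreal L \<longrightarrow>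
    (\<integral>\<^sup>+n. enn_powr (kernel_op a \<phi> n) q \<partial>poisson_measure br) \<le> ennreal C"
proof -
  obtain C \<delta> where C: "0 < C" "0 < \<delta>" and pair: "\<And>j k \<phi>. \<phi> \<in> borel_measurable borel \<Longrightarrow>
    (\<integral>\<^sup>+n. enn_powr (kernel_op a (on_slice j \<phi>) n * kernel_op a (on_slice k \<phi>) n) (q / 2) \<partial>poisson_measure br)
    \<le> ennreal (C * exp (- \<delta> * \<bar>real_of_int (j - k)\<bar>)) *
      enn_powr ((\<integral>\<^sup>+x. indicator (slice j) x * enn_powr (\<phi> x) p \<partial>haar_S br) *
        (\<integral>\<^sup>+x. indicator (slice k) x * enn_powr (\<phi> x) p \<partial>haar_S br)) (q / (2 * p))"
    using kernel_op_slice_pair[OF p a] by blast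
  obtain D where D: "0 < D" "(\<integral>\<^sup>+k. ennreal (exp (- \<delta> * \<bar>real_of_int k\<bar>)) \<partial>count_space UNIV) \<le> ennreal D"
    using nn_integral_exp_int_finite[OF C(2)] by blast
  define E where "E = L powr (q / p - 1)"
  have E: "0 < E" using L by (simp add: E_def)
  have "(\<integral>\<^sup>+n. enn_powr (kernel_op a \<phi> n) q \<partial>poisson_measure br) \<le> ennreal (2 * (C * E * D) * L)"
    if [measurable]: "\<phi> \<in> borel_measurable borel" and \<phi>: "(\<integral>\<^sup>+x. enn_powr (\<phi> x) p \<partial>haar_S br) \<le> ennreal L" for \<phi>
  proof -
    define m where "m j = (\<integral>\<^sup>+x. indicator (slice j) x * enn_powr (\<phi> x) p \<partial>haar_S br)" for j
    have sum_m: "(\<integral>\<^sup>+j. m j \<partial>count_space UNIV) \<le> ennreal L"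
      unfolding m_def by (subst nn_integral_slices[symmetric]) (use \<phi> in auto)
    have mL: "m j \<le> ennreal L" for j
      using nn_integral_ge_point[of j UNIV m] sum_m by simp
    have me: "enn_powr (m j) (q / p) \<le> ennreal E * m j" for j
    proof -
      have qp: "0 < q / p - 1" using p by (simp add: field_simps)
      have "enn_powr (m j) (q / p) = m j * enn_powr (m j) (q / p - 1)"
        using enn_powr_add[of 1 "q / p - 1" "m j"] qp by simp
      also have "\<dots> \<le> m j * enn_powr (ennreal L) (q / p - 1)"
        by (intro mult_left_mono enn_powr_mono mL qp) auto
      finally show ?thesis using L by (simp add: E_def mult.commute)
    qed
    have "(\<integral>\<^sup>+n. enn_powr (\<integral>\<^sup>+j. kernel_op a (on_slice j \<phi>) n \<partial>count_space UNIV) q \<partial>poisson_measure br) \<le>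
       2 * ennreal (C * E * D) * (\<integral>\<^sup>+j. m j \<partial>count_space UNIV)"
    proof (rule almost_orthogonal_sum[where d="\<lambda>k. ennreal (C * E) * ennreal (exp (- \<delta> * \<bar>real_of_int k\<bar>))"])
      show "kernel_op a (on_slice j \<phi>) \<in> borel_measurable (poisson_measure br)" for j by measurable
      have "(\<integral>\<^sup>+k. ennreal (C * E) * ennreal (exp (- \<delta> * \<bar>real_of_int k\<bar>)) \<partial>count_space UNIV) =
        ennreal (C * E) * (\<integral>\<^sup>+k. ennreal (exp (- \<delta> * \<bar>real_of_int k\<bar>)) \<partial>count_space UNIV)"
        by (intro nn_integral_cmult) auto
      also have "\<dots> \<le> ennreal (C * E) * ennreal D" by (intro mult_left_mono D) auto
      finally show "(\<integral>\<^sup>+k. ennreal (C * E) * ennreal (exp (- \<delta> * \<bar>real_of_int k\<bar>)) \<partial>count_space UNIV) \<le> ennreal (C * E * D)"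
        using C E D(1) by (simp add: ennreal_mult)
      fix j k
      have "(\<integral>\<^sup>+n. enn_powr (kernel_op a (on_slice j \<phi>) n * kernel_op a (on_slice k \<phi>) n) (q / 2) \<partial>poisson_measure br)
        \<le> ennreal (C * exp (- \<delta> * \<bar>real_of_int (j - k)\<bar>)) * enn_powr (m j * m k) ((q / p) / 2)"
        using pair[of \<phi> j k] by (simp add: m_def mult.commute)
      also have "\<dots> \<le> ennreal (C * exp (- \<delta> * \<bar>real_of_int (j - k)\<bar>)) * (enn_powr (m j) (q / p) + enn_powr (m k) (q / p))"
        using p by (intro mult_left_mono enn_powr_mult_half_le) auto
      also have "\<dots> \<le> ennreal (C * exp (- \<delta> * \<bar>real_of_int (j - k)\<bar>)) * (ennreal E * m j + ennreal E * m k)"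
        by (intro mult_left_mono add_mono me) auto
      also have "\<dots> = ennreal (C * E) * ennreal (exp (- \<delta> * \<bar>real_of_int (j - k)\<bar>)) * (m j + m k)"
        using C E by (simp add: ennreal_mult distrib_left distrib_right mult_ac)
      finally show "(\<integral>\<^sup>+n. enn_powr (kernel_op a (on_slice j \<phi>) n * kernel_op a (on_slice k \<phi>) n) (q / 2) \<partial>poisson_measure br)
        \<le> ennreal (C * E) * ennreal (exp (- \<delta> * \<bar>real_of_int (j - k)\<bar>)) * (m j + m k)" .
    qed (use p in auto)
    also have "\<dots> \<le> 2 * ennreal (C * E * D) * ennreal L"
      by (intro mult_left_mono sum_m) auto
    also have "\<dots> = ennreal (2 * (C * E * D) * L)"
      using C E D L by (simp add: ennreal_mult)
    finally show ?thesis by (simp add: kernel_op_slices[symmetric])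
  qed
  then show ?thesis using C E D L by (intro exI[of _ "2 * (C * E * D) * L"]) simp
qed

text \<open>
  Splitting \<open>\<phi> \<P>\<^sup>a = (\<phi> \<P>)\<^sup>a \<phi>\<^bsup>1-a\<^esup>\<close>, Hoelder's inequality bounds \<open>T\<^sub>a \<phi>\<close> by a constant times the power
  \<open>a\<close> of \<open>T\<^sub>1 \<phi>\<close>. The latter has bounded integral over \<open>N\<close> because \<open>\<P>(x, \<cdot>)\<close> does, and
  \<open>q a \<le> 1\<close> makes Jensen's inequality applicable.
\<close>

lemma kernel_op_L1:
  assumes a: "0 < a" "a < 1" "q * a \<le> 1" and q: "0 < q" and L: "0 < L"
  shows "\<exists>C>0. \<forall>\<phi>. \<phi> \<in> borel_measurable borel \<longrightarrow> (\<integral>\<^sup>+x. \<phi> x \<partial>haar_S br) \<le> ennreal L \<longrightarrow>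
    (\<integral>\<^sup>+n. enn_powr (kernel_op a \<phi> n) q \<partial>poisson_measure br) \<le> ennreal C"
proof -
  interpret pair_sigma_finite "lborel :: ('v \<times> 'z) measure" "haar_S br" ..
  obtain B where B: "0 < B" "\<And>t. (\<integral>\<^sup>+n. ennreal (poisson br t n powr 1) \<partial>lborel) \<le> ennreal (B * exp (Q * t * (1 - 1)))"
    using nn_integral_poisson_powr[of 1] by auto
  have P: "(\<integral>\<^sup>+n. ennreal (poisson_S br x n) \<partial>lborel) \<le> ennreal B" for x
  proof -
    obtain n1 t where x: "x = (n1, t)" by (cases x)
    have "(\<integral>\<^sup>+n. ennreal (poisson_S br x n) \<partial>lborel) = (\<integral>\<^sup>+n. ennreal (poisson br t n) \<partial>lborel)"
      unfolding x poisson_S_def prod.case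
      by (rule nn_integral_N_inverse[where f="\<lambda>n. ennreal (poisson br t n)"]) measurable
    also have "\<dots> \<le> ennreal B" using B(2)[of t] by (simp add: poisson_pos less_imp_le)
    finally show ?thesis .
  qed
  define C where "C = (poisson_const br * (B * L)) powr (q * a) * L powr (q * (1 - a))"
  have "(\<integral>\<^sup>+n. enn_powr (kernel_op a \<phi> n) q \<partial>poisson_measure br) \<le> ennreal C"
    if [measurable]: "\<phi> \<in> borel_measurable borel" and \<phi>: "(\<integral>\<^sup>+x. \<phi> x \<partial>haar_S br) \<le> ennreal L" for \<phi>
  proof -
    let ?g = "\<lambda>n. \<integral>\<^sup>+x. \<phi> x * ennreal (poisson_S br x n) \<partial>haar_S br"
    have pt: "enn_powr (kernel_op a \<phi> n) q \<le> enn_powr (?g n) (q * a) * ennreal (L powr (q * (1 - a)))" for n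
    proof -
      have "\<phi> x * ennreal (poisson_S br x n powr a) =
        enn_powr (\<phi> x * ennreal (poisson_S br x n)) a * enn_powr (\<phi> x) (1 - a)" for x
      proof -
        have "\<phi> x = enn_powr (\<phi> x) a * enn_powr (\<phi> x) (1 - a)"
          using a enn_powr_add[of a "1 - a" "\<phi> x"] by simp
        then have "\<phi> x * ennreal (poisson_S br x n powr a) =
          (enn_powr (\<phi> x) a * enn_powr (\<phi> x) (1 - a)) * ennreal (poisson_S br x n powr a)"
          by (rule arg_cong)
        also have "\<dots> = enn_powr (\<phi> x * ennreal (poisson_S br x n)) a * enn_powr (\<phi> x) (1 - a)"
          using a poisson_S_pos[of x n] by (simp add: enn_powr_mult less_imp_le mult_ac)
        finally show ?thesis .
      qed
      then have "kernel_op a \<phi> n = (\<integral>\<^sup>+x. enn_powr (\<phi> x * ennreal (poisson_S br x n)) a * enn_powr (\<phi> x) (1 - a) \<partial>haar_S br)"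
        by (simp only: kernel_op_def)
      also have "\<dots> \<le> enn_powr (?g n) a * enn_powr (\<integral>\<^sup>+x. \<phi> x \<partial>haar_S br) (1 - a)"
        using a by (intro Hoelder_nn_integral) auto
      also have "\<dots> \<le> enn_powr (?g n) a * enn_powr (ennreal L) (1 - a)"
        using a by (intro mult_left_mono enn_powr_mono \<phi>) auto
      finally have "enn_powr (kernel_op a \<phi> n) q \<le> enn_powr (enn_powr (?g n) a * enn_powr (ennreal L) (1 - a)) q"
        by (intro enn_powr_mono q)
      also have "\<dots> = enn_powr (?g n) (q * a) * ennreal (L powr (q * (1 - a)))"
        using L q by (simp add: enn_powr_mult enn_powr_powr powr_powr mult.commute)
      finally show ?thesis .
    qed
    have "(\<integral>\<^sup>+n. enn_powr (kernel_op a \<phi> n) q \<partial>poisson_measure br) \<le>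
      (\<integral>\<^sup>+n. enn_powr (?g n) (q * a) * ennreal (L powr (q * (1 - a))) \<partial>poisson_measure br)"
      by (intro nn_integral_mono pt)
    also have "\<dots> = (\<integral>\<^sup>+n. enn_powr (?g n) (q * a) \<partial>poisson_measure br) * ennreal (L powr (q * (1 - a)))"
      by (intro nn_integral_multc) measurable
    also have "(\<integral>\<^sup>+n. enn_powr (?g n) (q * a) \<partial>poisson_measure br) \<le>
      enn_powr (ennreal (poisson_const br) * (\<integral>\<^sup>+n. ?g n \<partial>lborel)) (q * a)"
      using a q by (intro Jensen_poisson_measure) auto
    also have "(\<integral>\<^sup>+n. ?g n \<partial>lborel) = (\<integral>\<^sup>+x. \<integral>\<^sup>+n. \<phi> x * ennreal (poisson_S br x n) \<partial>lborel \<partial>haar_S br)"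
      by (intro Fubini'[symmetric]) measurable
    also have "\<dots> = (\<integral>\<^sup>+x. \<phi> x * (\<integral>\<^sup>+n. ennreal (poisson_S br x n) \<partial>lborel) \<partial>haar_S br)"
      by (intro nn_integral_cong nn_integral_cmult) measurable
    also have "enn_powr (ennreal (poisson_const br) * \<dots>) (q * a) \<le> enn_powr (ennreal (poisson_const br) * (ennreal B * ennreal L)) (q * a)"
    proof (intro enn_powr_mono mult_left_mono)
      have "(\<integral>\<^sup>+x. \<phi> x * (\<integral>\<^sup>+n. ennreal (poisson_S br x n) \<partial>lborel) \<partial>haar_S br) \<le> (\<integral>\<^sup>+x. \<phi> x * ennreal B \<partial>haar_S br)"
        by (intro nn_integral_mono mult_left_mono P) auto
      also have "\<dots> = (\<integral>\<^sup>+x. \<phi> x \<partial>haar_S br) * ennreal B" by (intro nn_integral_multc) measurable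
      also have "\<dots> \<le> ennreal L * ennreal B" by (intro mult_right_mono \<phi>) auto
      finally show "(\<integral>\<^sup>+x. \<phi> x * (\<integral>\<^sup>+n. ennreal (poisson_S br x n) \<partial>lborel) \<partial>haar_S br) \<le> ennreal B * ennreal L"
        by (simp add: mult.commute)
    qed (use a q in auto)
    also have "\<dots> = ennreal ((poisson_const br * (B * L)) powr (q * a))"
      using B(1) L poisson_const_pos by (simp flip: ennreal_mult)
    finally show ?thesis by (simp add: C_def ennreal_mult mult_right_mono)
  qed
  moreover have "0 < C" using B(1) L poisson_const_pos by (simp add: C_def)
  ultimately show ?thesis by blast
qed

lemma kernel_op_add:
  assumes [measurable]: "\<phi> \<in> borel_measurable borel" "\<psi> \<in> borel_measurable borel"
  shows "kernel_op a (\<lambda>x. \<phi> x + \<psi> x) n = kernel_op a \<phi> n + kernel_op a \<psi> n"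
  unfolding kernel_op_def by (simp add: distrib_right nn_integral_add)

text \<open>
  Real interpolation with fixed target: the part of \<open>\<phi>\<close> above height 1 is in \<open>L\<^sup>1\<close>, the part below
  is in \<open>L\<^sup>r\<close>.
\<close>

lemma kernel_op_weak_type:
  assumes p: "1 < p" "p < q" "q \<le> 2" and a: "1 - 1 / q \<le> a" "a \<le> 1 / q"
  shows "\<exists>C>0. \<forall>\<phi>. \<phi> \<in> borel_measurable borel \<longrightarrow>
    (\<forall>s>0. emeasure (haar_S br) {x. ennreal s < \<phi> x} \<le> ennreal (s powr - p)) \<longrightarrow>
    (\<integral>\<^sup>+n. enn_powr (kernel_op a \<phi> n) q \<partial>poisson_measure br) \<le> ennreal C"
proof -
  \<comment> \<open>Any exponent strictly between \<open>p\<close> and \<open>q\<close> will do.\<close>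
  define r where "r = (p + q) / 2"
  have r: "1 < r" "p < r" "r < q" using p by (auto simp: r_def)
  have a0: "0 < a" "a < 1" "q * a \<le> 1"
  proof -
    have "0 < 1 - 1 / q" "1 / q < 1" using p by simp_all
    with a show "0 < a" "a < 1" by linarith+
    show "q * a \<le> 1" using a p by (simp add: field_simps)
  qed
  have q0: "0 < q" using p by simp
  have ra: "1 - 1 / r < a"
  proof -
    have "1 / q < 1 / r" using r by (simp add: frac_less2)
    with a show ?thesis by linarith
  qed
  define L1 where "L1 = 1 + 1 / (p - 1)"
  define L2 where "L2 = 1 / (1 - p / r)"
  have L: "0 < L1" "0 < L2" using p r by (auto simp: L1_def L2_def intro: add_pos_pos)
  obtain C1 where C1: "0 < C1" "\<And>\<phi>. \<phi> \<in> borel_measurable borel \<Longrightarrow> (\<integral>\<^sup>+x. \<phi> x \<partial>haar_S br) \<le> ennreal L1 \<Longrightarrow>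
    (\<integral>\<^sup>+n. enn_powr (kernel_op a \<phi> n) q \<partial>poisson_measure br) \<le> ennreal C1"
    using kernel_op_L1[OF a0 q0 L(1)] by blast
  obtain C2 where C2: "0 < C2" "\<And>\<phi>. \<phi> \<in> borel_measurable borel \<Longrightarrow> (\<integral>\<^sup>+x. enn_powr (\<phi> x) r \<partial>haar_S br) \<le> ennreal L2 \<Longrightarrow>
    (\<integral>\<^sup>+n. enn_powr (kernel_op a \<phi> n) q \<partial>poisson_measure br) \<le> ennreal C2"
    using kernel_op_strong_type[OF r(1,3) p(3) ra a(2) L(2)] by blast
  have "(\<integral>\<^sup>+n. enn_powr (kernel_op a \<phi> n) q \<partial>poisson_measure br) \<le> ennreal (2 powr q * (C1 + C2))"
    if [measurable]: "\<phi> \<in> borel_measurable borel"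
      and w: "\<forall>s>0. emeasure (haar_S br) {x. ennreal s < \<phi> x} \<le> ennreal (s powr - p)" for \<phi>
  proof (rule nn_integral_enn_powr_sum_le)
    let ?g = "\<lambda>x. if 1 < \<phi> x then \<phi> x else 0" and ?h = "\<lambda>x. if 1 < \<phi> x then 0 else \<phi> x"
    show "kernel_op a \<phi> n \<le> kernel_op a ?g n + kernel_op a ?h n" for n
      by (subst kernel_op_add[symmetric]) (auto intro!: nn_integral_mono simp: kernel_op_def)
    have "(\<integral>\<^sup>+x. ?g x \<partial>haar_S br) \<le> ennreal L1"
      unfolding L1_def using p w by (intro weak_type_large_part sigma_finite_haar_S) auto
    then show "(\<integral>\<^sup>+n. enn_powr (kernel_op a ?g n) q \<partial>poisson_measure br) \<le> ennreal C1"
      by (intro C1) measurable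
    have "(\<integral>\<^sup>+x. enn_powr (?h x) r \<partial>haar_S br) \<le> ennreal L2"
      unfolding L2_def using p r w by (intro weak_type_small_part sigma_finite_haar_S) auto
    then show "(\<integral>\<^sup>+n. enn_powr (kernel_op a ?h n) q \<partial>poisson_measure br) \<le> ennreal C2"
      by (intro C2) measurable
  qed (use p C1 C2 in auto)
  then show ?thesis using C1(1) C2(1) by (intro exI[of _ "2 powr q * (C1 + C2)"]) simp
qed

end

section \<open>The Fourier transform\<close>

text \<open>
  Replaces homogeneity: it is enough to know the estimate for every positive number
  above the norm, and the case of norm 0 needs no separate treatment.
\<close>

lemma ennreal_le_mult_of_upper_bounds:
  assumes "X < top" "0 < C" and le: "\<And>N. 0 < N \<Longrightarrow> X \<le> ennreal N \<Longrightarrow> Y \<le> ennreal (C * N)"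
  shows "Y \<le> ennreal C * X"
proof (rule ennreal_le_epsilon)
  fix e :: real assume e: "0 < e"
  obtain x where x: "X = ennreal x" "0 \<le> x" using assms(1) by (cases X) auto
  have "Y \<le> ennreal (C * (x + e / C))"
    using e assms(2) x by (intro le) (auto intro!: ennreal_leI add_nonneg_pos)
  also have "\<dots> = ennreal C * X + ennreal e"
    using e assms(2) x by (simp add: distrib_left ennreal_mult)
  finally show "Y \<le> ennreal C * X + ennreal e" .
qed

lemma Lebesgue_norm_le:
  assumes M: "emeasure M (space M) \<le> 1" and [measurable]: "G \<in> borel_measurable M"
    and FG: "\<And>x. ennreal (norm (F x)) \<le> G x"
    and G: "(\<integral>\<^sup>+x. enn_powr (G x) q \<partial>M) \<le> ennreal (K powr q)" and K: "0 < K"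
    and r: "1 \<le> r" "r \<le> q"
  shows "Lebesgue_norm M r F \<le> ennreal K"
proof -
  have "(\<integral>\<^sup>+x. ennreal (norm (F x) powr r) \<partial>M) \<le> (\<integral>\<^sup>+x. enn_powr (enn_powr (G x) q) (r / q) \<partial>M)"
  proof (intro nn_integral_mono)
    fix x
    have "ennreal (norm (F x) powr r) = enn_powr (ennreal (norm (F x))) r" by simp
    also have "\<dots> \<le> enn_powr (G x) r" using r by (intro enn_powr_mono FG) auto
    also have "\<dots> = enn_powr (enn_powr (G x) q) (r / q)" using r by (simp add: enn_powr_powr)
    finally show "ennreal (norm (F x) powr r) \<le> enn_powr (enn_powr (G x) q) (r / q)" .
  qed
  also have "\<dots> \<le> enn_powr (\<integral>\<^sup>+x. enn_powr (G x) q \<partial>M) (r / q)"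
    using r M by (intro Jensen_enn_powr) auto
  also have "\<dots> \<le> enn_powr (ennreal (K powr q)) (r / q)"
    using r by (intro enn_powr_mono G) auto
  also have "\<dots> = ennreal (K powr r)" using r by (simp add: powr_powr)
  finally have "Lebesgue_norm M r F \<le> enn_powr (ennreal (K powr r)) (1 / r)"
    unfolding Lebesgue_norm_def using r by (intro enn_powr_mono) auto
  then show ?thesis using r K by (simp add: powr_powr)
qed

context h_type
begin

interpretation haar: sigma_finite_measure "haar_S br"
  by (rule sigma_finite_haar_S)

lemma norm_poisson_power:
  "norm (poisson_power br \<zeta> x n) = poisson_S br x n powr (1 / 2 + Im \<zeta> / Q)"
proof -
  have "Re (1 / 2 - \<i> * \<zeta> / complex_of_real Q) = 1 / 2 + Im \<zeta> / Q" by simp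
  then show ?thesis
    unfolding poisson_power_def using poisson_S_pos[of x n]
    by (subst norm_powr_real_powr) (auto simp: less_imp_le)
qed

lemma measurable_poisson_power [measurable]: "(\<lambda>x. poisson_power br \<zeta> x n) \<in> borel_measurable borel"
proof -
  have "poisson_power br \<zeta> x n =
    exp ((1 / 2 - \<i> * \<zeta> / complex_of_real Q) * complex_of_real (ln (poisson_S br x n)))" for x
    using poisson_S_pos[of x n] by (simp add: poisson_power_def powr_def Ln_of_real)
  then show ?thesis by simp
qed

lemma nn_integral_norm_fourier:
  "(\<integral>\<^sup>+x. ennreal (norm (f x * poisson_power br \<zeta> x n)) \<partial>haar_S br) =
    kernel_op (1 / 2 + Im \<zeta> / Q) (\<lambda>x. ennreal (norm (f x))) n"
  unfolding kernel_op_def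
  by (intro nn_integral_cong) (simp add: norm_mult norm_poisson_power ennreal_mult)

text \<open>
  Valid for all \<open>n\<close>: where the Fourier integral diverges, \<open>fourier_S\<close> is 0.
\<close>

lemma norm_fourier_S_le:
  "ennreal (norm (fourier_S br f \<zeta> n)) \<le> kernel_op (1 / 2 + Im \<zeta> / Q) (\<lambda>x. ennreal (norm (f x))) n"
proof (cases "integrable (haar_S br) (\<lambda>x. f x * poisson_power br \<zeta> x n)")
  case True
  then show ?thesis
    unfolding nn_integral_norm_fourier[symmetric] fourier_S_def by (rule integral_norm_bound_ennreal)
qed (simp add: fourier_S_def not_integrable_integral_eq)

lemma AE_fourier_converges:
  assumes [measurable]: "f \<in> borel_measurable borel" and q: "0 < q"
    and C: "(\<integral>\<^sup>+n. enn_powr (kernel_op (1 / 2 + Im \<zeta> / Q) (\<lambda>x. ennreal (norm (f x))) n) q \<partial>poisson_measure br) \<le> ennreal C"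
  shows "AE n in lborel. fourier_converges br f \<zeta> n"
proof -
  let ?K = "kernel_op (1 / 2 + Im \<zeta> / Q) (\<lambda>x. ennreal (norm (f x)))"
  have "AE n in poisson_measure br. enn_powr (?K n) q \<noteq> \<infinity>"
    using C by (intro nn_integral_PInf_AE) (auto simp: top_unique)
  then have "AE n in lborel. ?K n \<noteq> top"
    unfolding poisson_measure_def
    by (subst (asm) AE_density) (auto simp: poisson_pos enn_powr_eq_top_iff)
  then show ?thesis
  proof eventually_elim
    case (elim n)
    have "(\<lambda>x. f x * poisson_power br \<zeta> x n) \<in> borel_measurable (haar_S br)" by measurable
    then show ?case
      unfolding fourier_converges_def using elim
      by (intro integrableI_bounded) (auto simp: nn_integral_norm_fourier less_top)
  qed
qed

text \<open>
  For \<open>p = 1\<close> the source norm dominates the \<open>L\<^sup>1\<close> norm; for \<open>p > 1\<close> it is the weak norm. The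
  division by \<open>N\<close> normalises \<open>f\<close> so that the cut at height 1 is the right one.
\<close>

lemma kernel_op_source_bound:
  assumes p: "1 \<le> p" "p < q" "q \<le> 2" and a: "1 - 1 / q \<le> a" "a \<le> 1 / q"
  shows "\<exists>C>0. \<forall>f N. f \<in> borel_measurable borel \<longrightarrow> 0 < N \<longrightarrow>
    Lorentz_norm (haar_S br) p (source_index p) f \<le> ennreal N \<longrightarrow>
    (\<integral>\<^sup>+n. enn_powr (kernel_op a (\<lambda>x. ennreal (norm (f x) / N)) n) q \<partial>poisson_measure br) \<le> ennreal C"
proof (cases "p = 1")
  case True
  have a0: "0 < a" "a < 1" "q * a \<le> 1" "0 < q"
  proof -
    have "0 < 1 - 1 / q" "1 / q < 1" using p by simp_all
    with a show "0 < a" "a < 1" by linarith+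
    show "q * a \<le> 1" "0 < q" using a p by (simp_all add: field_simps)
  qed
  obtain C where C: "0 < C" "\<And>\<phi>. \<phi> \<in> borel_measurable borel \<Longrightarrow> (\<integral>\<^sup>+x. \<phi> x \<partial>haar_S br) \<le> ennreal 1 \<Longrightarrow>
    (\<integral>\<^sup>+n. enn_powr (kernel_op a \<phi> n) q \<partial>poisson_measure br) \<le> ennreal C"
    using kernel_op_L1[OF a0, of 1] by auto
  have "(\<integral>\<^sup>+n. enn_powr (kernel_op a (\<lambda>x. ennreal (norm (f x) / N)) n) q \<partial>poisson_measure br) \<le> ennreal C"
    if [measurable]: "f \<in> borel_measurable borel" and N: "0 < N" "Lorentz_norm (haar_S br) p (source_index p) f \<le> ennreal N"
    for f :: "('v \<times> 'z) \<times> real \<Rightarrow> complex" and N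
  proof (rule C(2))
    have "(\<integral>\<^sup>+x. ennreal (norm (f x) / N) \<partial>haar_S br) = (\<integral>\<^sup>+x. ennreal (1 / N) * ennreal (norm (f x)) \<partial>haar_S br)"
      using N by (simp flip: ennreal_mult)
    also have "\<dots> = ennreal (1 / N) * (\<integral>\<^sup>+x. ennreal (norm (f x)) \<partial>haar_S br)"
      by (intro nn_integral_cmult) measurable
    also have "\<dots> \<le> ennreal (1 / N) * Lorentz_norm (haar_S br) 1 1 f"
      by (intro mult_left_mono nn_integral_le_Lorentz_norm_1_1 sigma_finite_haar_S) measurable
    also have "\<dots> \<le> ennreal (1 / N) * ennreal N"
      using N True by (intro mult_left_mono) (auto simp: source_index_def)
    also have "\<dots> = ennreal 1" using N by (simp flip: ennreal_mult)
    finally show "(\<integral>\<^sup>+x. ennreal (norm (f x) / N) \<partial>haar_S br) \<le> ennreal 1" .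
  qed measurable
  then show ?thesis using C(1) by blast
next
  case False
  then have p1: "1 < p" using p by simp
  obtain C where C: "0 < C" "\<And>\<phi>. \<phi> \<in> borel_measurable borel \<Longrightarrow>
    (\<forall>s>0. emeasure (haar_S br) {x. ennreal s < \<phi> x} \<le> ennreal (s powr - p)) \<Longrightarrow>
    (\<integral>\<^sup>+n. enn_powr (kernel_op a \<phi> n) q \<partial>poisson_measure br) \<le> ennreal C"
    using kernel_op_weak_type[OF p1 p(2,3) a] by blast
  have "(\<integral>\<^sup>+n. enn_powr (kernel_op a (\<lambda>x. ennreal (norm (f x) / N)) n) q \<partial>poisson_measure br) \<le> ennreal C"
    if [measurable]: "f \<in> borel_measurable borel" and N: "0 < N" "Lorentz_norm (haar_S br) p (source_index p) f \<le> ennreal N"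
    for f :: "('v \<times> 'z) \<times> real \<Rightarrow> complex" and N
  proof (rule C(2), safe)
    fix s :: real assume s: "0 < s"
    have "{x. ennreal s < ennreal (norm (f x) / N)} = {x \<in> space (haar_S br). ennreal (s * N) < ennreal (norm (f x))}"
      using N s by (auto simp: ennreal_less_iff field_simps)
    then have "emeasure (haar_S br) {x. ennreal s < ennreal (norm (f x) / N)} =
       emeasure (haar_S br) {x \<in> space (haar_S br). ennreal (s * N) < ennreal (norm (f x))}" by simp
    also have "\<dots> \<le> ennreal ((N / (s * N)) powr p)"
      using N s p1 by (intro Lorentz_weak_distribution) (auto simp: source_index_def)
    also have "(N / (s * N)) powr p = s powr - p"
    proof -
      have "N / (s * N) = inverse s" using N s by (simp add: field_simps)
      then show ?thesis using s by (simp add: powr_minus inverse_powr)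
    qed
    finally show "emeasure (haar_S br) {x. ennreal s < ennreal (norm (f x) / N)} \<le> ennreal (s powr - p)" .
  qed measurable
  then show ?thesis using C(1) by blast
qed

text \<open>
  Uniformity in \<open>a\<close>: according to whether \<open>\<P>(x, n)\<close> is above or below 1, its power \<open>a\<close> is at most the
  power \<open>1/q\<close> or the power \<open>1 - 1/q\<close>.
\<close>

lemma fourier_majorant_bound:
  assumes p: "1 \<le> p" "p < q" "q \<le> 2"
  shows "\<exists>C>0. \<forall>f N a. f \<in> borel_measurable borel \<longrightarrow> 0 < N \<longrightarrow>
    Lorentz_norm (haar_S br) p (source_index p) f \<le> ennreal N \<longrightarrow> 1 - 1 / q \<le> a \<longrightarrow> a \<le> 1 / q \<longrightarrow>
    (\<integral>\<^sup>+n. enn_powr (kernel_op a (\<lambda>x. ennreal (norm (f x))) n) q \<partial>poisson_measure br) \<le> ennreal ((C * N) powr q)"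
proof -
  have e: "1 - 1 / q \<le> 1 / q" using p by (simp add: field_simps)
  obtain C1 where C1: "0 < C1" "\<And>f N. f \<in> borel_measurable borel \<Longrightarrow> 0 < N \<Longrightarrow>
    Lorentz_norm (haar_S br) p (source_index p) f \<le> ennreal N \<Longrightarrow>
    (\<integral>\<^sup>+n. enn_powr (kernel_op (1 / q) (\<lambda>x. ennreal (norm (f x) / N)) n) q \<partial>poisson_measure br) \<le> ennreal C1"
    using kernel_op_source_bound[OF p e order_refl] by blast
  obtain C2 where C2: "0 < C2" "\<And>f N. f \<in> borel_measurable borel \<Longrightarrow> 0 < N \<Longrightarrow>
    Lorentz_norm (haar_S br) p (source_index p) f \<le> ennreal N \<Longrightarrow>
    (\<integral>\<^sup>+n. enn_powr (kernel_op (1 - 1 / q) (\<lambda>x. ennreal (norm (f x) / N)) n) q \<partial>poisson_measure br) \<le> ennreal C2"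
    using kernel_op_source_bound[OF p order_refl e] by blast
  define C where "C = (2 powr q * (C1 + C2)) powr (1 / q)"
  have C: "0 < C" "C powr q = 2 powr q * (C1 + C2)"
    using C1(1) C2(1) p by (auto simp: C_def powr_powr)
  have "(\<integral>\<^sup>+n. enn_powr (kernel_op a (\<lambda>x. ennreal (norm (f x))) n) q \<partial>poisson_measure br) \<le> ennreal ((C * N) powr q)"
    if [measurable]: "f \<in> borel_measurable borel"
      and N: "0 < N" "Lorentz_norm (haar_S br) p (source_index p) f \<le> ennreal N"
      and a: "1 - 1 / q \<le> a" "a \<le> 1 / q" for f :: "('v \<times> 'z) \<times> real \<Rightarrow> complex" and N a
  proof -
    let ?\<phi> = "\<lambda>x. ennreal (norm (f x) / N)"
    have scale: "kernel_op a (\<lambda>x. ennreal (norm (f x))) n = ennreal N * kernel_op a ?\<phi> n" for n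
    proof -
      have "ennreal (norm (f x)) * ennreal (poisson_S br x n powr a) = ennreal N * (?\<phi> x * ennreal (poisson_S br x n powr a))" for x
        using N by (simp add: mult.assoc flip: ennreal_mult)
      then have "kernel_op a (\<lambda>x. ennreal (norm (f x))) n =
        (\<integral>\<^sup>+x. ennreal N * (?\<phi> x * ennreal (poisson_S br x n powr a)) \<partial>haar_S br)"
        by (simp only: kernel_op_def)
      also have "\<dots> = ennreal N * kernel_op a ?\<phi> n"
        unfolding kernel_op_def by (intro nn_integral_cmult) measurable
      finally show ?thesis .
    qed
    have ends: "kernel_op a ?\<phi> n \<le> kernel_op (1 / q) ?\<phi> n + kernel_op (1 - 1 / q) ?\<phi> n" for n
    proof -
      have "poisson_S br x n powr a \<le> poisson_S br x n powr (1 / q) + poisson_S br x n powr (1 - 1 / q)" for x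
      proof (cases "1 \<le> poisson_S br x n")
        case True
        then have "poisson_S br x n powr a \<le> poisson_S br x n powr (1 / q)"
          using a by (intro powr_mono) auto
        then show ?thesis by (simp add: add_increasing2)
      next
        case False
        then have "poisson_S br x n powr a \<le> poisson_S br x n powr (1 - 1 / q)"
          using a poisson_S_pos[of x n] by (intro powr_mono') auto
        then show ?thesis by (simp add: add_increasing)
      qed
      then have "kernel_op a ?\<phi> n \<le>
        (\<integral>\<^sup>+x. ?\<phi> x * ennreal (poisson_S br x n powr (1 / q) + poisson_S br x n powr (1 - 1 / q)) \<partial>haar_S br)"
        unfolding kernel_op_def by (intro nn_integral_mono mult_left_mono ennreal_leI) auto
      also have "\<dots> = kernel_op (1 / q) ?\<phi> n + kernel_op (1 - 1 / q) ?\<phi> n"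
        unfolding kernel_op_def by (simp add: distrib_left nn_integral_add)
      finally show ?thesis .
    qed
    have "(\<integral>\<^sup>+n. enn_powr (kernel_op a ?\<phi> n) q \<partial>poisson_measure br) \<le> ennreal (2 powr q * (C1 + C2))"
      by (rule nn_integral_enn_powr_sum_le[OF _ _ _ ends C1(2) C2(2)]) (use N p C1(1) C2(1) in auto)
    then have "(\<integral>\<^sup>+n. enn_powr (kernel_op a ?\<phi> n) q \<partial>poisson_measure br) \<le> ennreal (C powr q)"
      by (simp add: C)
    then have "ennreal (N powr q) * (\<integral>\<^sup>+n. enn_powr (kernel_op a ?\<phi> n) q \<partial>poisson_measure br) \<le>
      ennreal (N powr q) * ennreal (C powr q)"
      by (intro mult_left_mono) auto
    also have "\<dots> = ennreal ((C * N) powr q)"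
      using N C(1) by (simp add: powr_mult mult.commute flip: ennreal_mult)
    also have "ennreal (N powr q) * (\<integral>\<^sup>+n. enn_powr (kernel_op a ?\<phi> n) q \<partial>poisson_measure br) =
      (\<integral>\<^sup>+n. ennreal (N powr q) * enn_powr (kernel_op a ?\<phi> n) q \<partial>poisson_measure br)"
      by (intro nn_integral_cmult[symmetric]) measurable
    also have "\<dots> = (\<integral>\<^sup>+n. enn_powr (kernel_op a (\<lambda>x. ennreal (norm (f x))) n) q \<partial>poisson_measure br)"
      using N p by (intro nn_integral_cong) (simp add: scale enn_powr_mult)
    finally show ?thesis .
  qed
  with C(1) show ?thesis by blast
qed

lemma strip_exponent:
  assumes "\<zeta> \<in> strip br q"
  shows "1 - 1 / q \<le> 1 / 2 + Im \<zeta> / Q" "1 / 2 + Im \<zeta> / Q \<le> 1 / q"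
proof -
  have "\<bar>Im \<zeta> / Q\<bar> \<le> lp_gamma q / 2"
    using assms Q_pos by (simp add: strip_def rho_def abs_divide field_simps)
  also have "lp_gamma q / 2 = 1 / q - 1 / 2" by (simp add: lp_gamma_def diff_divide_distrib)
  finally show "1 - 1 / q \<le> 1 / 2 + Im \<zeta> / Q" "1 / 2 + Im \<zeta> / Q \<le> 1 / q"
    unfolding abs_le_iff by linarith+
qed

lemma Lorentz_spaceD:
  assumes "f \<in> Lorentz_space (haar_S br) p s"
  shows "f \<in> borel_measurable borel" "Lorentz_norm (haar_S br) p s f < top"
  using assms by (auto simp: Lorentz_space_def cong: measurable_cong_sets)

lemma AE_fourier_converges_source:
  assumes p: "1 \<le> p" "p < q" "q \<le> 2"
    and f: "f \<in> Lorentz_space (haar_S br) p (source_index p)" and \<zeta>: "\<zeta> \<in> strip br q"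
  shows "AE n in lborel. fourier_converges br f \<zeta> n"
proof -
  obtain C where bound: "\<And>f N a. f \<in> borel_measurable borel \<Longrightarrow> 0 < N \<Longrightarrow>
    Lorentz_norm (haar_S br) p (source_index p) f \<le> ennreal N \<Longrightarrow> 1 - 1 / q \<le> a \<Longrightarrow> a \<le> 1 / q \<Longrightarrow>
    (\<integral>\<^sup>+n. enn_powr (kernel_op a (\<lambda>x. ennreal (norm (f x))) n) q \<partial>poisson_measure br) \<le> ennreal ((C * N) powr q)"
    using fourier_majorant_bound[OF p] by blast
  obtain x where x: "Lorentz_norm (haar_S br) p (source_index p) f = ennreal x" "0 \<le> x"
    using Lorentz_spaceD(2)[OF f] by (cases "Lorentz_norm (haar_S br) p (source_index p) f") auto
  show ?thesis
    by (rule AE_fourier_converges[OF Lorentz_spaceD(1)[OF f] _ bound[OF Lorentz_spaceD(1)[OF f] _ _ strip_exponent[OF \<zeta>], of "x + 1"]])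
      (use x p in auto)
qed

lemma fourier_Lebesgue_bound:
  assumes p: "1 \<le> p" "p < q" "q \<le> 2"
  shows "\<exists>C>0. \<forall>r f \<zeta>. 1 \<le> r \<and> r \<le> q \<and> f \<in> Lorentz_space (haar_S br) p (source_index p) \<and> \<zeta> \<in> strip br q \<longrightarrow>
    (AE n in lborel. fourier_converges br f \<zeta> n) \<and>
    Lebesgue_norm (poisson_measure br) r (fourier_S br f \<zeta>) \<le> ennreal C * Lorentz_norm (haar_S br) p (source_index p) f"
proof -
  obtain C where C: "0 < C" and bound: "\<And>f N a. f \<in> borel_measurable borel \<Longrightarrow> 0 < N \<Longrightarrow>
    Lorentz_norm (haar_S br) p (source_index p) f \<le> ennreal N \<Longrightarrow> 1 - 1 / q \<le> a \<Longrightarrow> a \<le> 1 / q \<Longrightarrow>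
    (\<integral>\<^sup>+n. enn_powr (kernel_op a (\<lambda>x. ennreal (norm (f x))) n) q \<partial>poisson_measure br) \<le> ennreal ((C * N) powr q)"
    using fourier_majorant_bound[OF p] by blast
  have "(AE n in lborel. fourier_converges br f \<zeta> n) \<and>
    Lebesgue_norm (poisson_measure br) r (fourier_S br f \<zeta>) \<le> ennreal C * Lorentz_norm (haar_S br) p (source_index p) f"
    if r: "1 \<le> r" "r \<le> q" and f: "f \<in> Lorentz_space (haar_S br) p (source_index p)" and \<zeta>: "\<zeta> \<in> strip br q" for r f \<zeta>
  proof
    note [measurable] = Lorentz_spaceD(1)[OF f]
    note fin = Lorentz_spaceD(2)[OF f]
    note b = bound[OF Lorentz_spaceD(1)[OF f] _ _ strip_exponent[OF \<zeta>]]
    show "AE n in lborel. fourier_converges br f \<zeta> n"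
      by (rule AE_fourier_converges_source[OF p f \<zeta>])
    show "Lebesgue_norm (poisson_measure br) r (fourier_S br f \<zeta>) \<le> ennreal C * Lorentz_norm (haar_S br) p (source_index p) f"
    proof (rule ennreal_le_mult_of_upper_bounds[OF fin C])
      fix N assume N: "0 < N" "Lorentz_norm (haar_S br) p (source_index p) f \<le> ennreal N"
      show "Lebesgue_norm (poisson_measure br) r (fourier_S br f \<zeta>) \<le> ennreal (C * N)"
        by (rule Lebesgue_norm_le[OF _ _ norm_fourier_S_le b[OF N]])
          (use r N C emeasure_poisson_measure in auto)
    qed
  qed
  with C show ?thesis by blast
qed

lemma fourier_Lorentz_bound:
  assumes p: "1 \<le> p" "p < q" "q < v" "v \<le> 2"
  shows "\<exists>C>0. \<forall>f \<zeta>. f \<in> Lorentz_space (haar_S br) p (source_index p) \<and> \<zeta> \<in> strip br v \<longrightarrow>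
    (AE n in lborel. fourier_converges br f \<zeta> n) \<and>
    Lorentz_norm (poisson_measure br) q 1 (fourier_S br f \<zeta>) \<le> ennreal C * Lorentz_norm (haar_S br) p (source_index p) f"
proof -
  have pv: "p < v" using p by simp
  obtain C where C: "0 < C" and bound: "\<And>f N a. f \<in> borel_measurable borel \<Longrightarrow> 0 < N \<Longrightarrow>
    Lorentz_norm (haar_S br) p (source_index p) f \<le> ennreal N \<Longrightarrow> 1 - 1 / v \<le> a \<Longrightarrow> a \<le> 1 / v \<Longrightarrow>
    (\<integral>\<^sup>+n. enn_powr (kernel_op a (\<lambda>x. ennreal (norm (f x))) n) v \<partial>poisson_measure br) \<le> ennreal ((C * N) powr v)"
    using fourier_majorant_bound[OF p(1) pv p(4)] by blast
  define E where "E = 1 / q / (1 / q - 1 / v)"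
  have E: "0 < E" using p by (simp add: E_def field_simps)
  have "Lorentz_norm (poisson_measure br) q 1 (fourier_S br f \<zeta>) \<le> ennreal (E * C) * Lorentz_norm (haar_S br) p (source_index p) f"
    if f: "f \<in> Lorentz_space (haar_S br) p (source_index p)" and \<zeta>: "\<zeta> \<in> strip br v" for f \<zeta>
  proof (rule ennreal_le_mult_of_upper_bounds)
    note [measurable] = Lorentz_spaceD(1)[OF f]
    show "Lorentz_norm (haar_S br) p (source_index p) f < top" by (rule Lorentz_spaceD(2)[OF f])
    show "0 < E * C" using C E by simp
    fix N assume N: "0 < N" "Lorentz_norm (haar_S br) p (source_index p) f \<le> ennreal N"
    have "Lorentz_norm (poisson_measure br) q 1 (fourier_S br f \<zeta>) \<le> ennreal (1 / q / (1 / q - 1 / v) * (C * N))"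
      by (rule Lorentz_norm_q_1_le[OF _ _ norm_fourier_S_le bound[OF Lorentz_spaceD(1)[OF f] N strip_exponent[OF \<zeta>]]])
        (use p N C emeasure_poisson_measure in auto)
    then show "Lorentz_norm (poisson_measure br) q 1 (fourier_S br f \<zeta>) \<le> ennreal (E * C * N)"
      by (simp add: E_def mult.assoc)
  qed
  then show ?thesis
    using AE_fourier_converges_source[OF p(1) pv p(4)] C E by (intro exI[of _ "E * C"]) auto
qed

text \<open>
  The width of the strip depends continuously on its index. Let \<open>y = |Im \<zeta>| / \<rho>\<close>, and
  let \<open>w\<close> be half way between \<open>y\<close> and \<open>\<gamma>\<^sub>q\<close>; then \<open>v = 2 / (1 + w)\<close> is the index with
  \<open>\<gamma>\<^sub>v = w\<close>.
\<close>

lemma interior_strip_subset: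
  assumes q: "1 \<le> q" "q < 2" and \<zeta>: "\<zeta> \<in> interior (strip br q)"
  obtains v where "q < v" "v \<le> 2" "\<zeta> \<in> strip br v"
proof -
  have \<rho>: "0 < rho br" using Q_pos by (simp add: rho_def)
  obtain e where e: "0 < e" "ball \<zeta> e \<subseteq> strip br q"
    using \<zeta> by (meson interior_subset mem_interior)
  \<comment> \<open>Moving \<open>\<zeta>\<close> by \<open>e/2\<close> away from the real axis shows that \<open>|Im \<zeta>|\<close> stays below the width
    of the strip by a definite amount.\<close>
  define \<zeta>' where "\<zeta>' = \<zeta> + \<i> * complex_of_real ((if 0 \<le> Im \<zeta> then 1 else - 1) * (e / 2))"
  have "dist \<zeta> \<zeta>' < e"
    using e by (simp add: \<zeta>'_def dist_norm norm_mult)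
  then have "\<zeta>' \<in> strip br q" using e by auto
  then have "\<bar>Im \<zeta>\<bar> + e / 2 \<le> lp_gamma q * rho br"
    using e by (auto simp: strip_def \<zeta>'_def split: if_splits)
  then have g: "\<bar>Im \<zeta>\<bar> / rho br < lp_gamma q"
    using e \<rho> by (simp add: divide_less_eq)
  define y where "y = \<bar>Im \<zeta>\<bar> / rho br"
  define w where "w = (y + lp_gamma q) / 2"
  have "0 \<le> y" using \<rho> by (simp add: y_def)
  then have w: "0 < w" "w < lp_gamma q" "y \<le> w"
    using g unfolding w_def y_def[symmetric] by (simp_all add: field_simps)
  show ?thesis
  proof (rule that[of "2 / (1 + w)"])
    show "q < 2 / (1 + w)" using w q by (simp add: lp_gamma_def field_simps)
    show "2 / (1 + w) \<le> 2" using w by (simp add: divide_le_eq)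
    have "lp_gamma (2 / (1 + w)) = w" using w by (simp add: lp_gamma_def add_divide_distrib)
    then show "\<zeta> \<in> strip br (2 / (1 + w))" using w \<rho> by (simp add: strip_def y_def divide_le_eq)
  qed
qed

end

theorem corollary3p4:
  fixes br :: "'v::euclidean_space \<times> 'z::euclidean_space \<Rightarrow> 'v \<times> 'z \<Rightarrow> 'v \<times> 'z"
  assumes "h_type br"
  shows
    "(\<forall>p q. 1 \<le> p \<and> p < q \<and> q \<le> 2 \<longrightarrow>
        (\<exists>C::real. \<forall>r f \<zeta>. 1 \<le> r \<and> r \<le> q \<and>
            f \<in> Lorentz_space (haar_S br) p (source_index p) \<and> \<zeta> \<in> strip br q \<longrightarrow>
          (AE n in lborel. fourier_converges br f \<zeta> n) \<and>
          Lebesgue_norm (poisson_measure br) r (fourier_S br f \<zeta>)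
            \<le> ennreal C * Lorentz_norm (haar_S br) p (source_index p) f))
     \<and>
     (\<forall>p q. 1 \<le> p \<and> p < q \<and> q < 2 \<longrightarrow>
        (\<forall>\<zeta> \<in> interior (strip br q). \<exists>C::real.
          \<forall>f \<in> Lorentz_space (haar_S br) p (source_index p).
            (AE n in lborel. fourier_converges br f \<zeta> n) \<and>
            Lorentz_norm (poisson_measure br) q 1 (fourier_S br f \<zeta>)
              \<le> ennreal C * Lorentz_norm (haar_S br) p (source_index p) f))
     \<and>
     (\<forall>p q q1. 1 \<le> p \<and> p < q \<and> q < q1 \<and> q1 \<le> 2 \<longrightarrow>
        (\<exists>C::real. \<forall>f \<in> Lorentz_space (haar_S br) p (source_index p). \<forall>s::real.
          (AE n in lborel.
            fourier_converges br f (complex_of_real s + \<i> * complex_of_real (lp_gamma q1 * rho br)) n) \<and>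
          Lorentz_norm (poisson_measure br) q 1
              (fourier_S br f (complex_of_real s + \<i> * complex_of_real (lp_gamma q1 * rho br)))
            \<le> ennreal C * Lorentz_norm (haar_S br) p (source_index p) f))"
proof -
  interpret h_type br by fact
  have a: "\<exists>C::real. \<forall>r f \<zeta>. 1 \<le> r \<and> r \<le> q \<and>
      f \<in> Lorentz_space (haar_S br) p (source_index p) \<and> \<zeta> \<in> strip br q \<longrightarrow>
    (AE n in lborel. fourier_converges br f \<zeta> n) \<and>
    Lebesgue_norm (poisson_measure br) r (fourier_S br f \<zeta>)
      \<le> ennreal C * Lorentz_norm (haar_S br) p (source_index p) f"
    if "1 \<le> p \<and> p < q \<and> q \<le> 2" for p q
    using fourier_Lebesgue_bound[of p q] that by blast
  have b: "\<exists>C::real. \<forall>f \<in> Lorentz_space (haar_S br) p (source_index p).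
      (AE n in lborel. fourier_converges br f \<zeta> n) \<and>
      Lorentz_norm (poisson_measure br) q 1 (fourier_S br f \<zeta>)
        \<le> ennreal C * Lorentz_norm (haar_S br) p (source_index p) f"
    if pq: "1 \<le> p \<and> p < q \<and> q < 2" and \<zeta>: "\<zeta> \<in> interior (strip br q)" for p q \<zeta>
  proof -
    obtain v where v: "q < v" "v \<le> 2" "\<zeta> \<in> strip br v"
      by (rule interior_strip_subset[OF _ _ \<zeta>]) (use pq in auto)
    obtain C where "\<forall>f \<zeta>. f \<in> Lorentz_space (haar_S br) p (source_index p) \<and> \<zeta> \<in> strip br v \<longrightarrow>
      (AE n in lborel. fourier_converges br f \<zeta> n) \<and>
      Lorentz_norm (poisson_measure br) q 1 (fourier_S br f \<zeta>)
        \<le> ennreal C * Lorentz_norm (haar_S br) p (source_index p) f"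
      using fourier_Lorentz_bound[of p q v] pq v by blast
    then show ?thesis using v by blast
  qed
  have c: "\<exists>C::real. \<forall>f \<in> Lorentz_space (haar_S br) p (source_index p). \<forall>s::real.
      (AE n in lborel.
        fourier_converges br f (complex_of_real s + \<i> * complex_of_real (lp_gamma q1 * rho br)) n) \<and>
      Lorentz_norm (poisson_measure br) q 1
          (fourier_S br f (complex_of_real s + \<i> * complex_of_real (lp_gamma q1 * rho br)))
        \<le> ennreal C * Lorentz_norm (haar_S br) p (source_index p) f"
    if pq: "1 \<le> p \<and> p < q \<and> q < q1 \<and> q1 \<le> 2" for p q q1
  proof -
    have strip: "complex_of_real s + \<i> * complex_of_real (lp_gamma q1 * rho br) \<in> strip br q1" for s
    proof -
      have "0 \<le> lp_gamma q1" using pq by (simp add: lp_gamma_def field_simps)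
      moreover have "0 \<le> rho br" using Q_pos by (simp add: rho_def)
      ultimately show ?thesis by (simp add: strip_def)
    qed
    obtain C where "\<forall>f \<zeta>. f \<in> Lorentz_space (haar_S br) p (source_index p) \<and> \<zeta> \<in> strip br q1 \<longrightarrow>
      (AE n in lborel. fourier_converges br f \<zeta> n) \<and>
      Lorentz_norm (poisson_measure br) q 1 (fourier_S br f \<zeta>)
        \<le> ennreal C * Lorentz_norm (haar_S br) p (source_index p) f"
      using fourier_Lorentz_bound[of p q q1] pq by blast
    then show ?thesis using strip by blast
  qed
  show ?thesis using a b c by blast
qed

end
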